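(* Let $R$ be a ring with unity, let $\mathcal{X}$ be a semibrick of left $R$-modules, and let $M,N\in\mathrm{Filt}(\mathcal{X})$ with $\mathcal{X}$-socle filtrations $(M_\lambda,\lambda\le\mu)$ and $(N_\omega,\omega\le\nu)$. Let $f\in\mathrm{Hom}_R(M,N)$ be a homomorphism. (a) If two submodules of $N$ lie in $\mathrm{Filt}(\mathcal{X})$, then both their sum and their intersection also belong to $\mathrm{Filt}(\mathcal{X})$. (b) The filtration $(\mathrm{Im}\,f\cap N_\lambda,\ \lambda\le\mu)$ is the $\mathcal{X}$-socle filtration of $\mathrm{Im}\,f$. (c) The cokernel of $f$ lies in $\mathrm{Filt}(\mathcal{X})$.
   Context: A brick is a finitely presented left $R$-module whose endomorphism ring is a division ring. A semibrick is a class $\mathcal{X}$ of pairwise non-isomorphic bricks with $\mathrm{Hom}(X,X')=0$ for distinct $X,X'\in\mathcal{X}$. A filtration of a module $M$ is an ascending chain $(M_\lambda,\lambda\le\mu)$ of submodules ($\mu$ an ordinal) with $M_0=0$, $M_\mu=M$ and $M_\nu=\bigcup_{\lambda<\nu}M_\lambda$ for limit ordinals $\nu\le\mu$. It is an $\mathcal{X}$-filtration if each $M_{\lambda+1}/M_\lambda$ ($\lambda<\mu$) is isomorphic to a module in $\mathcal{X}$. $\mathrm{Filt}(\mathcal{X})$ is the class of modules admitting an $\mathcal{X}$-filtration. For a module $N$ put $\mathrm{soc}_{\mathcal{X}}N=\sum_{X\in\mathcal{X},\,f\in\mathrm{Hom}(X,N)}\mathrm{Im}\,f$. The $\mathcal{X}$-socle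 filtration $(V_\lambda,\lambda\le\mu)$ of $M\in\mathrm{Filt}(\mathcal{X})$ is defined inductively by $V_0=0$, $V_{\lambda+1}$ the preimage of $\mathrm{soc}_{\mathcal{X}}(M/V_\lambda)$ under $M\to M/V_\lambda$, and $V_\lambda=\bigcup_{\alpha<\lambda}V_\alpha$ for limit ordinals $\lambda$, up to an ordinal $\mu$ with $V_\mu=M$. Convention: socle filtrations are continued by constant terms, i.e. $V_\lambda=M$ for all $\lambda$ beyond the length (so $N_\lambda=N$ for $\lambda>\nu$), and filtrations that agree up to such constant terms are identified. *)

theory Defs
  imports "HOL-Algebra.Module" "HOL-Algebra.AbelCoset" "HOL-Algebra.Generated_Groups"
begin

section \<open>Left modules over a noncommutative ring\<close>

text \<open>The library locale \<^locale>\<open>module\<close> requires a commutative ring of scalars. We reuse its record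
  type and drop commutativity; the record fields for a multiplication and a unit on the module
  carry no meaning.\<close>

locale left_module = R?: ring R + M?: abelian_group M
  for R :: "'a ring" (structure) and M :: "('a, 'm) module" (structure) +
  assumes smult_closed [simp, intro]:
      "\<lbrakk>a \<in> carrier R; x \<in> carrier M\<rbrakk> \<Longrightarrow> a \<odot>\<^bsub>M\<^esub> x \<in> carrier M"
    and smult_l_distr:
      "\<lbrakk>a \<in> carrier R; b \<in> carrier R; x \<in> carrier M\<rbrakk> \<Longrightarrow>
        (a \<oplus> b) \<odot>\<^bsub>M\<^esub> x = a \<odot>\<^bsub>M\<^esub> x \<oplus>\<^bsub>M\<^esub> b \<odot>\<^bsub>M\<^esub> x"
    and smult_r_distr:
      "\<lbrakk>a \<in> carrier R; x \<in> carrier M; y \<in> carrier M\<rbrakk> \<Longrightarrow>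
        a \<odot>\<^bsub>M\<^esub> (x \<oplus>\<^bsub>M\<^esub> y) = a \<odot>\<^bsub>M\<^esub> x \<oplus>\<^bsub>M\<^esub> a \<odot>\<^bsub>M\<^esub> y"
    and smult_assoc1:
      "\<lbrakk>a \<in> carrier R; b \<in> carrier R; x \<in> carrier M\<rbrakk> \<Longrightarrow>
        (a \<otimes> b) \<odot>\<^bsub>M\<^esub> x = a \<odot>\<^bsub>M\<^esub> (b \<odot>\<^bsub>M\<^esub> x)"
    and smult_one [simp]:
      "x \<in> carrier M \<Longrightarrow> \<one> \<odot>\<^bsub>M\<^esub> x = x"

definition mod_hom ::
  "'a ring \<Rightarrow> ('a, 'm) module \<Rightarrow> ('a, 'n) module \<Rightarrow> ('m \<Rightarrow> 'n) set"
  where "mod_hom R M N = {h \<in> hom (add_monoid M) (add_monoid N).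
    \<forall>a\<in>carrier R. \<forall>x\<in>carrier M. h (a \<odot>\<^bsub>M\<^esub> x) = a \<odot>\<^bsub>N\<^esub> h x}"

definition mod_isomorphic :: "'a ring \<Rightarrow> ('a, 'm) module \<Rightarrow> ('a, 'n) module \<Rightarrow> bool"
  where "mod_isomorphic R M N \<longleftrightarrow> (\<exists>h\<in>mod_hom R M N. bij_betw h (carrier M) (carrier N))"

definition quot_module :: "('a, 'm) module \<Rightarrow> 'm set \<Rightarrow> ('a, 'm set) module"
  where "quot_module M H =
    \<lparr>carrier = a_rcosets\<^bsub>M\<^esub> H, mult = undefined, one = undefined, zero = H, add = set_add M,
      smult = (\<lambda>a C. \<Union>x\<in>C. H +>\<^bsub>M\<^esub> (a \<odot>\<^bsub>M\<^esub> x))\<rparr>"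

lemma (in left_module) quot_module_is_left_module:
  assumes "submodule H R M"
  shows "left_module R (quot_module M H)"
proof -
  interpret H: submodule H R M by fact
  have subM: "subgroup H (add_monoid M)" ..
  then have as: "abelian_subgroup H M"
    by (intro abelian_subgroupI3 additive_subgroup.intro M.abelian_group_axioms)
  interpret H: abelian_subgroup H M by fact
  have Hc: "H \<subseteq> carrier M" by (rule H.a_subset)
  have sm: "(\<Union>y\<in>H +>\<^bsub>M\<^esub> x. H +>\<^bsub>M\<^esub> (a \<odot>\<^bsub>M\<^esub> y)) = H +>\<^bsub>M\<^esub> (a \<odot>\<^bsub>M\<^esub> x)"
    if a: "a \<in> carrier R" and x: "x \<in> carrier M" for a x
  proof -
    have "H +>\<^bsub>M\<^esub> (a \<odot>\<^bsub>M\<^esub> y) = H +>\<^bsub>M\<^esub> (a \<odot>\<^bsub>M\<^esub> x)" if yH: "y \<in> H +>\<^bsub>M\<^esub> x" for y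
    proof -
      obtain h where h: "h \<in> H" "y = h \<oplus>\<^bsub>M\<^esub> x" using yH by (auto simp: a_r_coset_def')
      have "a \<odot>\<^bsub>M\<^esub> y = a \<odot>\<^bsub>M\<^esub> h \<oplus>\<^bsub>M\<^esub> a \<odot>\<^bsub>M\<^esub> x" using h a x Hc by (auto simp: smult_r_distr)
      moreover have "a \<odot>\<^bsub>M\<^esub> h \<in> H" using submodule.smult_closed[OF assms] a h by blast
      ultimately have "a \<odot>\<^bsub>M\<^esub> y \<in> H +>\<^bsub>M\<^esub> (a \<odot>\<^bsub>M\<^esub> x)" by (auto simp: a_r_coset_def')
      then show ?thesis using a x subM
        by (metis M.a_repr_independence smult_closed)
    qed
    moreover have "x \<in> H +>\<^bsub>M\<^esub> x" using x H.a_rcos_self by blast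
    ultimately show ?thesis by blast
  qed
  have cs: "(C \<in> carrier (quot_module M H)) = (\<exists>x\<in>carrier M. C = H +>\<^bsub>M\<^esub> x)" for C
    by (auto simp: quot_module_def A_RCOSETS_def')
  have add: "(H +>\<^bsub>M\<^esub> x) \<oplus>\<^bsub>quot_module M H\<^esub> (H +>\<^bsub>M\<^esub> y) = H +>\<^bsub>M\<^esub> (x \<oplus>\<^bsub>M\<^esub> y)"
    if "x \<in> carrier M" "y \<in> carrier M" for x y
    using that H.a_rcos_sum by (simp add: quot_module_def)
  have z: "\<zero>\<^bsub>quot_module M H\<^esub> = H +>\<^bsub>M\<^esub> \<zero>\<^bsub>M\<^esub>"
    using Hc by (simp add: quot_module_def)
  have s: "a \<odot>\<^bsub>quot_module M H\<^esub> (H +>\<^bsub>M\<^esub> x) = H +>\<^bsub>M\<^esub> (a \<odot>\<^bsub>M\<^esub> x)"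
    if "a \<in> carrier R" "x \<in> carrier M" for a x
    using sm[OF that] by (simp add: quot_module_def)
  have ag: "abelian_group (quot_module M H)"
  proof (rule abelian_groupI)
    fix C assume "C \<in> carrier (quot_module M H)"
    then obtain x where "x \<in> carrier M" "C = H +>\<^bsub>M\<^esub> x" by (auto simp: cs)
    then show "\<exists>D\<in>carrier (quot_module M H). D \<oplus>\<^bsub>quot_module M H\<^esub> C = \<zero>\<^bsub>quot_module M H\<^esub>"
      by (intro bexI[of _ "H +>\<^bsub>M\<^esub> (\<ominus>\<^bsub>M\<^esub> x)"]) (auto simp: cs add z M.l_neg)
  qed (auto simp: cs z, (auto simp: add M.a_ac)+)
  show ?thesis
  proof (intro left_module.intro left_module_axioms.intro ag R.ring_axioms)
  qed (auto simp: cs add s smult_l_distr smult_r_distr smult_assoc1)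
qed

definition free_left_module :: "'a ring \<Rightarrow> nat \<Rightarrow> ('a, nat \<Rightarrow> 'a) module"
  where "free_left_module R n =
    \<lparr>carrier = {..<n} \<rightarrow>\<^sub>E carrier R, mult = undefined, one = undefined,
      zero = (\<lambda>i\<in>{..<n}. \<zero>\<^bsub>R\<^esub>), add = (\<lambda>x y. \<lambda>i\<in>{..<n}. x i \<oplus>\<^bsub>R\<^esub> y i),
      smult = (\<lambda>a x. \<lambda>i\<in>{..<n}. a \<otimes>\<^bsub>R\<^esub> x i)\<rparr>"

text \<open>Existence of an exact sequence $R^m \to R^n \to M \to 0$.\<close>

definition fin_presented :: "'a ring \<Rightarrow> ('a, 'm) module \<Rightarrow> bool"
  where "fin_presented R M \<longleftrightarrow> left_module R M \<and>
    (\<exists>m n g h. g \<in> mod_hom R (free_left_module R m) (free_left_module R n) \<and>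
      h \<in> mod_hom R (free_left_module R n) M \<and>
      h ` carrier (free_left_module R n) = carrier M \<and>
      {x \<in> carrier (free_left_module R n). h x = \<zero>\<^bsub>M\<^esub>} = g ` carrier (free_left_module R m))"


section \<open>Semibricks\<close>

text \<open>Endomorphisms are taken extensional, so that equal endomorphisms are equal functions.\<close>

definition End_ring :: "'a ring \<Rightarrow> ('a, 'm) module \<Rightarrow> ('m \<Rightarrow> 'm) ring"
  where "End_ring R M =
    \<lparr>carrier = mod_hom R M M \<inter> extensional (carrier M),
      mult = compose (carrier M), one = (\<lambda>x\<in>carrier M. x),
      zero = (\<lambda>x\<in>carrier M. \<zero>\<^bsub>M\<^esub>), add = (\<lambda>g h. \<lambda>x\<in>carrier M. g x \<oplus>\<^bsub>M\<^esub> h x)\<rparr>"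

lemma (in left_module) End_ring_is_ring: "ring (End_ring R M)"
proof -
  have zero: "a \<odot>\<^bsub>M\<^esub> \<zero>\<^bsub>M\<^esub> = \<zero>\<^bsub>M\<^esub>" if "a \<in> carrier R" for a
    using smult_r_distr[OF that M.zero_closed M.zero_closed] that
    by (metis M.add.r_cancel_one' M.l_zero M.zero_closed smult_closed)
  have neg: "a \<odot>\<^bsub>M\<^esub> (\<ominus>\<^bsub>M\<^esub> x) = \<ominus>\<^bsub>M\<^esub> (a \<odot>\<^bsub>M\<^esub> x)" if "a \<in> carrier R" "x \<in> carrier M" for a x
    using smult_r_distr[OF that(1) M.a_inv_closed[OF that(2)] that(2)] that zero
    by (metis M.a_inv_closed M.l_neg M.minus_equality smult_closed)
  have E: "g \<in> carrier (End_ring R M) \<longleftrightarrow> g \<in> extensional (carrier M) \<and>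
     (\<forall>x\<in>carrier M. g x \<in> carrier M) \<and> (\<forall>x\<in>carrier M. \<forall>y\<in>carrier M. g (x \<oplus>\<^bsub>M\<^esub> y) = g x \<oplus>\<^bsub>M\<^esub> g y)
     \<and> (\<forall>a\<in>carrier R. \<forall>x\<in>carrier M. g (a \<odot>\<^bsub>M\<^esub> x) = a \<odot>\<^bsub>M\<^esub> g x)" for g
    by (auto simp: End_ring_def mod_hom_def hom_def)
  have ag: "abelian_group (End_ring R M)"
  proof (rule abelian_groupI)
    fix g assume "g \<in> carrier (End_ring R M)"
    then have g: "\<And>x. x \<in> carrier M \<Longrightarrow> g x \<in> carrier M" and
      "(\<lambda>x\<in>carrier M. \<ominus>\<^bsub>M\<^esub> g x) \<in> carrier (End_ring R M)"
      by (auto simp: E M.minus_add neg)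
    then show "\<exists>h\<in>carrier (End_ring R M). h \<oplus>\<^bsub>End_ring R M\<^esub> g = \<zero>\<^bsub>End_ring R M\<^esub>"
      by (intro bexI[of _ "\<lambda>x\<in>carrier M. \<ominus>\<^bsub>M\<^esub> g x"])
         (auto simp: End_ring_def fun_eq_iff M.l_neg)
  qed (auto simp: E, auto simp: End_ring_def M.a_ac smult_r_distr zero fun_eq_iff extensional_def
     split: if_splits)
  have mo: "Group.monoid (End_ring R M)"
    by (rule monoidI) (auto simp: E, auto simp: End_ring_def compose_def extensional_def fun_eq_iff)
  show ?thesis
    by (rule ringI[OF ag mo]; unfold E; auto simp: End_ring_def compose_def fun_eq_iff)
qed

definition division_ring :: "('a, 'b) ring_scheme \<Rightarrow> bool"
  where "division_ring D \<longleftrightarrow> ring D \<and> \<one>\<^bsub>D\<^esub> \<noteq> \<zero>\<^bsub>D\<^esub> \<and> Units D = carrier D - {\<zero>\<^bsub>D\<^esub>}"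

definition brick :: "'a ring \<Rightarrow> ('a, 'm) module \<Rightarrow> bool"
  where "brick R M \<longleftrightarrow> left_module R M \<and> fin_presented R M \<and> division_ring (End_ring R M)"

text \<open>Bricks are finitely presented, so up to isomorphism a semibrick is a set; its members are
  realised on the subsets of one arbitrary type \<open>'b\<close>.\<close>

definition semibrick :: "'a ring \<Rightarrow> ('a, 'b) module set \<Rightarrow> bool"
  where "semibrick R \<X> \<longleftrightarrow> (\<forall>X\<in>\<X>. brick R X) \<and>
    (\<forall>X\<in>\<X>. \<forall>X'\<in>\<X>. X \<noteq> X' \<longrightarrow> \<not> mod_isomorphic R X X' \<and>
      (\<forall>h\<in>mod_hom R X X'. \<forall>x\<in>carrier X. h x = \<zero>\<^bsub>X'\<^esub>))"


section \<open>Filtrations\<close>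

text \<open>Ordinals are the elements of the field of a well-order \<open>r\<close>: the ordinals \<open>\<lambda> \<le> \<mu>\<close> are the
  elements of \<^term>\<open>under r \<mu>\<close>, those below \<open>\<mu>\<close> are the elements of \<^term>\<open>underS r \<mu>\<close>. The ordinal
  \<open>\<mu>\<close> need not be the largest element of \<open>r\<close>, so chains of different lengths can be indexed by the
  same well-order.\<close>

definition ord_zero :: "'i rel \<Rightarrow> 'i \<Rightarrow> bool"
  where "ord_zero r \<alpha> \<longleftrightarrow> \<alpha> \<in> Field r \<and> underS r \<alpha> = {}"

definition ord_succ :: "'i rel \<Rightarrow> 'i \<Rightarrow> 'i \<Rightarrow> bool"
  where "ord_succ r \<alpha> \<beta> \<longleftrightarrow> \<alpha> \<in> Field r \<and> \<beta> \<in> Field r \<and> underS r \<beta> = under r \<alpha>"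

definition ord_limit :: "'i rel \<Rightarrow> 'i \<Rightarrow> bool"
  where "ord_limit r \<beta> \<longleftrightarrow> \<beta> \<in> Field r \<and> \<not> ord_zero r \<beta> \<and> (\<nexists>\<alpha>. ord_succ r \<alpha> \<beta>)"

definition filtration ::
  "'a ring \<Rightarrow> ('a, 'm) module \<Rightarrow> 'i rel \<Rightarrow> 'i \<Rightarrow> ('i \<Rightarrow> 'm set) \<Rightarrow> bool"
  where "filtration R M r \<mu> F \<longleftrightarrow> Well_order r \<and> \<mu> \<in> Field r \<and>
    (\<forall>\<alpha>\<in>under r \<mu>. submodule (F \<alpha>) R M) \<and>
    (\<forall>\<beta>\<in>under r \<mu>. \<forall>\<alpha>\<in>under r \<beta>. F \<alpha> \<subseteq> F \<beta>) \<and>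
    (\<forall>\<alpha>\<in>under r \<mu>. ord_zero r \<alpha> \<longrightarrow> F \<alpha> = {\<zero>\<^bsub>M\<^esub>}) \<and>
    F \<mu> = carrier M \<and>
    (\<forall>\<beta>\<in>under r \<mu>. ord_limit r \<beta> \<longrightarrow> F \<beta> = (\<Union>\<alpha>\<in>underS r \<beta>. F \<alpha>))"

definition X_filtration ::
  "'a ring \<Rightarrow> ('a, 'b) module set \<Rightarrow> ('a, 'm) module \<Rightarrow> 'i rel \<Rightarrow> 'i \<Rightarrow> ('i \<Rightarrow> 'm set) \<Rightarrow> bool"
  where "X_filtration R \<X> M r \<mu> F \<longleftrightarrow> filtration R M r \<mu> F \<and>
    (\<forall>\<alpha>. \<forall>\<beta>\<in>under r \<mu>. ord_succ r \<alpha> \<beta> \<longrightarrow>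
      (\<exists>X\<in>\<X>. mod_isomorphic R (quot_module (M\<lparr>carrier := F \<beta>\<rparr>) (F \<alpha>)) X))"

text \<open>Indexing by well-orders on \<^typ>\<open>'m set\<close> is no restriction when the modules in \<open>\<X>\<close> are nonzero
  (as bricks are): such a filtration is strictly increasing, so it can be indexed by its own terms.
  \<open>FiltI\<close> below proves this.\<close>

definition Filt :: "'a ring \<Rightarrow> ('a, 'b) module set \<Rightarrow> ('a, 'm) module set"
  where "Filt R \<X> = {M. left_module R M \<and>
    (\<exists>(r :: 'm set rel) \<mu> F. X_filtration R \<X> M r \<mu> F)}"

lemma FiltI:
  fixes M :: "('a, 'm) module" and r :: "'i rel"
  assumes M: "left_module R M"
    and X: "\<And>X. X \<in> \<X> \<Longrightarrow> left_module R X \<and> carrier X \<noteq> {\<zero>\<^bsub>X\<^esub>}"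
    and F: "X_filtration R \<X> M r \<mu> F"
  shows "M \<in> Filt R \<X>"
proof -
  define U where "U = under r \<mu>"
  have r: "Well_order r" and \<mu>: "\<mu> \<in> Field r"
    and mono: "\<And>\<alpha> \<beta>. \<beta> \<in> U \<Longrightarrow> (\<alpha>, \<beta>) \<in> r \<Longrightarrow> F \<alpha> \<subseteq> F \<beta>"
    using F by (auto simp: X_filtration_def filtration_def U_def under_def)
  have wo: "wo_rel r" by (simp add: wo_rel_def r)
  have tr: "(a, b) \<in> r \<Longrightarrow> (b, c) \<in> r \<Longrightarrow> (a, c) \<in> r" for a b c
    using wo_rel.TRANS[OF wo] by (auto dest: transD)
  have an: "(a, b) \<in> r \<Longrightarrow> (b, a) \<in> r \<Longrightarrow> a = b" for a b
    using wo_rel.ANTISYM[OF wo] by (auto dest: antisymD)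
  have re: "a \<in> Field r \<Longrightarrow> (a, a) \<in> r" for a
    using wo_rel.REFL[OF wo] by (auto dest: refl_onD)
  have UF: "U \<subseteq> Field r" by (auto simp: U_def under_def Field_def)
  have \<mu>U: "\<mu> \<in> U" using re \<mu> by (auto simp: U_def under_def)
  have Udown: "\<beta> \<in> U \<Longrightarrow> (\<alpha>, \<beta>) \<in> r \<Longrightarrow> \<alpha> \<in> U" for \<alpha> \<beta>
    using tr by (auto simp: U_def under_def)
  have step: "F \<alpha> \<noteq> F \<beta>" if s: "ord_succ r \<alpha> \<beta>" and b: "\<beta> \<in> U" for \<alpha> \<beta>
  proof
    assume e: "F \<alpha> = F \<beta>"
    from F s b obtain X h where XX: "X \<in> \<X>"
      and h: "bij_betw h (carrier (quot_module (M\<lparr>carrier := F \<beta>\<rparr>) (F \<beta>))) (carrier X)"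
      unfolding X_filtration_def U_def mod_isomorphic_def by (metis e)
    have "submodule (F \<beta>) R M" using F b by (auto simp: X_filtration_def filtration_def U_def)
    then interpret H: submodule "F \<beta>" R M .
    interpret left_module R M by (rule M)
    have sg: "subgroup (F \<beta>) (add_monoid M)" ..
    have "F \<beta> +>\<^bsub>M\<^esub> x = F \<beta>" if "x \<in> F \<beta>" for x
      using M.add.coset_join2[OF _ sg that] that H.subset
      by (auto simp: a_r_coset_def)
    then have "carrier (quot_module (M\<lparr>carrier := F \<beta>\<rparr>) (F \<beta>)) \<subseteq> {F \<beta>}"
      by (auto simp: quot_module_def A_RCOSETS_def' a_r_coset_def r_coset_def)
    then have "carrier X \<subseteq> {h (F \<beta>)}" using h by (auto simp: bij_betw_def)
    moreover have "\<zero>\<^bsub>X\<^esub> \<in> carrier X"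
      using X[OF XX] left_module.axioms(2) abelian_group.axioms(1) abelian_monoid.zero_closed by blast
    ultimately show False using X[OF XX] by (metis empty_iff singletonD subset_singletonD)
  qed
  have strict: "F \<alpha> \<noteq> F \<beta>" if ab: "(\<alpha>, \<beta>) \<in> r" "\<alpha> \<noteq> \<beta>" and b: "\<beta> \<in> U" for \<alpha> \<beta>
  proof -
    define A where "A = {\<gamma>. (\<alpha>, \<gamma>) \<in> r \<and> \<gamma> \<noteq> \<alpha>}"
    have "A \<subseteq> Field r" "A \<noteq> {}" using ab by (auto simp: A_def Field_def)
    then have m: "wo_rel.isMinim r A (wo_rel.minim r A)" by (rule wo_rel.minim_isMinim[OF wo])
    define \<gamma> where "\<gamma> = wo_rel.minim r A"
    have \<gamma>: "(\<alpha>, \<gamma>) \<in> r" "\<gamma> \<noteq> \<alpha>" "\<And>\<delta>. (\<alpha>, \<delta>) \<in> r \<Longrightarrow> \<delta> \<noteq> \<alpha> \<Longrightarrow> (\<gamma>, \<delta>) \<in> r"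
      using m by (auto simp: wo_rel.isMinim_def[OF wo] A_def \<gamma>_def)
    have \<gamma>\<beta>: "(\<gamma>, \<beta>) \<in> r" using \<gamma>(3) ab by auto
    have Fi: "\<alpha> \<in> Field r" "\<gamma> \<in> Field r" using \<gamma>(1) by (auto simp: Field_def)
    have "underS r \<gamma> = under r \<alpha>"
    proof (intro equalityI subsetI)
      fix x assume x: "x \<in> underS r \<gamma>"
      then have xf: "x \<in> Field r" by (auto simp: underS_def Field_def)
      show "x \<in> under r \<alpha>"
        using wo_rel.TOTALS[OF wo] xf Fi x \<gamma>(3)[of x] an[of x \<gamma>] re by (auto simp: underS_def under_def)
    next
      fix x assume "x \<in> under r \<alpha>"
      then show "x \<in> underS r \<gamma>" using \<gamma>(1,2) tr an by (auto simp: under_def underS_def)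
    qed
    then have "ord_succ r \<alpha> \<gamma>" using Fi by (simp add: ord_succ_def)
    then have "F \<alpha> \<noteq> F \<gamma>" using step Udown[OF b \<gamma>\<beta>] by blast
    moreover have "F \<alpha> \<subseteq> F \<gamma>" "F \<gamma> \<subseteq> F \<beta>" using mono \<gamma>(1) \<gamma>\<beta> b Udown by blast+
    ultimately show ?thesis by blast
  qed
  have inj: "inj_on F U"
    by (rule inj_onI) (metis wo_rel.TOTALS[OF wo] UF strict subsetD)
  define s where "s = dir_image (Restr r U) F"
  have FR: "Field (Restr r U) = U"
    using UF re by (fastforce simp: Field_def)
  have s: "Well_order s"
    unfolding s_def using inj by (intro Well_order_dir_image Well_order_Restr r) (simp add: FR)
  have ss: "(S, T) \<in> s \<longleftrightarrow> (\<exists>\<alpha>\<in>U. \<exists>\<beta>\<in>U. (\<alpha>, \<beta>) \<in> r \<and> S = F \<alpha> \<and> T = F \<beta>)" for S T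
    by (auto simp: s_def dir_image_def)
  have Fs: "Field s = F ` U" unfolding s_def by (simp add: dir_image_Field FR)
  have un: "under s (F \<alpha>) = F ` under r \<alpha>" if "\<alpha> \<in> U" for \<alpha>
    using that Udown inj by (auto simp: under_def ss inj_on_def)
  have us: "underS s (F \<alpha>) = F ` underS r \<alpha>" if a: "\<alpha> \<in> U" for \<alpha>
  proof -
    have "underS s (F \<alpha>) = under s (F \<alpha>) - {F \<alpha>}" by (auto simp: under_def underS_def)
    also have "under s (F \<alpha>) - {F \<alpha>} = F ` under r \<alpha> - F ` {\<alpha>}"
      by (simp add: un[OF a])
    also have "\<dots> = F ` (under r \<alpha> - {\<alpha>})"
      by (rule inj_on_image_set_diff[OF inj, symmetric]) (use a Udown[OF a] in \<open>auto simp: under_def\<close>)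
    also have "under r \<alpha> - {\<alpha>} = underS r \<alpha>" by (auto simp: under_def underS_def)
    finally show ?thesis .
  qed
  have sub: "underS r \<alpha> \<subseteq> U" "under r \<alpha> \<subseteq> U" if "\<alpha> \<in> U" for \<alpha>
    using Udown[OF that] by (auto simp: under_def underS_def)
  have suc: "ord_succ s (F \<alpha>) (F \<beta>) \<longleftrightarrow> ord_succ r \<alpha> \<beta>" if "\<alpha> \<in> U" "\<beta> \<in> U" for \<alpha> \<beta>
    using that UF inj_on_image_eq_iff[OF inj sub(1)[OF that(2)] sub(2)[OF that(1)]]
    by (auto simp: ord_succ_def Fs us un)
  have sucU: "\<alpha> \<in> U" if "ord_succ r \<alpha> \<beta>" "\<beta> \<in> U" for \<alpha> \<beta>
    using that re Udown[OF that(2), of \<alpha>] by (auto simp: ord_succ_def under_def underS_def)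
  have ze: "ord_zero s (F \<alpha>) \<longleftrightarrow> ord_zero r \<alpha>" if "\<alpha> \<in> U" for \<alpha>
    using that UF by (auto simp: ord_zero_def Fs us)
  have li: "ord_limit s (F \<alpha>) \<longleftrightarrow> ord_limit r \<alpha>" if "\<alpha> \<in> U" for \<alpha>
  proof -
    have "(\<exists>S. ord_succ s S (F \<alpha>)) \<longleftrightarrow> (\<exists>\<beta>. ord_succ r \<beta> \<alpha>)"
      using suc sucU that by (metis Fs imageE ord_succ_def)
    then show ?thesis using that UF ze by (auto simp: ord_limit_def Fs)
  qed
  have us\<mu>: "under s (F \<mu>) = F ` U" using un[OF \<mu>U] by (simp add: U_def)
  have fil: "\<And>\<alpha>. \<alpha> \<in> U \<Longrightarrow> submodule (F \<alpha>) R M"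
    "\<And>\<alpha>. \<alpha> \<in> U \<Longrightarrow> ord_zero r \<alpha> \<Longrightarrow> F \<alpha> = {\<zero>\<^bsub>M\<^esub>}" "F \<mu> = carrier M"
    "\<And>\<alpha>. \<alpha> \<in> U \<Longrightarrow> ord_limit r \<alpha> \<Longrightarrow> F \<alpha> = (\<Union>\<beta>\<in>underS r \<alpha>. F \<beta>)"
    "\<And>\<alpha> \<beta>. \<beta> \<in> U \<Longrightarrow> ord_succ r \<alpha> \<beta> \<Longrightarrow>
      \<exists>X\<in>\<X>. mod_isomorphic R (quot_module (M\<lparr>carrier := F \<beta>\<rparr>) (F \<alpha>)) X"
    using F by (simp_all add: X_filtration_def filtration_def U_def)
  have "filtration R M s (F \<mu>) (\<lambda>S. S)"
    unfolding filtration_def us\<mu>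
  proof (intro conjI)
    show "F \<mu> \<in> Field s" using Fs \<mu>U by blast
    show "\<forall>T\<in>F ` U. \<forall>S\<in>under s T. S \<subseteq> T" using un mono by (fastforce simp: under_def)
    show "\<forall>S\<in>F ` U. ord_limit s S \<longrightarrow> S = (\<Union>T\<in>underS s S. T)"
    proof (intro ballI impI)
      fix S assume "S \<in> F ` U" and lim: "ord_limit s S"
      then obtain \<alpha> where "\<alpha> \<in> U" "S = F \<alpha>" by blast
      then show "S = (\<Union>T\<in>underS s S. T)" using fil(4)[of \<alpha>] li us[of \<alpha>] lim by simp
    qed
  qed (use s fil ze in auto)
  moreover have "\<exists>X\<in>\<X>. mod_isomorphic R (quot_module (M\<lparr>carrier := T\<rparr>) S) X"
    if "T \<in> F ` U" "ord_succ s S T" for S T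
  proof -
    from that obtain \<alpha> \<beta> where "\<alpha> \<in> U" "S = F \<alpha>" "\<beta> \<in> U" "T = F \<beta>"
      by (auto simp: ord_succ_def Fs)
    then show ?thesis using fil(5) suc that(2) by simp
  qed
  ultimately have "X_filtration R \<X> M s (F \<mu>) (\<lambda>S. S)"
    unfolding X_filtration_def us\<mu> by blast
  then show ?thesis using M by (auto simp: Filt_def)
qed

text \<open>A sum of submodules is the additive subgroup generated by their union.\<close>

definition X_socle :: "'a ring \<Rightarrow> ('a, 'b) module set \<Rightarrow> ('a, 'm) module \<Rightarrow> 'm set"
  where "X_socle R \<X> N = generate (add_monoid N) (\<Union>X\<in>\<X>. \<Union>h\<in>mod_hom R X N. h ` carrier X)"

text \<open>The terms up to \<open>\<mu>\<close> are determined by the inductive clauses. The index \<open>\<mu>\<close> is not required to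
  be the least one with value \<open>M\<close>: after reaching \<open>M\<close> the clauses yield constant terms, in
  accordance with the identification of filtrations that agree up to such terms.\<close>

definition socle_filtration ::
  "'a ring \<Rightarrow> ('a, 'b) module set \<Rightarrow> ('a, 'm) module \<Rightarrow> 'i rel \<Rightarrow> 'i \<Rightarrow> ('i \<Rightarrow> 'm set) \<Rightarrow> bool"
  where "socle_filtration R \<X> M r \<mu> V \<longleftrightarrow> M \<in> Filt R \<X> \<and> Well_order r \<and> \<mu> \<in> Field r \<and>
    (\<forall>\<alpha>\<in>under r \<mu>. ord_zero r \<alpha> \<longrightarrow> V \<alpha> = {\<zero>\<^bsub>M\<^esub>}) \<and>
    (\<forall>\<alpha>. \<forall>\<beta>\<in>under r \<mu>. ord_succ r \<alpha> \<beta> \<longrightarrow>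
      V \<beta> = {x \<in> carrier M. V \<alpha> +>\<^bsub>M\<^esub> x \<in> X_socle R \<X> (quot_module M (V \<alpha>))}) \<and>
    (\<forall>\<beta>\<in>under r \<mu>. ord_limit r \<beta> \<longrightarrow> V \<beta> = (\<Union>\<alpha>\<in>underS r \<beta>. V \<alpha>)) \<and>
    V \<mu> = carrier M"

definition continue_constant ::
  "('a, 'm) module \<Rightarrow> 'i rel \<Rightarrow> 'i \<Rightarrow> ('i \<Rightarrow> 'm set) \<Rightarrow> 'i \<Rightarrow> 'm set"
  where "continue_constant M r \<nu> V \<alpha> = (if \<alpha> \<in> under r \<nu> then V \<alpha> else carrier M)"

end

theory Submission
  imports Defs
begin

text \<open>Replace a filtration by the well-ordered chain of its terms, and call a submodule \<open>H\<close> of \<open>N\<close>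
  compatible with it if for every step \<open>S \<subset> T\<close> either \<open>T \<subseteq> S + H\<close> or \<open>T \<inter> H \<subseteq> S\<close>. Compatibility is preserved by
  unions of chains, and it makes both \<open>H\<close> and \<open>N/H\<close> filtered by the semibrick. If \<open>H\<close> is compatible, then a map
  \<open>X \<rightarrow> N/H\<close> from a brick is zero or injective and the preimage of its image is compatible again: \<open>X\<close> is
  finitely generated, so the image first appears at a successor step, where Schur's lemma applies. Transfinite
  induction along \<open>M\<close> shows that \<open>H + f(M)\<close> is compatible in \<open>N\<close> and \<open>f\<^sup>-\<^sup>1(H)\<close> is compatible in \<open>M\<close>, which gives
  sums, intersections and cokernels. For the socle filtration of the image it remains to see that an injective
  map \<open>P \<rightarrow> N\<close> of filtered modules reflects socles; for this, the socle of \<open>N\<close> is retracted onto that of \<open>P\<close> along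
  a maximal compatible complement.\<close>

section \<open>Submodules and homomorphisms\<close>

lemma mod_hom_iff:
  "h \<in> mod_hom R M N \<longleftrightarrow> (\<forall>x\<in>carrier M. h x \<in> carrier N) \<and>
    (\<forall>x\<in>carrier M. \<forall>y\<in>carrier M. h (x \<oplus>\<^bsub>M\<^esub> y) = h x \<oplus>\<^bsub>N\<^esub> h y) \<and>
    (\<forall>a\<in>carrier R. \<forall>x\<in>carrier M. h (a \<odot>\<^bsub>M\<^esub> x) = a \<odot>\<^bsub>N\<^esub> h x)"
  by (auto simp: mod_hom_def hom_def)

lemma mod_homI:
  assumes "\<And>x. x \<in> carrier M \<Longrightarrow> h x \<in> carrier N"
    and "\<And>x y. x \<in> carrier M \<Longrightarrow> y \<in> carrier M \<Longrightarrow> h (x \<oplus>\<^bsub>M\<^esub> y) = h x \<oplus>\<^bsub>N\<^esub> h y"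
    and "\<And>a x. a \<in> carrier R \<Longrightarrow> x \<in> carrier M \<Longrightarrow> h (a \<odot>\<^bsub>M\<^esub> x) = a \<odot>\<^bsub>N\<^esub> h x"
  shows "h \<in> mod_hom R M N"
  using assms by (simp add: mod_hom_iff)

lemma mod_homD:
  assumes "h \<in> mod_hom R M N"
  shows "x \<in> carrier M \<Longrightarrow> h x \<in> carrier N"
    and "x \<in> carrier M \<Longrightarrow> y \<in> carrier M \<Longrightarrow> h (x \<oplus>\<^bsub>M\<^esub> y) = h x \<oplus>\<^bsub>N\<^esub> h y"
    and "a \<in> carrier R \<Longrightarrow> x \<in> carrier M \<Longrightarrow> h (a \<odot>\<^bsub>M\<^esub> x) = a \<odot>\<^bsub>N\<^esub> h x"
  using assms by (simp_all add: mod_hom_iff)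

lemma mod_hom_comp:
  "g \<in> mod_hom R L M \<Longrightarrow> h \<in> mod_hom R M N \<Longrightarrow> h \<circ> g \<in> mod_hom R L N"
  by (auto simp: mod_hom_iff)

lemma mod_hom_restrict:
  "h \<in> mod_hom R M N \<Longrightarrow> T \<subseteq> carrier M \<Longrightarrow> h \<in> mod_hom R (M\<lparr>carrier := T\<rparr>) N"
  by (rule mod_homI) (auto dest: mod_homD)

lemma mod_hom_inclusion:
  "T \<subseteq> carrier M \<Longrightarrow> (\<lambda>x. x) \<in> mod_hom R (M\<lparr>carrier := T\<rparr>) M"
  by (auto simp: mod_hom_iff)

context left_module
begin

lemma smult_zero_right: "a \<in> carrier R \<Longrightarrow> a \<odot>\<^bsub>M\<^esub> \<zero>\<^bsub>M\<^esub> = \<zero>\<^bsub>M\<^esub>"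
  using smult_r_distr[of a "\<zero>\<^bsub>M\<^esub>" "\<zero>\<^bsub>M\<^esub>"]
  by (metis M.add.r_cancel_one' M.l_zero M.zero_closed smult_closed)

lemma smult_zero_left: "x \<in> carrier M \<Longrightarrow> \<zero>\<^bsub>R\<^esub> \<odot>\<^bsub>M\<^esub> x = \<zero>\<^bsub>M\<^esub>"
  using smult_l_distr[of "\<zero>\<^bsub>R\<^esub>" "\<zero>\<^bsub>R\<^esub>" x]
  by (metis M.add.r_cancel_one' R.l_zero R.zero_closed smult_closed)

lemma smult_minus_one: "x \<in> carrier M \<Longrightarrow> (\<ominus>\<^bsub>R\<^esub> \<one>\<^bsub>R\<^esub>) \<odot>\<^bsub>M\<^esub> x = \<ominus>\<^bsub>M\<^esub> x"
  using smult_l_distr[of "\<ominus>\<^bsub>R\<^esub> \<one>\<^bsub>R\<^esub>" "\<one>\<^bsub>R\<^esub>" x]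
  by (simp add: R.l_neg smult_zero_left M.minus_equality[symmetric])

lemma minus_in_smult_closed:
  assumes "H \<subseteq> carrier M" "\<And>a x. a \<in> carrier R \<Longrightarrow> x \<in> H \<Longrightarrow> a \<odot>\<^bsub>M\<^esub> x \<in> H" "x \<in> H"
  shows "\<ominus>\<^bsub>M\<^esub> x \<in> H"
  using assms(2)[of "\<ominus>\<^bsub>R\<^esub> \<one>\<^bsub>R\<^esub>" x] assms(1,3) smult_minus_one[of x] by auto

lemma diff_eq_zero_iff:
  "x \<in> carrier M \<Longrightarrow> y \<in> carrier M \<Longrightarrow> x \<ominus>\<^bsub>M\<^esub> y = \<zero>\<^bsub>M\<^esub> \<longleftrightarrow> x = y"
  by (metis M.a_inv_closed M.minus_equality M.minus_minus M.r_neg a_minus_def)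

lemma submodule_iff:
  "submodule H R M \<longleftrightarrow> H \<subseteq> carrier M \<and> \<zero>\<^bsub>M\<^esub> \<in> H \<and> (\<forall>x\<in>H. \<forall>y\<in>H. x \<oplus>\<^bsub>M\<^esub> y \<in> H) \<and>
    (\<forall>a\<in>carrier R. \<forall>x\<in>H. a \<odot>\<^bsub>M\<^esub> x \<in> H)" (is "_ \<longleftrightarrow> ?rhs")
proof
  assume "submodule H R M"
  then interpret submodule H R M .
  show ?rhs using subset one_closed m_closed by auto
next
  assume *: ?rhs
  then have "\<ominus>\<^bsub>M\<^esub> x \<in> H" if "x \<in> H" for x
    using that by (intro minus_in_smult_closed) auto
  then show "submodule H R M"
    using * by (intro submodule.intro subgroup.intro submodule_axioms.intro) (auto simp: a_inv_def)
qed

lemma submoduleI: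
  assumes "H \<subseteq> carrier M" "\<zero>\<^bsub>M\<^esub> \<in> H" "\<And>x y. x \<in> H \<Longrightarrow> y \<in> H \<Longrightarrow> x \<oplus>\<^bsub>M\<^esub> y \<in> H"
    "\<And>a x. a \<in> carrier R \<Longrightarrow> x \<in> H \<Longrightarrow> a \<odot>\<^bsub>M\<^esub> x \<in> H"
  shows "submodule H R M"
  using assms by (simp add: submodule_iff)

lemma submoduleD:
  assumes "submodule H R M"
  shows "H \<subseteq> carrier M" "\<zero>\<^bsub>M\<^esub> \<in> H" "x \<in> H \<Longrightarrow> y \<in> H \<Longrightarrow> x \<oplus>\<^bsub>M\<^esub> y \<in> H"
    "a \<in> carrier R \<Longrightarrow> x \<in> H \<Longrightarrow> a \<odot>\<^bsub>M\<^esub> x \<in> H" "x \<in> H \<Longrightarrow> x \<in> carrier M"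
    "x \<in> H \<Longrightarrow> \<ominus>\<^bsub>M\<^esub> x \<in> H" "x \<in> H \<Longrightarrow> y \<in> H \<Longrightarrow> x \<ominus>\<^bsub>M\<^esub> y \<in> H"
proof -
  have H: "H \<subseteq> carrier M" "\<zero>\<^bsub>M\<^esub> \<in> H" "\<forall>x\<in>H. \<forall>y\<in>H. x \<oplus>\<^bsub>M\<^esub> y \<in> H"
    "\<forall>a\<in>carrier R. \<forall>x\<in>H. a \<odot>\<^bsub>M\<^esub> x \<in> H"
    using assms unfolding submodule_iff by simp_all
  moreover have "\<ominus>\<^bsub>M\<^esub> x \<in> H" if "x \<in> H" for x
    using H that by (intro minus_in_smult_closed) auto
  ultimately show "H \<subseteq> carrier M" "\<zero>\<^bsub>M\<^esub> \<in> H" "x \<in> H \<Longrightarrow> y \<in> H \<Longrightarrow> x \<oplus>\<^bsub>M\<^esub> y \<in> H"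
    "a \<in> carrier R \<Longrightarrow> x \<in> H \<Longrightarrow> a \<odot>\<^bsub>M\<^esub> x \<in> H" "x \<in> H \<Longrightarrow> x \<in> carrier M"
    "x \<in> H \<Longrightarrow> \<ominus>\<^bsub>M\<^esub> x \<in> H" "x \<in> H \<Longrightarrow> y \<in> H \<Longrightarrow> x \<ominus>\<^bsub>M\<^esub> y \<in> H"
    by (auto simp: a_minus_def)
qed

lemma submodule_summand:
  assumes "submodule H R M" "x \<oplus>\<^bsub>M\<^esub> y \<in> H" "x \<in> carrier M" "y \<in> carrier M"
  shows "x \<in> H \<longleftrightarrow> y \<in> H"
proof
  assume "x \<in> H"
  then have "\<ominus>\<^bsub>M\<^esub> x \<oplus>\<^bsub>M\<^esub> (x \<oplus>\<^bsub>M\<^esub> y) \<in> H"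
    by (intro submoduleD(3,6)[OF assms(1)] assms(2))
  then show "y \<in> H"
    using assms by (simp add: M.r_neg1)
next
  assume "y \<in> H"
  then have "(x \<oplus>\<^bsub>M\<^esub> y) \<oplus>\<^bsub>M\<^esub> \<ominus>\<^bsub>M\<^esub> y \<in> H"
    by (intro submoduleD(3,6)[OF assms(1)] assms(2))
  then show "x \<in> H"
    using assms by (simp add: M.a_assoc M.r_neg)
qed

lemma submodule_zero: "submodule {\<zero>\<^bsub>M\<^esub>} R M"
  by (rule submoduleI) (auto simp: smult_zero_right)

lemma submodule_carrier: "submodule (carrier M) R M"
  by (rule submoduleI) auto

lemma submodule_Int: "submodule A R M \<Longrightarrow> submodule B R M \<Longrightarrow> submodule (A \<inter> B) R M"
  by (auto simp: submodule_iff)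

lemma set_addI: "a \<in> A \<Longrightarrow> b \<in> B \<Longrightarrow> a \<oplus>\<^bsub>M\<^esub> b \<in> A <+>\<^bsub>M\<^esub> B"
  by (auto simp: set_add_def')

lemma set_addE:
  assumes "x \<in> A <+>\<^bsub>M\<^esub> B" obtains a b where "a \<in> A" "b \<in> B" "x = a \<oplus>\<^bsub>M\<^esub> b"
  using assms by (auto simp: set_add_def')

lemma submodule_set_add:
  assumes A: "submodule A R M" and B: "submodule B R M"
  shows "submodule (A <+>\<^bsub>M\<^esub> B) R M"
proof (rule submoduleI)
  show "A <+>\<^bsub>M\<^esub> B \<subseteq> carrier M"
    using submoduleD(5)[OF A] submoduleD(5)[OF B] by (auto simp: set_add_def')
  show "\<zero>\<^bsub>M\<^esub> \<in> A <+>\<^bsub>M\<^esub> B"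
    using submoduleD(2)[OF A] submoduleD(2)[OF B] by (force simp: set_add_def')
next
  fix x y assume "x \<in> A <+>\<^bsub>M\<^esub> B" "y \<in> A <+>\<^bsub>M\<^esub> B"
  then obtain a b c d where *: "a \<in> A" "b \<in> B" "x = a \<oplus>\<^bsub>M\<^esub> b" "c \<in> A" "d \<in> B" "y = c \<oplus>\<^bsub>M\<^esub> d"
    by (auto simp: set_add_def')
  then have "x \<oplus>\<^bsub>M\<^esub> y = (a \<oplus>\<^bsub>M\<^esub> c) \<oplus>\<^bsub>M\<^esub> (b \<oplus>\<^bsub>M\<^esub> d)"
    using submoduleD(5)[OF A] submoduleD(5)[OF B] by (simp add: M.a_ac)
  with * show "x \<oplus>\<^bsub>M\<^esub> y \<in> A <+>\<^bsub>M\<^esub> B"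
    by (auto intro!: set_addI submoduleD(3)[OF A] submoduleD(3)[OF B])
next
  fix r x assume r: "r \<in> carrier R" and "x \<in> A <+>\<^bsub>M\<^esub> B"
  then obtain a b where *: "a \<in> A" "b \<in> B" "x = a \<oplus>\<^bsub>M\<^esub> b" by (auto simp: set_add_def')
  then have "r \<odot>\<^bsub>M\<^esub> x = r \<odot>\<^bsub>M\<^esub> a \<oplus>\<^bsub>M\<^esub> r \<odot>\<^bsub>M\<^esub> b"
    using submoduleD(5)[OF A] submoduleD(5)[OF B] r by (simp add: smult_r_distr)
  with * r show "r \<odot>\<^bsub>M\<^esub> x \<in> A <+>\<^bsub>M\<^esub> B"
    by (auto intro!: set_addI submoduleD(4)[OF A] submoduleD(4)[OF B])
qed

lemma set_add_upper:
  assumes A: "submodule A R M" and B: "submodule B R M"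
  shows "A \<subseteq> A <+>\<^bsub>M\<^esub> B" "B \<subseteq> A <+>\<^bsub>M\<^esub> B"
proof -
  have "a = a \<oplus>\<^bsub>M\<^esub> \<zero>\<^bsub>M\<^esub>" if "a \<in> A" for a
    using that submoduleD(5)[OF A] by simp
  then show "A \<subseteq> A <+>\<^bsub>M\<^esub> B" using submoduleD(2)[OF B] by (auto simp: set_add_def')
  have "b = \<zero>\<^bsub>M\<^esub> \<oplus>\<^bsub>M\<^esub> b" if "b \<in> B" for b
    using that submoduleD(5)[OF B] by simp
  then show "B \<subseteq> A <+>\<^bsub>M\<^esub> B" using submoduleD(2)[OF A] by (auto simp: set_add_def')
qed

lemma set_add_least:
  "submodule C R M \<Longrightarrow> A \<subseteq> C \<Longrightarrow> B \<subseteq> C \<Longrightarrow> A <+>\<^bsub>M\<^esub> B \<subseteq> C"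
  using submoduleD(3)[of C] by (auto simp: set_add_def')

lemma submodule_Union_chain:
  assumes "\<D> \<noteq> {}" and "\<And>A. A \<in> \<D> \<Longrightarrow> submodule A R M"
    and ch: "\<And>A B. A \<in> \<D> \<Longrightarrow> B \<in> \<D> \<Longrightarrow> A \<subseteq> B \<or> B \<subseteq> A"
  shows "submodule (\<Union>\<D>) R M"
proof (rule submoduleI)
  fix x y assume "x \<in> \<Union>\<D>" "y \<in> \<Union>\<D>"
  then obtain C where "C \<in> \<D>" "x \<in> C" "y \<in> C" using ch by blast
  then show "x \<oplus>\<^bsub>M\<^esub> y \<in> \<Union>\<D>" using assms(2) submoduleD(3) by blast
qed (use assms(1,2) submoduleD(1,2,4) in blast)+

lemma left_module_submodule:
  assumes H: "submodule H R M"
  shows "left_module R (M\<lparr>carrier := H\<rparr>)"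
proof -
  note D = submoduleD[OF H]
  have "abelian_group (M\<lparr>carrier := H\<rparr>)"
  proof (rule abelian_groupI)
    fix x assume "x \<in> carrier (M\<lparr>carrier := H\<rparr>)"
    then show "\<exists>y\<in>carrier (M\<lparr>carrier := H\<rparr>). y \<oplus>\<^bsub>M\<lparr>carrier := H\<rparr>\<^esub> x = \<zero>\<^bsub>M\<lparr>carrier := H\<rparr>\<^esub>"
      using D(5,6) by (intro bexI[of _ "\<ominus>\<^bsub>M\<^esub> x"]) (auto simp: M.l_neg)
  qed (use D(2,3,5) in \<open>auto simp: M.a_ac\<close>)
  moreover have "left_module_axioms R (M\<lparr>carrier := H\<rparr>)"
    using D(4,5)
    by unfold_locales (auto simp: smult_l_distr smult_r_distr smult_assoc1)
  ultimately show ?thesis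
    by (intro left_module.intro R.ring_axioms)
qed

lemma submodule_submodule_iff:
  assumes "submodule H R M"
  shows "submodule K R (M\<lparr>carrier := H\<rparr>) \<longleftrightarrow> submodule K R M \<and> K \<subseteq> H"
  using submoduleD(1)[OF assms]
  by (auto simp: submodule_iff left_module.submodule_iff[OF left_module_submodule[OF assms]])

end

context
  fixes R :: "'a ring" and M :: "('a, 'm) module" and N :: "('a, 'n) module" and h :: "'m \<Rightarrow> 'n"
  assumes M: "left_module R M" and N: "left_module R N" and h: "h \<in> mod_hom R M N"
begin

interpretation M: left_module R M by (rule M)
interpretation N: left_module R N by (rule N)

lemma mod_hom_zero: "h \<zero>\<^bsub>M\<^esub> = \<zero>\<^bsub>N\<^esub>"
  using mod_homD(1)[OF h] mod_homD(2)[OF h, of "\<zero>\<^bsub>M\<^esub>" "\<zero>\<^bsub>M\<^esub>"]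
  by (metis M.M.l_zero M.M.zero_closed N.M.add.r_cancel_one')

lemma mod_hom_minus: "x \<in> carrier M \<Longrightarrow> h (\<ominus>\<^bsub>M\<^esub> x) = \<ominus>\<^bsub>N\<^esub> h x"
  using mod_homD(1)[OF h] mod_homD(2)[OF h, of "\<ominus>\<^bsub>M\<^esub> x" x] mod_hom_zero
  by (metis M.M.a_inv_closed M.M.l_neg N.M.minus_equality)

lemma mod_hom_diff: "x \<in> carrier M \<Longrightarrow> y \<in> carrier M \<Longrightarrow> h (x \<ominus>\<^bsub>M\<^esub> y) = h x \<ominus>\<^bsub>N\<^esub> h y"
  by (simp add: a_minus_def mod_homD(2)[OF h] mod_hom_minus)

lemma submodule_image: "submodule A R M \<Longrightarrow> submodule (h ` A) R N"
proof (rule N.submoduleI)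
  assume A: "submodule A R M"
  note D = M.submoduleD[OF A]
  show "h ` A \<subseteq> carrier N" using D(1) mod_homD(1)[OF h] by auto
  show "\<zero>\<^bsub>N\<^esub> \<in> h ` A" using D(2) mod_hom_zero by (metis imageI)
  fix x y assume "x \<in> h ` A" "y \<in> h ` A"
  then obtain a b where "a \<in> A" "b \<in> A" "x = h a" "y = h b" by auto
  then show "x \<oplus>\<^bsub>N\<^esub> y \<in> h ` A" using D(3,5) mod_homD(2)[OF h] by (metis imageI)
next
  fix r x assume A: "submodule A R M" and r: "r \<in> carrier R" "x \<in> h ` A"
  then obtain a where "a \<in> A" "x = h a" by auto
  then show "r \<odot>\<^bsub>N\<^esub> x \<in> h ` A" using M.submoduleD(4,5)[OF A] mod_homD(3)[OF h] r by (metis imageI)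
qed

lemma submodule_vimage: "submodule B R N \<Longrightarrow> submodule {x \<in> carrier M. h x \<in> B} R M"
  by (rule M.submoduleI) (auto simp: mod_hom_zero mod_homD[OF h] N.submoduleD)

lemma mod_hom_inj_iff:
  "inj_on h (carrier M) \<longleftrightarrow> (\<forall>x\<in>carrier M. h x = \<zero>\<^bsub>N\<^esub> \<longrightarrow> x = \<zero>\<^bsub>M\<^esub>)"
proof
  assume "inj_on h (carrier M)"
  then show "\<forall>x\<in>carrier M. h x = \<zero>\<^bsub>N\<^esub> \<longrightarrow> x = \<zero>\<^bsub>M\<^esub>"
    using mod_hom_zero by (metis M.M.zero_closed inj_onD)
next
  assume *: "\<forall>x\<in>carrier M. h x = \<zero>\<^bsub>N\<^esub> \<longrightarrow> x = \<zero>\<^bsub>M\<^esub>"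
  show "inj_on h (carrier M)"
  proof (rule inj_onI)
    fix x y assume xy: "x \<in> carrier M" "y \<in> carrier M" "h x = h y"
    then have "h (x \<ominus>\<^bsub>M\<^esub> y) = \<zero>\<^bsub>N\<^esub>"
      using mod_homD(1)[OF h] by (simp add: mod_hom_diff N.M.r_neg a_minus_def[of N])
    then show "x = y" using * xy M.diff_eq_zero_iff M.M.minus_closed by blast
  qed
qed

end

lemma mod_hom_factor:
  fixes R :: "'a ring" and M :: "('a, 'm) module" and N :: "('a, 'n) module" and h :: "'m \<Rightarrow> 'n"
    and P :: "('a, 'p) module" and p :: "'m \<Rightarrow> 'p"
  assumes M: "left_module R M" and N: "left_module R N" and h: "h \<in> mod_hom R M N"
    and P: "left_module R P" and p: "p \<in> mod_hom R M P" "p ` carrier M = carrier P"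
    and ker: "\<And>x. x \<in> carrier M \<Longrightarrow> p x = \<zero>\<^bsub>P\<^esub> \<Longrightarrow> h x = \<zero>\<^bsub>N\<^esub>"
  obtains k where "k \<in> mod_hom R P N" "\<And>x. x \<in> carrier M \<Longrightarrow> k (p x) = h x"
proof -
  interpret M: left_module R M by (rule M)
  interpret N: left_module R N by (rule N)
  interpret P: left_module R P by (rule P)
  define k where "k y = h (SOME x. x \<in> carrier M \<and> p x = y)" for y
  have k: "k (p x) = h x" if x: "x \<in> carrier M" for x
  proof -
    define x' where "x' = (SOME x'. x' \<in> carrier M \<and> p x' = p x)"
    have x': "x' \<in> carrier M" "p x' = p x"
      using someI[of "\<lambda>x'. x' \<in> carrier M \<and> p x' = p x" x] x by (auto simp: x'_def)
    have "p (x' \<ominus>\<^bsub>M\<^esub> x) = \<zero>\<^bsub>P\<^esub>"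
      using x x' mod_homD(1)[OF p(1)] by (simp add: mod_hom_diff[OF M P p(1)] a_minus_def[of P] P.M.r_neg)
    then have "h x' \<ominus>\<^bsub>N\<^esub> h x = \<zero>\<^bsub>N\<^esub>"
      using ker[of "x' \<ominus>\<^bsub>M\<^esub> x"] x x' mod_hom_diff[OF M N h] by simp
    then have "h x' = h x" using x x' mod_homD(1)[OF h] N.diff_eq_zero_iff by simp
    then show ?thesis by (simp add: k_def x'_def)
  qed
  have pre: "\<exists>x\<in>carrier M. y = p x" if "y \<in> carrier P" for y
    using that p(2) by auto
  have "k \<in> mod_hom R P N"
  proof (rule mod_homI)
    fix y assume "y \<in> carrier P"
    then show "k y \<in> carrier N" using pre k mod_homD(1)[OF h] by metis
  next
    fix y z assume "y \<in> carrier P" "z \<in> carrier P"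
    then obtain u v where "u \<in> carrier M" "v \<in> carrier M" "y = p u" "z = p v"
      using pre by metis
    then show "k (y \<oplus>\<^bsub>P\<^esub> z) = k y \<oplus>\<^bsub>N\<^esub> k z"
      using k mod_homD(2)[OF p(1), of u v] mod_homD(2)[OF h] k[of "u \<oplus>\<^bsub>M\<^esub> v"] by simp
  next
    fix a y assume a: "a \<in> carrier R" and "y \<in> carrier P"
    then obtain u where "u \<in> carrier M" "y = p u" using pre by metis
    then show "k (a \<odot>\<^bsub>P\<^esub> y) = a \<odot>\<^bsub>N\<^esub> k y"
      using k mod_homD(3)[OF p(1) a, of u] mod_homD(3)[OF h a] k[of "a \<odot>\<^bsub>M\<^esub> u"] a by simp
  qed
  then show thesis using that k by blast
qed

context left_module
begin

lemma abelian_subgroup_of_submodule: "submodule H R M \<Longrightarrow> abelian_subgroup H M"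
  by (intro abelian_subgroupI3 additive_subgroup.intro M.abelian_group_axioms submodule.axioms(1))

lemma coset_eq_iff:
  assumes H: "submodule H R M" and x: "x \<in> carrier M" "y \<in> carrier M"
  shows "H +>\<^bsub>M\<^esub> x = H +>\<^bsub>M\<^esub> y \<longleftrightarrow> x \<ominus>\<^bsub>M\<^esub> y \<in> H"
proof -
  interpret abelian_subgroup H M by (rule abelian_subgroup_of_submodule[OF H])
  show ?thesis
  proof
    assume "H +>\<^bsub>M\<^esub> x = H +>\<^bsub>M\<^esub> y"
    then have "x \<in> H +>\<^bsub>M\<^esub> y" using a_rcos_self[OF x(1)] by simp
    then obtain h where "h \<in> H" "x = h \<oplus>\<^bsub>M\<^esub> y" by (auto simp: a_r_coset_def')
    then show "x \<ominus>\<^bsub>M\<^esub> y \<in> H"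
      using submoduleD(5)[OF H] x by (simp add: a_minus_def M.a_assoc M.r_neg)
  next
    assume *: "x \<ominus>\<^bsub>M\<^esub> y \<in> H"
    have "(x \<ominus>\<^bsub>M\<^esub> y) \<oplus>\<^bsub>M\<^esub> y = x"
      using x by (simp add: a_minus_def M.a_assoc M.l_neg)
    then have "x \<in> H +>\<^bsub>M\<^esub> y" using * by (force simp: a_r_coset_def')
    then show "H +>\<^bsub>M\<^esub> x = H +>\<^bsub>M\<^esub> y"
      using M.a_repr_independence[OF _ x(2) submodule.axioms(1)[OF H]] by simp
  qed
qed

lemma carrier_quot_module: "carrier (quot_module M H) = (\<lambda>x. H +>\<^bsub>M\<^esub> x) ` carrier M"
  by (auto simp: quot_module_def A_RCOSETS_def')

lemma coset_zero: "submodule H R M \<Longrightarrow> H +>\<^bsub>M\<^esub> \<zero>\<^bsub>M\<^esub> = \<zero>\<^bsub>quot_module M H\<^esub>"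
  using submoduleD(1) by (simp add: quot_module_def)

lemma coset_eq_zero_iff:
  assumes H: "submodule H R M" and x: "x \<in> carrier M"
  shows "H +>\<^bsub>M\<^esub> x = \<zero>\<^bsub>quot_module M H\<^esub> \<longleftrightarrow> x \<in> H"
  using coset_eq_iff[OF H x M.zero_closed] coset_zero[OF H] x
  by (simp add: a_minus_def M.add.inv_one[unfolded a_inv_def[symmetric]])

lemma proj_hom:
  assumes H: "submodule H R M"
  shows "(\<lambda>x. H +>\<^bsub>M\<^esub> x) \<in> mod_hom R M (quot_module M H)"
proof (rule mod_homI)
  fix x y assume "x \<in> carrier M" "y \<in> carrier M"
  then show "H +>\<^bsub>M\<^esub> (x \<oplus>\<^bsub>M\<^esub> y) = (H +>\<^bsub>M\<^esub> x) \<oplus>\<^bsub>quot_module M H\<^esub> (H +>\<^bsub>M\<^esub> y)"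
    using abelian_subgroup.a_rcos_sum[OF abelian_subgroup_of_submodule[OF H]]
    by (simp add: quot_module_def)
next
  fix a x assume a: "a \<in> carrier R" and x: "x \<in> carrier M"
  note D = submoduleD[OF H]
  have eq: "H +>\<^bsub>M\<^esub> (a \<odot>\<^bsub>M\<^esub> y) = H +>\<^bsub>M\<^esub> (a \<odot>\<^bsub>M\<^esub> x)" if y: "y \<in> H +>\<^bsub>M\<^esub> x" for y
  proof -
    obtain h where h: "h \<in> H" "y = h \<oplus>\<^bsub>M\<^esub> x"
      using y unfolding a_r_coset_def' by blast
    then have "a \<odot>\<^bsub>M\<^esub> y \<ominus>\<^bsub>M\<^esub> a \<odot>\<^bsub>M\<^esub> x = a \<odot>\<^bsub>M\<^esub> h"
      using a x D(5) by (simp add: smult_r_distr a_minus_def M.a_assoc M.r_neg)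
    then show ?thesis using coset_eq_iff[OF H] a x h D(4,5) by auto
  qed
  have "H +>\<^bsub>M\<^esub> x \<noteq> {}"
    using x D(2) M.l_zero by (force simp: a_r_coset_def')
  then have "(\<Union>y\<in>H +>\<^bsub>M\<^esub> x. H +>\<^bsub>M\<^esub> (a \<odot>\<^bsub>M\<^esub> y)) = H +>\<^bsub>M\<^esub> (a \<odot>\<^bsub>M\<^esub> x)"
    by (rule SUP_eq_const) (rule eq)
  then show "H +>\<^bsub>M\<^esub> (a \<odot>\<^bsub>M\<^esub> x) = a \<odot>\<^bsub>quot_module M H\<^esub> (H +>\<^bsub>M\<^esub> x)"
    by (simp add: quot_module_def)
qed (simp add: carrier_quot_module)

end

section \<open>Bricks\<close>

lemma free_left_module_simps [simp]:
  "carrier (free_left_module R n) = ({..<n} \<rightarrow>\<^sub>E carrier R)"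
  "add (free_left_module R n) = (\<lambda>x y. \<lambda>i\<in>{..<n}. x i \<oplus>\<^bsub>R\<^esub> y i)"
  "smult (free_left_module R n) = (\<lambda>a x. \<lambda>i\<in>{..<n}. a \<otimes>\<^bsub>R\<^esub> x i)"
  by (simp_all add: free_left_module_def)

lemma fin_presented_compact:
  assumes fp: "fin_presented R X" and ne: "\<D> \<noteq> {}"
    and sub: "\<And>D. D \<in> \<D> \<Longrightarrow> submodule D R X"
    and ch: "\<And>A B. A \<in> \<D> \<Longrightarrow> B \<in> \<D> \<Longrightarrow> A \<subseteq> B \<or> B \<subseteq> A"
    and cov: "carrier X \<subseteq> \<Union>\<D>"
  shows "carrier X \<in> \<D>"
proof -
  from fp obtain n h where X: "left_module R X"
    and h: "h \<in> mod_hom R (free_left_module R n) X" "h ` carrier (free_left_module R n) = carrier X"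
    unfolding fin_presented_def by auto
  interpret X: left_module R X by (rule X)
  define e where "e i = (\<lambda>j\<in>{..<n}. if j = i then \<one>\<^bsub>R\<^esub> else \<zero>\<^bsub>R\<^esub>)" for i
  have e: "e i \<in> {..<n} \<rightarrow>\<^sub>E carrier R" for i by (auto simp: e_def)
  have "h (e i) \<in> carrier X" for i
    using mod_homD(1)[OF h(1), of "e i"] e by simp
  then have "(\<lambda>i. h (e i)) ` {..<n} \<subseteq> \<Union>\<D>" using cov by auto
  moreover have "subset.chain UNIV \<D>" using ch by (auto simp: subset_chain_def)
  ultimately obtain D where D: "D \<in> \<D>" "(\<lambda>i. h (e i)) ` {..<n} \<subseteq> D"
    using finite_subset_Union_chain[OF finite_imageI[OF finite_lessThan]] ne by metis
  note DD = X.submoduleD[OF sub[OF D(1)]]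
  have "h v \<in> D" if "k \<le> n" "v \<in> {..<n} \<rightarrow>\<^sub>E carrier R" "\<And>i. k \<le> i \<Longrightarrow> i < n \<Longrightarrow> v i = \<zero>\<^bsub>R\<^esub>" for k v
    using that
  proof (induction k arbitrary: v)
    case 0
    have "v = (\<lambda>i\<in>{..<n}. \<zero>\<^bsub>R\<^esub> \<otimes>\<^bsub>R\<^esub> v i)"
    proof
      fix i show "v i = (\<lambda>i\<in>{..<n}. \<zero>\<^bsub>R\<^esub> \<otimes>\<^bsub>R\<^esub> v i) i"
        using "0.prems"(2) "0.prems"(3)[of i] by (auto simp: PiE_def extensional_def)
    qed
    then have "h v = \<zero>\<^bsub>R\<^esub> \<odot>\<^bsub>X\<^esub> h v"
      using mod_homD(3)[OF h(1), of "\<zero>\<^bsub>R\<^esub>" v] 0 by simp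
    also have "\<dots> = \<zero>\<^bsub>X\<^esub>"
      using X.smult_zero_left mod_homD(1)[OF h(1), of v] 0 by simp
    finally show ?case using DD(2) by simp
  next
    case (Suc k)
    define w where "w = v(k := \<zero>\<^bsub>R\<^esub>)"
    have w: "w \<in> {..<n} \<rightarrow>\<^sub>E carrier R"
      using Suc.prems(1,2) by (auto simp: w_def PiE_def extensional_def)
    have k: "k < n" and vk: "v k \<in> carrier R" using Suc.prems by auto
    have "w i = \<zero>\<^bsub>R\<^esub>" if "k \<le> i" "i < n" for i
      using that Suc.prems(3)[of i] by (cases "i = k") (auto simp: w_def)
    then have hw: "h w \<in> D" using Suc.IH[OF _ w] k by simp
    have ve: "(\<lambda>i\<in>{..<n}. v k \<otimes>\<^bsub>R\<^esub> e k i) \<in> {..<n} \<rightarrow>\<^sub>E carrier R"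
      using vk by (auto simp: e_def)
    have "v = (\<lambda>i\<in>{..<n}. w i \<oplus>\<^bsub>R\<^esub> (\<lambda>i\<in>{..<n}. v k \<otimes>\<^bsub>R\<^esub> e k i) i)"
    proof
      fix i
      have "v i \<in> carrier R" if "i < n" using Suc.prems(2) that by auto
      then show "v i = (\<lambda>i\<in>{..<n}. w i \<oplus>\<^bsub>R\<^esub> (\<lambda>i\<in>{..<n}. v k \<otimes>\<^bsub>R\<^esub> e k i) i) i"
        using Suc.prems(2) k vk by (auto simp: PiE_def extensional_def w_def e_def)
    qed
    then have "h v = h w \<oplus>\<^bsub>X\<^esub> v k \<odot>\<^bsub>X\<^esub> h (e k)"
      using mod_homD(2)[OF h(1), of w "\<lambda>i\<in>{..<n}. v k \<otimes>\<^bsub>R\<^esub> e k i"] mod_homD(3)[OF h(1), of "v k" "e k"]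
        w ve vk e by simp
    moreover have "h (e k) \<in> D" using D(2) k by auto
    ultimately show ?case using DD(3,4) hw vk by simp
  qed
  from this[of n] have "carrier X \<subseteq> D" unfolding h(2)[symmetric] by auto
  then have "D = carrier X" using DD(1) by simp
  then show ?thesis using D(1) by simp
qed

locale semibrick_modules =
  fixes R :: "'a ring" and \<X> :: "('a, 'b) module set"
  assumes semibrick: "semibrick R \<X>"
begin

lemma brick_left_module: "X \<in> \<X> \<Longrightarrow> left_module R X"
  using semibrick by (auto simp: semibrick_def brick_def)

lemma brick_compact:
  assumes "X \<in> \<X>" "\<D> \<noteq> {}" "\<And>D. D \<in> \<D> \<Longrightarrow> submodule D R X"
    "\<And>A B. A \<in> \<D> \<Longrightarrow> B \<in> \<D> \<Longrightarrow> A \<subseteq> B \<or> B \<subseteq> A" "carrier X \<subseteq> \<Union>\<D>"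
  shows "carrier X \<in> \<D>"
  using assms semibrick by (intro fin_presented_compact[of R]) (auto simp: semibrick_def brick_def)

lemma brick_schur:
  assumes X: "X \<in> \<X>" "X' \<in> \<X>" and h: "h \<in> mod_hom R X X'"
    and nz: "x\<^sub>0 \<in> carrier X" "h x\<^sub>0 \<noteq> \<zero>\<^bsub>X'\<^esub>"
  shows "h ` carrier X = carrier X'" "x \<in> carrier X \<Longrightarrow> h x = \<zero>\<^bsub>X'\<^esub> \<Longrightarrow> x = \<zero>\<^bsub>X\<^esub>"
proof -
  have eq: "X' = X" using semibrick X h nz unfolding semibrick_def by metis
  note h = h[unfolded eq] and nz = nz[unfolded eq]
  interpret X: left_module R X by (rule brick_left_module[OF X(1)])
  have div: "division_ring (End_ring R X)"
    using semibrick X(1) by (simp add: semibrick_def brick_def)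
  define g where "g = restrict h (carrier X)"
  have "g \<in> carrier (End_ring R X)"
    using h by (auto simp: End_ring_def mod_hom_iff g_def)
  moreover have "g \<noteq> \<zero>\<^bsub>End_ring R X\<^esub>"
  proof
    assume "g = \<zero>\<^bsub>End_ring R X\<^esub>"
    then have "g x\<^sub>0 = \<zero>\<^bsub>X\<^esub>" using nz(1) by (simp add: End_ring_def)
    then show False using nz by (simp add: g_def)
  qed
  ultimately have "g \<in> Units (End_ring R X)" using div by (simp add: division_ring_def)
  then obtain k where k: "k \<in> mod_hom R X X" "compose (carrier X) k g = (\<lambda>x\<in>carrier X. x)"
    "compose (carrier X) g k = (\<lambda>x\<in>carrier X. x)"
    by (auto simp: Units_def End_ring_def)
  have kh: "k (h x) = x" and hk: "h (k x) = x" if "x \<in> carrier X" for x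
    using fun_cong[OF k(2), of x] fun_cong[OF k(3), of x] that mod_homD(1)[OF k(1)]
    by (simp_all add: compose_def g_def)
  show "h ` carrier X = carrier X'"
    unfolding eq using mod_homD(1)[OF h] mod_homD(1)[OF k(1)] hk by (metis (no_types, opaque_lifting) image_eqI image_subset_iff subsetI subset_antisym)
  show "x = \<zero>\<^bsub>X\<^esub>" if "x \<in> carrier X" "h x = \<zero>\<^bsub>X'\<^esub>"
    using kh that mod_hom_zero[OF X.left_module_axioms X.left_module_axioms k(1)] unfolding eq by metis
qed

end

section \<open>Filtrations as well-ordered chains of submodules\<close>

definition chain_covers :: "'m set set \<Rightarrow> 'm set \<Rightarrow> 'm set \<Rightarrow> bool"
  where "chain_covers \<C> S T \<longleftrightarrow> S \<in> \<C> \<and> T \<in> \<C> \<and> S \<subset> T \<and> (\<forall>U\<in>\<C>. U \<subset> T \<longrightarrow> U \<subseteq> S)"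

definition X_step :: "'a ring \<Rightarrow> ('a, 'b) module set \<Rightarrow> ('a, 'm) module \<Rightarrow> 'm set \<Rightarrow> 'm set \<Rightarrow> bool"
  where "X_step R \<X> M S T \<longleftrightarrow> (\<exists>X\<in>\<X>. \<exists>q\<in>mod_hom R (M\<lparr>carrier := T\<rparr>) X.
    q ` T = carrier X \<and> S = {x \<in> T. q x = \<zero>\<^bsub>X\<^esub>})"

text \<open>The terms of a filtration, with the index ordinals forgotten.\<close>

definition X_chain :: "'a ring \<Rightarrow> ('a, 'b) module set \<Rightarrow> ('a, 'm) module \<Rightarrow> 'm set set \<Rightarrow> bool"
  where "X_chain R \<X> M \<C> \<longleftrightarrow> (\<forall>S\<in>\<C>. submodule S R M) \<and> {\<zero>\<^bsub>M\<^esub>} \<in> \<C> \<and> carrier M \<in> \<C> \<and>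
    (\<forall>D\<subseteq>\<C>. D \<noteq> {} \<longrightarrow> (\<exists>S\<in>D. \<forall>T\<in>D. S \<subseteq> T)) \<and>
    (\<forall>T\<in>\<C>. T = {\<zero>\<^bsub>M\<^esub>} \<or> T = \<Union>{S \<in> \<C>. S \<subset> T} \<or> (\<exists>S. chain_covers \<C> S T)) \<and>
    (\<forall>S T. chain_covers \<C> S T \<longrightarrow> X_step R \<X> M S T)"

lemma X_chainD:
  assumes "X_chain R \<X> M \<C>"
  shows "S \<in> \<C> \<Longrightarrow> submodule S R M" "{\<zero>\<^bsub>M\<^esub>} \<in> \<C>" "carrier M \<in> \<C>"
    "chain_covers \<C> S T \<Longrightarrow> X_step R \<X> M S T"
  using assms by (simp_all add: X_chain_def)

lemma X_chain_least:
  assumes "X_chain R \<X> M \<C>" "T \<in> \<C>" "P T"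
  obtains S where "S \<in> \<C>" "P S" "\<And>U. U \<in> \<C> \<Longrightarrow> P U \<Longrightarrow> S \<subseteq> U"
proof -
  have "{S \<in> \<C>. P S} \<subseteq> \<C>" "{S \<in> \<C>. P S} \<noteq> {}" using assms(2,3) by auto
  then have "\<exists>S\<in>{S \<in> \<C>. P S}. \<forall>T\<in>{S \<in> \<C>. P S}. S \<subseteq> T"
    using assms(1) unfolding X_chain_def by meson
  then show thesis using that by auto
qed

lemma X_chain_total:
  assumes "X_chain R \<X> M \<C>" "S \<in> \<C>" "T \<in> \<C>"
  shows "S \<subseteq> T \<or> T \<subseteq> S"
proof -
  obtain U where "U = S \<or> U = T" "\<And>V. V \<in> \<C> \<Longrightarrow> V = S \<or> V = T \<Longrightarrow> U \<subseteq> V"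
    using X_chain_least[OF assms(1,2), of "\<lambda>U. U = S \<or> U = T"] by metis
  from this(1) this(2)[OF assms(2)] this(2)[OF assms(3)] show ?thesis by auto
qed

lemma X_chain_cases:
  assumes "X_chain R \<X> M \<C>" "T \<in> \<C>"
  obtains (zero) "T = {\<zero>\<^bsub>M\<^esub>}" | (limit) "T \<noteq> {\<zero>\<^bsub>M\<^esub>}" "T = \<Union>{S \<in> \<C>. S \<subset> T}"
    | (cover) S where "chain_covers \<C> S T"
  using assms unfolding X_chain_def by meson

lemma X_chain_induct [consumes 2, case_names zero limit cover]:
  assumes "X_chain R \<X> M \<C>" "T \<in> \<C>"
    and "P {\<zero>\<^bsub>M\<^esub>}"
    and "\<And>T. T \<in> \<C> \<Longrightarrow> T \<noteq> {\<zero>\<^bsub>M\<^esub>} \<Longrightarrow> T = \<Union>{S \<in> \<C>. S \<subset> T} \<Longrightarrow> (\<And>S. S \<in> \<C> \<Longrightarrow> S \<subset> T \<Longrightarrow> P S) \<Longrightarrow> P T"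
    and "\<And>S T. chain_covers \<C> S T \<Longrightarrow> P S \<Longrightarrow> P T"
  shows "P T"
proof (rule ccontr)
  assume "\<not> P T"
  from X_chain_least[OF assms(1), of T "\<lambda>T. \<not> P T", OF assms(2) this]
  obtain T where T: "T \<in> \<C>" "\<not> P T" and *: "\<And>U. U \<in> \<C> \<Longrightarrow> \<not> P U \<Longrightarrow> T \<subseteq> U" by metis
  then have "\<And>S. S \<in> \<C> \<Longrightarrow> S \<subset> T \<Longrightarrow> P S" by blast
  with assms(1) T(1) show False
    by (cases rule: X_chain_cases) (use assms(3-5) T in \<open>auto simp: chain_covers_def\<close>)
qed

lemma (in left_module) zero_psubset:
  "submodule T R M \<Longrightarrow> T \<noteq> {\<zero>\<^bsub>M\<^esub>} \<Longrightarrow> {\<zero>\<^bsub>M\<^esub>} \<subset> T"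
  using submoduleD(2) by auto

lemma chain_covers_unique:
  "chain_covers \<C> S T \<Longrightarrow> chain_covers \<C> S' T \<Longrightarrow> S = S'"
  unfolding chain_covers_def by (meson subset_antisym)

subsection \<open>Collapsing a chain along a monotone map\<close>

lemma chain_covers_image:
  assumes "X_chain R \<X> M \<C>" and mono: "\<And>S T. S \<in> \<C> \<Longrightarrow> T \<in> \<C> \<Longrightarrow> S \<subseteq> T \<Longrightarrow> \<Phi> S \<subseteq> \<Phi> T"
    and ST: "chain_covers \<C> S T" "\<Phi> S \<noteq> \<Phi> T"
  shows "chain_covers (\<Phi> ` \<C>) (\<Phi> S) (\<Phi> T)"
proof -
  have *: "S \<in> \<C>" "T \<in> \<C>" "S \<subset> T" "\<And>U. U \<in> \<C> \<Longrightarrow> U \<subset> T \<Longrightarrow> U \<subseteq> S"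
    using ST(1) by (auto simp: chain_covers_def)
  have "\<Phi> U \<subseteq> \<Phi> S" if "U \<in> \<C>" "\<Phi> U \<subset> \<Phi> T" for U
  proof -
    have "\<not> T \<subseteq> U" using mono[OF *(2) that(1)] that(2) by auto
    then have "U \<subset> T" using X_chain_total[OF assms(1) that(1) *(2)] by auto
    then show ?thesis using mono *(1,4) that(1) by simp
  qed
  moreover have "\<Phi> S \<subset> \<Phi> T" using mono * ST(2) by (simp add: psubset_eq)
  ultimately show ?thesis using * by (auto simp: chain_covers_def)
qed

lemma X_chain_image:
  assumes C: "X_chain R \<X> M \<C>"
    and M': "left_module R M'"
    and sub: "\<And>S. S \<in> \<C> \<Longrightarrow> submodule (\<Phi> S) R M'"
    and zero: "\<Phi> {\<zero>\<^bsub>M\<^esub>} = {\<zero>\<^bsub>M'\<^esub>}" and top: "\<Phi> (carrier M) = carrier M'"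
    and mono: "\<And>S T. S \<in> \<C> \<Longrightarrow> T \<in> \<C> \<Longrightarrow> S \<subseteq> T \<Longrightarrow> \<Phi> S \<subseteq> \<Phi> T"
    and lim: "\<And>T. T \<in> \<C> \<Longrightarrow> T = \<Union>{S \<in> \<C>. S \<subset> T} \<Longrightarrow> \<Phi> T \<subseteq> \<Union>(\<Phi> ` {S \<in> \<C>. S \<subset> T})"
    and step: "\<And>S T. chain_covers \<C> S T \<Longrightarrow> \<Phi> S = \<Phi> T \<or> X_step R \<X> M' (\<Phi> S) (\<Phi> T)"
  shows "X_chain R \<X> M' (\<Phi> ` \<C>)"
proof -
  interpret M': left_module R M' by (rule M')
  have cases: "V = {\<zero>\<^bsub>M'\<^esub>} \<or> V = \<Union>{U \<in> \<Phi> ` \<C>. U \<subset> V}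
      \<or> (\<exists>S T. chain_covers \<C> S T \<and> V = \<Phi> T \<and> \<Phi> S \<noteq> \<Phi> T)" if "V \<in> \<Phi> ` \<C>" for V
  proof -
    from that obtain T\<^sub>0 where "T\<^sub>0 \<in> \<C>" "V = \<Phi> T\<^sub>0" by auto
    from X_chain_least[OF C, of T\<^sub>0 "\<lambda>T. V = \<Phi> T", OF this]
    obtain T where T: "T \<in> \<C>" "V = \<Phi> T" and least: "\<And>U. U \<in> \<C> \<Longrightarrow> V = \<Phi> U \<Longrightarrow> T \<subseteq> U" by metis
    have ne: "\<Phi> S \<subset> V" if "S \<in> \<C>" "S \<subset> T" for S
      using mono[of S T] least[of S] that T by auto
    from C T(1) show ?thesis
    proof (cases rule: X_chain_cases)
      case limit
      have "\<Phi> T \<subseteq> \<Union>(\<Phi> ` {S \<in> \<C>. S \<subset> T})" by (rule lim[OF T(1) limit(2)])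
      also have "\<dots> \<subseteq> \<Union>{U \<in> \<Phi> ` \<C>. U \<subset> V}"
      proof (rule Union_mono, rule subsetI)
        fix U assume "U \<in> \<Phi> ` {S \<in> \<C>. S \<subset> T}"
        then obtain S where "S \<in> \<C>" "S \<subset> T" "U = \<Phi> S" by auto
        then show "U \<in> {U \<in> \<Phi> ` \<C>. U \<subset> V}" using ne by simp
      qed
      finally show ?thesis using T(2) by auto
    next
      case (cover S)
      then have "S \<in> \<C>" "S \<subset> T" by (simp_all add: chain_covers_def)
      from ne[OF this] have "\<Phi> S \<noteq> \<Phi> T" unfolding T(2) by simp
      then show ?thesis using cover T(2) by metis
    next
      case zero
      then show ?thesis using T(2) assms(4) by simp
    qed
  qed
  have covers: "\<exists>S T. chain_covers \<C> S T \<and> U = \<Phi> S \<and> V = \<Phi> T" if UV: "chain_covers (\<Phi> ` \<C>) U V" for U V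
  proof -
    have *: "U \<in> \<Phi> ` \<C>" "V \<in> \<Phi> ` \<C>" "U \<subset> V" "\<And>W. W \<in> \<Phi> ` \<C> \<Longrightarrow> W \<subset> V \<Longrightarrow> W \<subseteq> U"
      using UV by (auto simp: chain_covers_def)
    have "\<zero>\<^bsub>M'\<^esub> \<in> U" using *(1) sub M'.submoduleD(2) by auto
    then have "V \<noteq> {\<zero>\<^bsub>M'\<^esub>}" using *(3) by auto
    moreover have "\<Union>{W \<in> \<Phi> ` \<C>. W \<subset> V} \<subseteq> U" using *(4) by (intro Union_least) simp
    then have "V \<noteq> \<Union>{W \<in> \<Phi> ` \<C>. W \<subset> V}" using *(3) by auto
    ultimately obtain S T where ST: "chain_covers \<C> S T" "V = \<Phi> T" "\<Phi> S \<noteq> \<Phi> T"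
      using cases[OF *(2)] by auto
    then show ?thesis
      using chain_covers_image[OF C mono ST(1,3)] chain_covers_unique UV by metis
  qed
  have "\<exists>S\<in>D. \<forall>T\<in>D. S \<subseteq> T" if D: "D \<subseteq> \<Phi> ` \<C>" "D \<noteq> {}" for D
  proof -
    from D obtain T where "T \<in> \<C>" "\<Phi> T \<in> D" by auto
    from X_chain_least[OF C, of T "\<lambda>T. \<Phi> T \<in> D", OF this]
    obtain S where S: "S \<in> \<C>" "\<Phi> S \<in> D" "\<And>U. U \<in> \<C> \<Longrightarrow> \<Phi> U \<in> D \<Longrightarrow> S \<subseteq> U" by metis
    have "\<Phi> S \<subseteq> V" if V: "V \<in> D" for V
    proof -
      obtain U where "U \<in> \<C>" "V = \<Phi> U" using D(1) V by auto
      then show ?thesis using S mono V by simp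
    qed
    then show ?thesis using S(2) by auto
  qed
  moreover have "X_step R \<X> M' U V" if UV: "chain_covers (\<Phi> ` \<C>) U V" for U V
  proof -
    from covers[OF UV] obtain S T where "chain_covers \<C> S T" "U = \<Phi> S" "V = \<Phi> T" by auto
    then show ?thesis using step[of S T] UV by (auto simp: chain_covers_def)
  qed
  moreover have "{\<zero>\<^bsub>M'\<^esub>} \<in> \<Phi> ` \<C>" "carrier M' \<in> \<Phi> ` \<C>"
    using X_chainD(2,3)[OF C] zero top by force+
  moreover have "submodule V R M'" if "V \<in> \<Phi> ` \<C>" for V using sub that by auto
  moreover have "V = {\<zero>\<^bsub>M'\<^esub>} \<or> V = \<Union>{U \<in> \<Phi> ` \<C>. U \<subset> V} \<or> (\<exists>U. chain_covers (\<Phi> ` \<C>) U V)"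
    if "V \<in> \<Phi> ` \<C>" for V
    using cases[OF that]
  proof (elim disjE exE conjE)
    fix S T assume *: "chain_covers \<C> S T" "V = \<Phi> T" "\<Phi> S \<noteq> \<Phi> T"
    have "chain_covers (\<Phi> ` \<C>) (\<Phi> S) V"
      unfolding *(2) by (rule chain_covers_image[OF C mono *(1,3)])
    then show ?thesis by (intro disjI2 exI)
  qed (intro disjI1 disjI2, assumption)+
  ultimately show ?thesis
    unfolding X_chain_def by (intro conjI allI ballI impI) simp_all
qed

subsection \<open>Comparison with transfinite filtrations\<close>

lemma (in left_module) X_step_iff:
  assumes S: "submodule S R M" and T: "submodule T R M" and "S \<subseteq> T"
    and X: "\<And>X. X \<in> \<X> \<Longrightarrow> left_module R X"
  shows "X_step R \<X> M S T \<longleftrightarrow>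
    (\<exists>X\<in>\<X>. mod_isomorphic R (quot_module (M\<lparr>carrier := T\<rparr>) S) X)"
proof -
  let ?T = "M\<lparr>carrier := T\<rparr>"
  let ?Q = "quot_module ?T S"
  let ?p = "\<lambda>x. S +>\<^bsub>?T\<^esub> x"
  interpret T: left_module R ?T by (rule left_module_submodule[OF T])
  have ST: "submodule S R ?T" using assms by (simp add: submodule_submodule_iff)
  have Q: "left_module R ?Q" by (rule T.quot_module_is_left_module[OF ST])
  interpret Q: left_module R ?Q by (rule Q)
  have p: "?p \<in> mod_hom R ?T ?Q" by (rule T.proj_hom[OF ST])
  have pc: "carrier ?Q = ?p ` T" by (simp add: T.carrier_quot_module)
  have p0: "?p x = \<zero>\<^bsub>?Q\<^esub> \<longleftrightarrow> x \<in> S" if "x \<in> T" for x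
    using T.coset_eq_zero_iff[OF ST] that by simp
  show ?thesis
  proof
    assume "X_step R \<X> M S T"
    then obtain X q where q: "X \<in> \<X>" "q \<in> mod_hom R ?T X" "q ` T = carrier X"
      "S = {x \<in> T. q x = \<zero>\<^bsub>X\<^esub>}"
      by (auto simp: X_step_def)
    obtain k where k: "k \<in> mod_hom R ?Q X" "\<And>x. x \<in> carrier ?T \<Longrightarrow> k (?p x) = q x"
      using mod_hom_factor[OF T.left_module_axioms X[OF q(1)] q(2) Q p] pc p0 q(4) by auto
    have "inj_on k (carrier ?Q)"
      unfolding mod_hom_inj_iff[OF Q X[OF q(1)] k(1)]
    proof (intro ballI impI)
      fix y assume "y \<in> carrier ?Q" and y: "k y = \<zero>\<^bsub>X\<^esub>"
      then obtain x where x: "x \<in> T" "y = ?p x" unfolding pc by auto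
      then have "x \<in> S" using y k(2)[of x] unfolding q(4) by simp
      then show "y = \<zero>\<^bsub>?Q\<^esub>" using p0 x by simp
    qed
    moreover have "k ` carrier ?Q = carrier X"
      unfolding pc q(3)[symmetric] image_image using k(2) by simp
    ultimately show "\<exists>X\<in>\<X>. mod_isomorphic R ?Q X"
      using q(1) k(1) by (auto simp: mod_isomorphic_def bij_betw_def)
  next
    assume "\<exists>X\<in>\<X>. mod_isomorphic R ?Q X"
    then obtain X h where h: "X \<in> \<X>" "h \<in> mod_hom R ?Q X" "inj_on h (carrier ?Q)"
      "h ` carrier ?Q = carrier X"
      by (auto simp: mod_isomorphic_def bij_betw_def)
    have "h \<circ> ?p \<in> mod_hom R ?T X" by (rule mod_hom_comp[OF p h(2)])
    moreover have "(h \<circ> ?p) ` T = carrier X" using h(4) unfolding pc image_comp .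
    moreover have "S = {x \<in> T. (h \<circ> ?p) x = \<zero>\<^bsub>X\<^esub>}"
    proof -
      have "h (?p x) = \<zero>\<^bsub>X\<^esub> \<longleftrightarrow> ?p x = \<zero>\<^bsub>?Q\<^esub>" if "x \<in> T" for x
        using mod_hom_inj_iff[OF Q X[OF h(1)] h(2)] h(3) mod_hom_zero[OF Q X[OF h(1)] h(2)] that pc
        by auto
      then show ?thesis using p0 \<open>S \<subseteq> T\<close> by auto
    qed
    ultimately show "X_step R \<X> M S T" using h(1) unfolding X_step_def by (intro bexI[of _ X] bexI[of _ "h \<circ> ?p"] conjI)
  qed
qed

lemma X_chain_imp_Filt:
  assumes M: "left_module R M" and X: "\<And>X. X \<in> \<X> \<Longrightarrow> left_module R X" and C: "X_chain R \<X> M \<C>"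
  shows "M \<in> Filt R \<X>"
proof -
  interpret M: left_module R M by (rule M)
  define r where "r = {(S, T). S \<in> \<C> \<and> T \<in> \<C> \<and> S \<subseteq> T}"
  have Field: "Field r = \<C>" by (auto simp: r_def Field_def)
  have under: "under r T = {S \<in> \<C>. S \<subseteq> T}" if "T \<in> \<C>" for T
    using that by (auto simp: r_def under_def)
  have underS: "underS r T = {S \<in> \<C>. S \<subset> T}" if "T \<in> \<C>" for T
    using that by (auto simp: r_def underS_def)
  have "wf (r - Id)"
  proof (rule wfI_min)
    fix T Q assume Q: "T \<in> (Q :: 'b set set)"
    show "\<exists>z\<in>Q. \<forall>y. (y, z) \<in> r - Id \<longrightarrow> y \<notin> Q"
    proof (cases "T \<in> \<C>")
      case True
      from X_chain_least[OF C, of T "\<lambda>T. T \<in> Q", OF this Q]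
      obtain S where "S \<in> \<C>" "S \<in> Q" "\<And>U. U \<in> \<C> \<Longrightarrow> U \<in> Q \<Longrightarrow> S \<subseteq> U" by metis
      then show ?thesis by (auto simp: r_def)
    qed (use Q in \<open>auto simp: r_def\<close>)
  qed
  moreover have "Linear_order r"
    using X_chain_total[OF C] unfolding order_on_defs Field
    by (auto simp: r_def refl_on_def trans_def antisym_def total_on_def)
  ultimately have wo: "Well_order r" by (simp add: well_order_on_def)
  have succ: "chain_covers \<C> S T" if "ord_succ r S T" for S T
  proof -
    have "S \<in> \<C>" "T \<in> \<C>" and eq: "underS r T = under r S"
      using that by (simp_all add: ord_succ_def Field)
    note eq[unfolded underS[OF \<open>T \<in> \<C>\<close>] under[OF \<open>S \<in> \<C>\<close>]]
    with \<open>S \<in> \<C>\<close> have "S \<subset> T" "\<And>U. U \<in> \<C> \<Longrightarrow> U \<subset> T \<Longrightarrow> U \<subseteq> S" by blast+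
    with \<open>S \<in> \<C>\<close> \<open>T \<in> \<C>\<close> show ?thesis by (simp add: chain_covers_def)
  qed
  have succ': "ord_succ r S T" if "chain_covers \<C> S T" for S T
    using that by (auto simp: chain_covers_def ord_succ_def Field under underS)
  have zero: "T = {\<zero>\<^bsub>M\<^esub>}" if "ord_zero r T" for T
  proof (rule ccontr)
    assume "T \<noteq> {\<zero>\<^bsub>M\<^esub>}"
    moreover have "T \<in> \<C>" "{U \<in> \<C>. U \<subset> T} = {}" using that by (auto simp: ord_zero_def Field underS)
    ultimately show False using X_chainD(1,2)[OF C] M.zero_psubset by auto
  qed
  have ord0: "ord_zero r {\<zero>\<^bsub>M\<^esub>}"
    using X_chainD(1,2)[OF C] M.submoduleD(2) by (auto simp: ord_zero_def Field underS)
  have "filtration R M r (carrier M) (\<lambda>S. S)"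
    unfolding filtration_def
  proof (intro conjI ballI impI)
    fix T assume "T \<in> under r (carrier M)" and lim: "ord_limit r T"
    then have "T \<in> \<C>" by (simp add: ord_limit_def Field)
    with C show "T = (\<Union>S\<in>underS r T. S)"
    proof (cases rule: X_chain_cases)
      case (cover S)
      then show ?thesis using succ'[of S T] lim by (simp add: ord_limit_def)
    qed (use lim ord0 underS[OF \<open>T \<in> \<C>\<close>] in \<open>auto simp: ord_limit_def\<close>)
  qed (use wo X_chainD[OF C] Field under zero in auto)
  moreover have "\<exists>X\<in>\<X>. mod_isomorphic R (quot_module (M\<lparr>carrier := T\<rparr>) S) X"
    if "ord_succ r S T" for S T
  proof -
    have cov: "chain_covers \<C> S T" by (rule succ[OF that])
    then have "S \<in> \<C>" "T \<in> \<C>" "S \<subseteq> T" by (auto simp: chain_covers_def)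
    then show ?thesis
      using M.X_step_iff[of S T \<X>] X X_chainD(1)[OF C] X_chainD(4)[OF C cov] by simp
  qed
  ultimately have "X_filtration R \<X> M r (carrier M) (\<lambda>S. S)"
    by (simp add: X_filtration_def)
  then show ?thesis using M by (auto simp: Filt_def)
qed

lemma Filt_imp_X_chain:
  fixes M :: "('a, 'm) module"
  assumes X: "\<And>X. X \<in> \<X> \<Longrightarrow> left_module R X" and Filt: "M \<in> Filt R \<X>"
  obtains \<C> where "X_chain R \<X> M \<C>"
proof -
  from Filt obtain r :: "'m set rel" and \<mu> F where M: "left_module R M" and F: "X_filtration R \<X> M r \<mu> F"
    by (auto simp: Filt_def)
  interpret M: left_module R M by (rule M)
  have r: "Well_order r" and mu: "\<mu> \<in> Field r" and F\<mu>: "F \<mu> = carrier M"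
    and sub: "\<And>\<alpha>. \<alpha> \<in> under r \<mu> \<Longrightarrow> submodule (F \<alpha>) R M"
    and mono: "\<And>\<alpha> \<beta>. \<beta> \<in> under r \<mu> \<Longrightarrow> (\<alpha>, \<beta>) \<in> r \<Longrightarrow> F \<alpha> \<subseteq> F \<beta>"
    and zero: "\<And>\<alpha>. \<alpha> \<in> under r \<mu> \<Longrightarrow> ord_zero r \<alpha> \<Longrightarrow> F \<alpha> = {\<zero>\<^bsub>M\<^esub>}"
    and limit: "\<And>\<beta>. \<beta> \<in> under r \<mu> \<Longrightarrow> ord_limit r \<beta> \<Longrightarrow> F \<beta> = (\<Union>\<alpha>\<in>underS r \<beta>. F \<alpha>)"
    and step: "\<And>\<alpha> \<beta>. \<beta> \<in> under r \<mu> \<Longrightarrow> ord_succ r \<alpha> \<beta> \<Longrightarrow>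
      \<exists>X\<in>\<X>. mod_isomorphic R (quot_module (M\<lparr>carrier := F \<beta>\<rparr>) (F \<alpha>)) X"
    using F by (auto simp: X_filtration_def filtration_def under_def)
  define U where "U = under r \<mu>"
  have wo: "wo_rel r" using r by (simp add: wo_rel_def)
  have UF: "U \<subseteq> Field r" by (auto simp: U_def under_def Field_def)
  have re: "(a, a) \<in> r" if "a \<in> Field r" for a
    using wo_rel.REFL[OF wo] that by (auto simp: refl_on_def)
  have down: "\<alpha> \<in> U" if "\<beta> \<in> U" "(\<alpha>, \<beta>) \<in> r" for \<alpha> \<beta>
    using wo_rel.TRANS[OF wo] that by (auto simp: U_def under_def dest: transD)
  have least: "\<exists>\<beta>\<in>U. P \<beta> \<and> (\<forall>\<gamma>\<in>U. P \<gamma> \<longrightarrow> (\<beta>, \<gamma>) \<in> r)" if "\<alpha> \<in> U" "P \<alpha>" for \<alpha> P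
  proof -
    let ?A = "{\<gamma> \<in> U. P \<gamma>}"
    have "?A \<subseteq> Field r" "?A \<noteq> {}" using that UF by auto
    then have "wo_rel.isMinim r ?A (wo_rel.minim r ?A)" by (rule wo_rel.minim_isMinim[OF wo])
    then show ?thesis by (auto simp: wo_rel.isMinim_def[OF wo])
  qed
  let ?C = "F ` U"
  have cases: "T = {\<zero>\<^bsub>M\<^esub>} \<or> T = \<Union>{S \<in> ?C. S \<subset> T} \<or>
      (\<exists>S. chain_covers ?C S T \<and> X_step R \<X> M S T)" if T: "T \<in> ?C" for T
  proof -
    from T obtain \<beta>\<^sub>0 where "\<beta>\<^sub>0 \<in> U" "T = F \<beta>\<^sub>0" by (rule imageE)
    from least[of \<beta>\<^sub>0 "\<lambda>\<gamma>. T = F \<gamma>", OF this]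
    obtain \<beta> where \<beta>: "\<beta> \<in> U" "T = F \<beta>" and min: "\<And>\<gamma>. \<gamma> \<in> U \<Longrightarrow> T = F \<gamma> \<Longrightarrow> (\<beta>, \<gamma>) \<in> r"
      by metis
    have less: "\<alpha> \<in> U \<and> F \<alpha> \<subset> T" if "\<alpha> \<in> underS r \<beta>" for \<alpha>
    proof -
      have a: "(\<alpha>, \<beta>) \<in> r" "\<alpha> \<noteq> \<beta>" using that by (auto simp: underS_def)
      then have U: "\<alpha> \<in> U" using down \<beta> by blast
      moreover have "T \<noteq> F \<alpha>"
        using min[OF U] a wo_rel.ANTISYM[OF wo] by (auto dest: antisymD)
      ultimately show ?thesis using mono[of \<beta> \<alpha>] a \<beta> by (auto simp: U_def)
    qed
    consider "ord_zero r \<beta>" | "ord_limit r \<beta>" | \<alpha> where "ord_succ r \<alpha> \<beta>"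
      using \<beta>(1) UF by (auto simp: ord_limit_def)
    then show ?thesis
    proof cases
      case 1
      then show ?thesis using zero \<beta> by (simp add: U_def)
    next
      case 2
      then have "T = (\<Union>\<alpha>\<in>underS r \<beta>. F \<alpha>)" using limit \<beta> by (simp add: U_def)
      moreover have "F \<alpha> \<subseteq> \<Union>{S \<in> ?C. S \<subset> T}" if "\<alpha> \<in> underS r \<beta>" for \<alpha>
        using less[OF that] by (intro Union_upper) simp
      ultimately have "T \<subseteq> \<Union>{S \<in> ?C. S \<subset> T}" by (metis (no_types, lifting) UN_least)
      then show ?thesis by auto
    next
      case (3 \<alpha>)
      then have *: "\<alpha> \<in> Field r" "underS r \<beta> = under r \<alpha>" by (auto simp: ord_succ_def)
      then have a: "\<alpha> \<in> underS r \<beta>" using re by (auto simp: under_def)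
      have "S \<subseteq> F \<alpha>" if S: "S \<in> ?C" "S \<subset> T" for S
      proof -
        obtain \<gamma> where \<gamma>: "\<gamma> \<in> U" "S = F \<gamma>" using S(1) by auto
        have "(\<beta>, \<gamma>) \<notin> r" using mono[of \<gamma> \<beta>] \<gamma> S(2) \<beta> by (auto simp: U_def)
        then have "(\<gamma>, \<beta>) \<in> r" "\<gamma> \<noteq> \<beta>"
          using wo_rel.TOTALS[OF wo] \<gamma>(1) \<beta>(1) UF re by (meson subsetD)+
        then have "(\<gamma>, \<alpha>) \<in> r" using *(2) by (auto simp: under_def underS_def)
        then show ?thesis using mono[of \<alpha> \<gamma>] less[OF a] \<gamma>(2) by (auto simp: U_def)
      qed
      then have "chain_covers ?C (F \<alpha>) T"
        using less[OF a] \<beta> by (auto simp: chain_covers_def)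
      moreover have "X_step R \<X> M (F \<alpha>) T"
        using M.X_step_iff[of "F \<alpha>" T \<X>] X step[of \<beta> \<alpha>] 3 sub less[OF a] \<beta> by (auto simp: U_def)
      ultimately show ?thesis by auto
    qed
  qed
  have bot: "{\<zero>\<^bsub>M\<^esub>} \<in> ?C"
  proof -
    obtain \<beta> where \<beta>: "\<beta> \<in> U" and min: "\<And>\<gamma>. \<gamma> \<in> U \<Longrightarrow> (\<beta>, \<gamma>) \<in> r"
      using least[of \<mu> "\<lambda>_. True"] re mu by (auto simp: U_def under_def)
    have "\<alpha> \<notin> underS r \<beta>" for \<alpha>
      using min[of \<alpha>] down[OF \<beta>] wo_rel.ANTISYM[OF wo] by (auto simp: underS_def dest: antisymD)
    then have "ord_zero r \<beta>" using \<beta> UF by (auto simp: ord_zero_def)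
    then show ?thesis using zero[of \<beta>] \<beta> by (force simp: U_def)
  qed
  have step': "X_step R \<X> M S T" if cov: "chain_covers ?C S T" for S T
  proof -
    have *: "S \<in> ?C" "T \<in> ?C" "S \<subset> T" "\<And>V. V \<in> ?C \<Longrightarrow> V \<subset> T \<Longrightarrow> V \<subseteq> S"
      using cov by (auto simp: chain_covers_def)
    have "\<zero>\<^bsub>M\<^esub> \<in> S" using *(1) sub M.submoduleD(2) by (auto simp: U_def)
    then have "T \<noteq> {\<zero>\<^bsub>M\<^esub>}" using *(3) by auto
    moreover have "\<Union>{V \<in> ?C. V \<subset> T} \<subseteq> S" using *(4) by (intro Union_least) simp
    then have "T \<noteq> \<Union>{V \<in> ?C. V \<subset> T}" using *(3) by auto
    ultimately obtain S' where "chain_covers ?C S' T" "X_step R \<X> M S' T" using cases[OF *(2)] by auto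
    then show ?thesis using chain_covers_unique[OF cov] by simp
  qed
  have "X_chain R \<X> M ?C"
    unfolding X_chain_def
  proof (intro conjI allI ballI impI)
    show "carrier M \<in> ?C" using F\<mu> re[OF mu] by (auto simp: U_def under_def)
  next
    fix D assume D: "D \<subseteq> ?C" "D \<noteq> {}"
    then obtain \<alpha> where "\<alpha> \<in> U" "F \<alpha> \<in> D" by blast
    from least[of \<alpha> "\<lambda>\<alpha>. F \<alpha> \<in> D", OF this]
    obtain \<beta> where \<beta>: "\<beta> \<in> U" "F \<beta> \<in> D" "\<And>\<gamma>. \<gamma> \<in> U \<Longrightarrow> F \<gamma> \<in> D \<Longrightarrow> (\<beta>, \<gamma>) \<in> r"
      by metis
    have "F \<beta> \<subseteq> T" if T: "T \<in> D" for T
    proof -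
      obtain \<gamma> where "\<gamma> \<in> U" "T = F \<gamma>" using D T by auto
      then show ?thesis using \<beta>(3) mono[of \<gamma> \<beta>] T by (simp add: U_def)
    qed
    then show "\<exists>S\<in>D. \<forall>T\<in>D. S \<subseteq> T" using \<beta>(2) by blast
  next
    fix T assume "T \<in> ?C"
    then show "T = {\<zero>\<^bsub>M\<^esub>} \<or> T = \<Union>{S \<in> ?C. S \<subset> T} \<or> (\<exists>S. chain_covers ?C S T)"
      using cases by meson
  qed (use sub bot step' in \<open>auto simp: U_def\<close>)
  then show thesis by (rule that)
qed

section \<open>Submodules compatible with a filtration\<close>

text \<open>The submodule \<open>H\<close> inherits the steps of the first kind, the quotient by \<open>H\<close> those of the second.\<close>

definition compatible ::
  "'a ring \<Rightarrow> ('a, 'm) module \<Rightarrow> 'm set set \<Rightarrow> 'm set \<Rightarrow> bool"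
  where "compatible R M \<C> H \<longleftrightarrow> submodule H R M \<and>
    (\<forall>S T. chain_covers \<C> S T \<longrightarrow> T \<subseteq> S <+>\<^bsub>M\<^esub> H \<or> T \<inter> H \<subseteq> S)"

lemma chain_coversD:
  assumes "chain_covers \<C> S T"
  shows "S \<in> \<C>" "T \<in> \<C>" "S \<subseteq> T" "S \<noteq> T" "U \<in> \<C> \<Longrightarrow> U \<subset> T \<Longrightarrow> U \<subseteq> S"
  using assms by (auto simp: chain_covers_def)

lemma compatibleD:
  assumes "compatible R M \<C> H"
  shows "submodule H R M" "chain_covers \<C> S T \<Longrightarrow> T \<subseteq> S <+>\<^bsub>M\<^esub> H \<or> T \<inter> H \<subseteq> S"
  using assms by (auto simp: compatible_def)

lemma compatibleI:
  assumes "submodule H R M"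
    and "\<And>S T. chain_covers \<C> S T \<Longrightarrow> \<not> T \<inter> H \<subseteq> S \<Longrightarrow> T \<subseteq> S <+>\<^bsub>M\<^esub> H"
  shows "compatible R M \<C> H"
  using assms unfolding compatible_def by meson

context left_module
begin

lemma set_add_mono: "A \<subseteq> A' \<Longrightarrow> B \<subseteq> B' \<Longrightarrow> A <+>\<^bsub>M\<^esub> B \<subseteq> A' <+>\<^bsub>M\<^esub> B'"
  unfolding set_add_def' by (intro UN_mono) auto

lemma add_diff_cancel:
  assumes "x \<in> carrier M" "s \<in> carrier M"
  shows "s \<oplus>\<^bsub>M\<^esub> (x \<ominus>\<^bsub>M\<^esub> s) = x"
proof -
  have "s \<oplus>\<^bsub>M\<^esub> (x \<oplus>\<^bsub>M\<^esub> \<ominus>\<^bsub>M\<^esub> s) = x \<oplus>\<^bsub>M\<^esub> (s \<oplus>\<^bsub>M\<^esub> \<ominus>\<^bsub>M\<^esub> s)"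
    using assms by (intro M.a_lcomm) auto
  then show ?thesis using assms by (simp add: a_minus_def M.r_neg)
qed

lemma diff_add_cancel:
  "x \<in> carrier M \<Longrightarrow> y \<in> carrier M \<Longrightarrow> (x \<oplus>\<^bsub>M\<^esub> y) \<ominus>\<^bsub>M\<^esub> y = x"
  by (simp add: a_minus_def M.a_assoc M.r_neg)

lemma mem_set_add_diff:
  assumes "s \<in> S" "x \<in> carrier M" "s \<in> carrier M" "x \<ominus>\<^bsub>M\<^esub> s \<in> H"
  shows "x \<in> S <+>\<^bsub>M\<^esub> H"
  using set_addI[OF assms(1,4)] add_diff_cancel[OF assms(2,3)] by simp

lemma compatible_zero:
  assumes C: "X_chain R \<X> M \<C>"
  shows "compatible R M \<C> {\<zero>\<^bsub>M\<^esub>}"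
proof (rule compatibleI)
  fix S T assume "chain_covers \<C> S T" and *: "\<not> T \<inter> {\<zero>\<^bsub>M\<^esub>} \<subseteq> S"
  then have "S \<in> \<C>" by (simp add: chain_coversD)
  then have "\<zero>\<^bsub>M\<^esub> \<in> S" using submoduleD(2) X_chainD(1)[OF C] by simp
  then show "T \<subseteq> S <+>\<^bsub>M\<^esub> {\<zero>\<^bsub>M\<^esub>}" using * by auto
qed (rule submodule_zero)

lemma compatible_Union:
  assumes C: "X_chain R \<X> M \<C>" and "\<D> \<noteq> {}" and comp: "\<And>D. D \<in> \<D> \<Longrightarrow> compatible R M \<C> D"
    and ch: "\<And>A B. A \<in> \<D> \<Longrightarrow> B \<in> \<D> \<Longrightarrow> A \<subseteq> B \<or> B \<subseteq> A"
  shows "compatible R M \<C> (\<Union>\<D>)"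
proof (rule compatibleI)
  show "submodule (\<Union>\<D>) R M"
    by (rule submodule_Union_chain[OF assms(2) compatibleD(1)[OF comp] ch])
  fix S T assume cov: "chain_covers \<C> S T" and "\<not> T \<inter> \<Union>\<D> \<subseteq> S"
  then obtain D where D: "D \<in> \<D>" "\<not> T \<inter> D \<subseteq> S" by auto
  then have "T \<subseteq> S <+>\<^bsub>M\<^esub> D" using compatibleD(2)[OF comp[OF D(1)] cov] by simp
  also have "\<dots> \<subseteq> S <+>\<^bsub>M\<^esub> \<Union>\<D>" by (rule set_add_mono) (use D(1) in auto)
  finally show "T \<subseteq> S <+>\<^bsub>M\<^esub> \<Union>\<D>" .
qed

lemma compatible_imp_X_chain:
  assumes C: "X_chain R \<X> M \<C>" and H: "compatible R M \<C> H"
  shows "X_chain R \<X> (M\<lparr>carrier := H\<rparr>) ((\<lambda>S. S \<inter> H) ` \<C>)"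
proof (rule X_chain_image[OF C])
  note sH = compatibleD(1)[OF H] and sC = X_chainD(1)[OF C]
  show "left_module R (M\<lparr>carrier := H\<rparr>)" by (rule left_module_submodule[OF sH])
  show "submodule (S \<inter> H) R (M\<lparr>carrier := H\<rparr>)" if "S \<in> \<C>" for S
    using submodule_submodule_iff[OF sH] submodule_Int[OF sC[OF that] sH] by simp
  show "{\<zero>\<^bsub>M\<^esub>} \<inter> H = {\<zero>\<^bsub>M\<lparr>carrier := H\<rparr>\<^esub>}" using submoduleD(2)[OF sH] by simp
  show "carrier M \<inter> H = carrier (M\<lparr>carrier := H\<rparr>)" using submoduleD(1)[OF sH] by auto
  show "T \<inter> H \<subseteq> \<Union> ((\<lambda>S. S \<inter> H) ` {S \<in> \<C>. S \<subset> T})" if "T = \<Union> {S \<in> \<C>. S \<subset> T}" for T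
  proof
    fix x assume x: "x \<in> T \<inter> H"
    then have "x \<in> \<Union>{S \<in> \<C>. S \<subset> T}" using equalityD1[OF that] by auto
    then show "x \<in> \<Union> ((\<lambda>S. S \<inter> H) ` {S \<in> \<C>. S \<subset> T})" using x by auto
  qed
  fix S T assume cov: "chain_covers \<C> S T"
  note S = sC[OF chain_coversD(1)[OF cov]] and T = sC[OF chain_coversD(2)[OF cov]]
    and ST = chain_coversD(3)[OF cov]
  show "S \<inter> H = T \<inter> H \<or> X_step R \<X> (M\<lparr>carrier := H\<rparr>) (S \<inter> H) (T \<inter> H)"
  proof (cases "T \<inter> H \<subseteq> S")
    case True
    then show ?thesis using ST by auto
  next
    case False
    then have sub: "T \<subseteq> S <+>\<^bsub>M\<^esub> H" using compatibleD(2)[OF H cov] by simp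
    obtain X q where q: "X \<in> \<X>" "q \<in> mod_hom R (M\<lparr>carrier := T\<rparr>) X" "q ` T = carrier X"
      "S = {x \<in> T. q x = \<zero>\<^bsub>X\<^esub>}"
      using X_chainD(4)[OF C cov] by (auto simp: X_step_def)
    have "q t \<in> q ` (T \<inter> H)" if t: "t \<in> T" for t
    proof -
      from subsetD[OF sub t] obtain s h where sh: "s \<in> S" "h \<in> H" "t = s \<oplus>\<^bsub>M\<^esub> h"
        by (rule set_addE)
      have sT: "s \<in> T" using sh(1) ST by auto
      have hT: "h \<in> T"
        using submodule_summand[OF T, of s h] t sh submoduleD(5)[OF T] submoduleD(5)[OF sH] sT by simp
      have "q t = q s \<oplus>\<^bsub>X\<^esub> q h" using mod_homD(2)[OF q(2), of s h] sh sT hT by simp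
      also have "q s = \<zero>\<^bsub>X\<^esub>" using sh(1) q(4) by simp
      finally have 1: "q t = \<zero>\<^bsub>X\<^esub> \<oplus>\<^bsub>X\<^esub> q h" .
      have "q (\<zero>\<^bsub>M\<^esub> \<oplus>\<^bsub>M\<^esub> h) = q \<zero>\<^bsub>M\<^esub> \<oplus>\<^bsub>X\<^esub> q h"
        using mod_homD(2)[OF q(2), of "\<zero>\<^bsub>M\<^esub>" h] hT submoduleD(2)[OF T] by simp
      moreover have "q \<zero>\<^bsub>M\<^esub> = \<zero>\<^bsub>X\<^esub>" using submoduleD(2)[OF S] q(4) by simp
      moreover have "\<zero>\<^bsub>M\<^esub> \<oplus>\<^bsub>M\<^esub> h = h" using hT submoduleD(5)[OF T] by simp
      ultimately have "q t = q h" using 1 by simp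
      then show ?thesis using hT sh(2) by auto
    qed
    then have "q ` (T \<inter> H) = carrier X" unfolding q(3)[symmetric] by auto
    moreover have "q \<in> mod_hom R (M\<lparr>carrier := T \<inter> H\<rparr>) X"
      using mod_hom_restrict[OF q(2), of "T \<inter> H"] by simp
    moreover have "S \<inter> H = {x \<in> T \<inter> H. q x = \<zero>\<^bsub>X\<^esub>}" using q(4) by auto
    ultimately have "X_step R \<X> (M\<lparr>carrier := H\<rparr>) (S \<inter> H) (T \<inter> H)"
      using q(1) unfolding X_step_def by (intro bexI[of _ X] bexI[of _ q]) simp_all
    then show ?thesis by simp
  qed
qed auto

end

context
  fixes R :: "'a ring" and \<X> :: "('a, 'b) module set"
    and M :: "('a, 'm) module" and P :: "('a, 'p) module" and p :: "'m \<Rightarrow> 'p" and \<C>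
  assumes M: "left_module R M" and P: "left_module R P" and p: "p \<in> mod_hom R M P"
    and X: "\<And>X. X \<in> \<X> \<Longrightarrow> left_module R X"
    and surj: "p ` carrier M = carrier P"
    and C: "X_chain R \<X> M \<C>"
    and ker: "compatible R M \<C> {x \<in> carrier M. p x = \<zero>\<^bsub>P\<^esub>}"
begin

interpretation M: left_module R M by (rule M)
interpretation P: left_module R P by (rule P)

lemma X_chain_quotient: "X_chain R \<X> P ((`) p ` \<C>)"
proof (rule X_chain_image[OF C P])
  let ?K = "{x \<in> carrier M. p x = \<zero>\<^bsub>P\<^esub>}"
  note sC = X_chainD(1)[OF C]
  show "submodule (p ` S) R P" if "S \<in> \<C>" for S
    by (rule submodule_image[OF M P p sC[OF that]])
  show "p ` {\<zero>\<^bsub>M\<^esub>} = {\<zero>\<^bsub>P\<^esub>}" using mod_hom_zero[OF M P p] by simp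
  show "p ` T \<subseteq> \<Union> ((`) p ` {S \<in> \<C>. S \<subset> T})" if "T = \<Union> {S \<in> \<C>. S \<subset> T}" for T
    using arg_cong[OF that, of "(`) p"] by (simp add: image_Union)
  fix S T assume cov: "chain_covers \<C> S T"
  note S = sC[OF chain_coversD(1)[OF cov]] and T = sC[OF chain_coversD(2)[OF cov]]
    and ST = chain_coversD(3)[OF cov]
  show "p ` S = p ` T \<or> X_step R \<X> P (p ` S) (p ` T)"
  proof (cases "T \<inter> ?K \<subseteq> S")
    case False
    then have sub: "T \<subseteq> S <+>\<^bsub>M\<^esub> ?K" using compatibleD(2)[OF ker cov] by simp
    have "p t \<in> p ` S" if "t \<in> T" for t
    proof -
      from subsetD[OF sub that] obtain s k where sk: "s \<in> S" "k \<in> ?K" "t = s \<oplus>\<^bsub>M\<^esub> k"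
        by (rule M.set_addE)
      then have "p t = p s"
        using mod_homD(1,2)[OF p] M.submoduleD(5)[OF S sk(1)] by simp
      then show ?thesis using sk(1) by simp
    qed
    then have "p ` T \<subseteq> p ` S" by auto
    then show ?thesis using image_mono[OF ST, of p] by auto
  next
    case True
    obtain X q where q: "X \<in> \<X>" "q \<in> mod_hom R (M\<lparr>carrier := T\<rparr>) X" "q ` T = carrier X"
      "S = {x \<in> T. q x = \<zero>\<^bsub>X\<^esub>}"
      using X_chainD(4)[OF C cov] by (auto simp: X_step_def)
    note TM = M.submoduleD(1)[OF T]
    have lT: "left_module R (M\<lparr>carrier := T\<rparr>)" by (rule M.left_module_submodule[OF T])
    have pT: "left_module R (P\<lparr>carrier := p ` T\<rparr>)"
      by (rule P.left_module_submodule[OF submodule_image[OF M P p T]])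
    have "p \<in> mod_hom R (M\<lparr>carrier := T\<rparr>) (P\<lparr>carrier := p ` T\<rparr>)"
      using mod_hom_restrict[OF p TM] by (auto simp: mod_hom_iff)
    moreover have "q x = \<zero>\<^bsub>X\<^esub>" if "x \<in> T" "p x = \<zero>\<^bsub>P\<^esub>" for x
      using True that TM q(4) by auto
    ultimately obtain k where k: "k \<in> mod_hom R (P\<lparr>carrier := p ` T\<rparr>) X" "\<And>x. x \<in> T \<Longrightarrow> k (p x) = q x"
      using mod_hom_factor[OF lT X[OF q(1)] q(2) pT, of p] by auto
    have "k ` p ` T = carrier X" unfolding q(3)[symmetric] image_image using k(2) by simp
    moreover have "p ` S = {y \<in> p ` T. k y = \<zero>\<^bsub>X\<^esub>}" using k(2) q(4) by auto
    ultimately have "X_step R \<X> P (p ` S) (p ` T)"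
      using q(1) k(1) unfolding X_step_def by (intro bexI[of _ X] bexI[of _ k]) simp_all
    then show ?thesis by simp
  qed
qed (use surj in auto)

lemma compatible_vimage:
  assumes K: "compatible R P ((`) p ` \<C>) K"
  shows "compatible R M \<C> {x \<in> carrier M. p x \<in> K}"
proof (rule compatibleI)
  let ?K = "{x \<in> carrier M. p x \<in> K}"
  let ?N = "{x \<in> carrier M. p x = \<zero>\<^bsub>P\<^esub>}"
  note sC = X_chainD(1)[OF C] and sK = compatibleD(1)[OF K]
  show "submodule ?K R M" by (rule submodule_vimage[OF M P p sK])
  fix S T assume cov: "chain_covers \<C> S T" and no: "\<not> T \<inter> ?K \<subseteq> S"
  note S = sC[OF chain_coversD(1)[OF cov]] and T = sC[OF chain_coversD(2)[OF cov]]
    and ST = chain_coversD(3)[OF cov]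
  have NK: "?N \<subseteq> ?K" using P.submoduleD(2)[OF sK] by auto
  show "T \<subseteq> S <+>\<^bsub>M\<^esub> ?K"
  proof (cases "T \<inter> ?N \<subseteq> S")
    case False
    then have "T \<subseteq> S <+>\<^bsub>M\<^esub> ?N" using compatibleD(2)[OF ker cov] by simp
    also have "\<dots> \<subseteq> S <+>\<^bsub>M\<^esub> ?K" by (rule M.set_add_mono[OF subset_refl NK])
    finally show ?thesis .
  next
    case True
    have pS: "t \<in> S" if t: "t \<in> T" "p t \<in> p ` S" for t
    proof -
      obtain s where s: "s \<in> S" "p t = p s" using t(2) by auto
      have tM: "t \<in> carrier M" "s \<in> carrier M" using M.submoduleD(5)[OF T t(1)] M.submoduleD(5)[OF S s(1)] .
      have "t \<ominus>\<^bsub>M\<^esub> s \<in> T" using M.submoduleD(7)[OF T t(1)] s(1) ST by auto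
      moreover have "p (t \<ominus>\<^bsub>M\<^esub> s) = \<zero>\<^bsub>P\<^esub>"
        using s(2) tM mod_homD(1)[OF p] by (simp add: mod_hom_diff[OF M P p] P.diff_eq_zero_iff)
      ultimately have "t \<ominus>\<^bsub>M\<^esub> s \<in> S" using True tM by auto
      then have "s \<oplus>\<^bsub>M\<^esub> (t \<ominus>\<^bsub>M\<^esub> s) \<in> S" by (rule M.submoduleD(3)[OF S s(1)])
      then show ?thesis using M.add_diff_cancel[OF tM] by simp
    qed
    then have "p ` S \<noteq> p ` T" using chain_coversD(4)[OF cov] ST by auto
    then have cov': "chain_covers ((`) p ` \<C>) (p ` S) (p ` T)"
      using chain_covers_image[of R \<X> M \<C> "(`) p" S T] C cov by (simp add: image_mono)
    from no obtain x where x: "x \<in> T" "p x \<in> K" "x \<notin> S" by auto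
    have "\<not> p ` T \<inter> K \<subseteq> p ` S"
    proof
      assume "p ` T \<inter> K \<subseteq> p ` S"
      then have "p x \<in> p ` S" using x(1,2) by auto
      then show False using pS[OF x(1)] x(3) by simp
    qed
    then have sub: "p ` T \<subseteq> p ` S <+>\<^bsub>P\<^esub> K" using compatibleD(2)[OF K cov'] by simp
    show ?thesis
    proof
      fix t assume t: "t \<in> T"
      then have "p t \<in> p ` S <+>\<^bsub>P\<^esub> K" using sub by auto
      then obtain s k where sk: "s \<in> S" "k \<in> K" "p t = p s \<oplus>\<^bsub>P\<^esub> k" by (auto elim: P.set_addE)
      have tM: "t \<in> carrier M" "s \<in> carrier M" using M.submoduleD(5)[OF T t] M.submoduleD(5)[OF S sk(1)] .
      have "p (t \<ominus>\<^bsub>M\<^esub> s) = k"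
        unfolding mod_hom_diff[OF M P p tM] sk(3)
          P.M.a_comm[OF mod_homD(1)[OF p tM(2)] P.submoduleD(5)[OF sK sk(2)]]
        by (rule P.diff_add_cancel[OF P.submoduleD(5)[OF sK sk(2)] mod_homD(1)[OF p tM(2)]])
      then show "t \<in> S <+>\<^bsub>M\<^esub> ?K"
        using M.mem_set_add_diff[OF sk(1) tM] tM sk(2) by simp
    qed
  qed
qed

end

context semibrick_modules
begin

text \<open>The least term of the filtration containing a non-zero image of a brick \<open>X\<close> is not a limit, as \<open>X\<close>
  is finitely generated. By Schur's lemma the image is a complement of the preceding term in it.\<close>

lemma compatible_brick_image:
  assumes M: "left_module R M" and C: "X_chain R \<X> M \<C>"
    and X: "X \<in> \<X>" and g: "g \<in> mod_hom R X M"
  shows "compatible R M \<C> (g ` carrier X)"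
    and "(\<forall>x\<in>carrier X. g x = \<zero>\<^bsub>M\<^esub>) \<or> (\<forall>x\<in>carrier X. g x = \<zero>\<^bsub>M\<^esub> \<longrightarrow> x = \<zero>\<^bsub>X\<^esub>)"
proof -
  interpret M: left_module R M by (rule M)
  interpret X: left_module R X by (rule brick_left_module[OF X])
  note sC = X_chainD(1)[OF C] and lX = brick_left_module[OF X]
  have g0: "g \<zero>\<^bsub>X\<^esub> = \<zero>\<^bsub>M\<^esub>" by (rule mod_hom_zero[OF lX M g])
  have "g ` carrier X \<subseteq> carrier M" using mod_homD(1)[OF g] by auto
  from X_chain_least[OF C, of "carrier M" "\<lambda>T. g ` carrier X \<subseteq> T", OF X_chainD(3)[OF C] this]
  obtain T where T: "T \<in> \<C>" "g ` carrier X \<subseteq> T"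
    and min: "\<And>U. U \<in> \<C> \<Longrightarrow> g ` carrier X \<subseteq> U \<Longrightarrow> T \<subseteq> U" by metis
  have "compatible R M \<C> (g ` carrier X) \<and>
    ((\<forall>x\<in>carrier X. g x = \<zero>\<^bsub>M\<^esub>) \<or> (\<forall>x\<in>carrier X. g x = \<zero>\<^bsub>M\<^esub> \<longrightarrow> x = \<zero>\<^bsub>X\<^esub>))"
    using C T(1)
  proof (cases rule: X_chain_cases)
    case zero
    then have 0: "\<forall>x\<in>carrier X. g x = \<zero>\<^bsub>M\<^esub>" using T(2) by auto
    then have "g ` carrier X = {\<zero>\<^bsub>M\<^esub>}" using X.M.zero_closed by force
    then show ?thesis using 0 M.compatible_zero[OF C] by simp
  next
    case limit
    let ?D = "(\<lambda>S. {x \<in> carrier X. g x \<in> S}) ` {S \<in> \<C>. S \<subset> T}"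
    have "carrier X \<in> ?D"
    proof (rule brick_compact[OF X])
      have "{\<zero>\<^bsub>M\<^esub>} \<subset> T" by (rule M.zero_psubset[OF sC[OF T(1)] limit(1)])
      then show "?D \<noteq> {}" using X_chainD(2)[OF C] by auto
      show "submodule D R X" if "D \<in> ?D" for D
        using that submodule_vimage[OF lX M g sC] by auto
      show "A \<subseteq> B \<or> B \<subseteq> A" if AB: "A \<in> ?D" "B \<in> ?D" for A B
      proof -
        obtain S where S: "S \<in> \<C>" "A = {x \<in> carrier X. g x \<in> S}" using AB(1) by auto
        obtain U where U: "U \<in> \<C>" "B = {x \<in> carrier X. g x \<in> U}" using AB(2) by auto
        show ?thesis using X_chain_total[OF C S(1) U(1)] S(2) U(2) by auto
      qed
      show "carrier X \<subseteq> \<Union>?D"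
      proof
        fix x assume x: "x \<in> carrier X"
        then have "g x \<in> T" using T(2) by auto
        then have "g x \<in> \<Union>{S \<in> \<C>. S \<subset> T}" by (rule subsetD[OF equalityD1[OF limit(2)]])
        then show "x \<in> \<Union>?D" using x by auto
      qed
    qed
    then obtain S where S: "S \<in> \<C>" "S \<subset> T" "carrier X = {x \<in> carrier X. g x \<in> S}" by auto
    from S(3) have "g ` carrier X \<subseteq> S" by (metis (no_types, lifting) image_subsetI mem_Collect_eq)
    then show ?thesis using min[OF S(1)] S(2) by auto
  next
    case (cover S)
    note ST = chain_coversD[OF cover]
    note S = sC[OF ST(1)] and TM = sC[OF T(1)]
    obtain X' q where q: "X' \<in> \<X>" "q \<in> mod_hom R (M\<lparr>carrier := T\<rparr>) X'" "q ` T = carrier X'"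
      "S = {x \<in> T. q x = \<zero>\<^bsub>X'\<^esub>}"
      using X_chainD(4)[OF C cover] by (auto simp: X_step_def)
    interpret X': left_module R X' by (rule brick_left_module[OF q(1)])
    have lT: "left_module R (M\<lparr>carrier := T\<rparr>)" by (rule M.left_module_submodule[OF TM])
    have "g \<in> mod_hom R X (M\<lparr>carrier := T\<rparr>)" using g T(2) by (auto simp: mod_hom_iff)
    then have qg: "q \<circ> g \<in> mod_hom R X X'" using q(2) by (rule mod_hom_comp)
    have "\<not> g ` carrier X \<subseteq> S" using min[OF ST(1)] ST(3,4) by auto
    then obtain x\<^sub>0 where x0: "x\<^sub>0 \<in> carrier X" "(q \<circ> g) x\<^sub>0 \<noteq> \<zero>\<^bsub>X'\<^esub>" using q(4) T(2) by auto
    note schur = brick_schur[OF X q(1) qg x0]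
    have inS: "x = \<zero>\<^bsub>X\<^esub>" if "x \<in> carrier X" "g x \<in> S" for x
      using schur(2)[OF that(1)] that(2) q(4) by auto
    have "\<zero>\<^bsub>M\<^esub> \<in> S" by (rule M.submoduleD(2)[OF S])
    then have inj: "\<forall>x\<in>carrier X. g x = \<zero>\<^bsub>M\<^esub> \<longrightarrow> x = \<zero>\<^bsub>X\<^esub>" using inS by auto
    have top: "T \<subseteq> S <+>\<^bsub>M\<^esub> g ` carrier X"
    proof
      fix t assume t: "t \<in> T"
      then have "q t \<in> (q \<circ> g) ` carrier X" using q(3) schur(1) by auto
      then obtain x where x: "x \<in> carrier X" "q t = q (g x)" by auto
      have gx: "g x \<in> T" using x(1) T(2) by auto
      have "t \<ominus>\<^bsub>M\<^esub> g x \<in> T" by (rule M.submoduleD(7)[OF TM t gx])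
      moreover have "q (t \<ominus>\<^bsub>M\<^esub> g x) = \<zero>\<^bsub>X'\<^esub>"
      proof -
        let ?d = "t \<ominus>\<^bsub>M\<^esub> g x"
        have c: "t \<in> carrier M" "g x \<in> carrier M"
          using M.submoduleD(5)[OF TM t] M.submoduleD(5)[OF TM gx] .
        have d: "?d \<in> T" by (rule M.submoduleD(7)[OF TM t gx])
        have "?d \<oplus>\<^bsub>M\<^esub> g x = t" using c by (simp add: a_minus_def M.M.a_assoc M.M.l_neg)
        then have "q t = q ?d \<oplus>\<^bsub>X'\<^esub> q (g x)" using mod_homD(2)[OF q(2), of ?d "g x"] d gx by simp
        moreover have "q ?d \<in> carrier X'" "q (g x) \<in> carrier X'" using q(3) d gx by auto
        ultimately show ?thesis using x(2) by (metis X'.M.add.r_cancel_one')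
      qed
      ultimately have "t \<ominus>\<^bsub>M\<^esub> g x \<in> S" using q(4) by simp
      moreover have "(t \<ominus>\<^bsub>M\<^esub> g x) \<oplus>\<^bsub>M\<^esub> g x = t"
        using M.submoduleD(5)[OF TM t] M.submoduleD(5)[OF TM gx]
        by (simp add: a_minus_def M.M.a_assoc M.M.l_neg)
      ultimately show "t \<in> S <+>\<^bsub>M\<^esub> g ` carrier X"
        using M.set_addI[of "t \<ominus>\<^bsub>M\<^esub> g x" S "g x" "g ` carrier X"] x(1) by simp
    qed
    have "compatible R M \<C> (g ` carrier X)"
    proof (rule compatibleI)
      show "submodule (g ` carrier X) R M" by (rule submodule_image[OF lX M g X.submodule_carrier])
      fix U V assume UV: "chain_covers \<C> U V" and no: "\<not> V \<inter> g ` carrier X \<subseteq> U"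
      note UVD = chain_coversD[OF UV]
      have "V = T"
      proof (rule ccontr)
        assume "V \<noteq> T"
        with X_chain_total[OF C UVD(2) T(1)] consider "V \<subset> T" | "T \<subset> V" by auto
        then show False
        proof cases
          case 1
          then have "V \<subseteq> S" by (rule ST(5)[OF UVD(2)])
          then have "V \<inter> g ` carrier X \<subseteq> {\<zero>\<^bsub>M\<^esub>}" using inS g0 by auto
          moreover have "\<zero>\<^bsub>M\<^esub> \<in> U" by (rule M.submoduleD(2)[OF sC[OF UVD(1)]])
          ultimately show False using no by auto
        next
          case 2
          then have "T \<subseteq> U" by (rule UVD(5)[OF T(1)])
          then show False using no T(2) by auto
        qed
      qed
      then have "U = S" using chain_covers_unique UV cover by metis
      then show "V \<subseteq> U <+>\<^bsub>M\<^esub> g ` carrier X" using top \<open>V = T\<close> by simp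
    qed
    then show ?thesis using inj by simp
  qed
  then show "compatible R M \<C> (g ` carrier X)"
    and "(\<forall>x\<in>carrier X. g x = \<zero>\<^bsub>M\<^esub>) \<or> (\<forall>x\<in>carrier X. g x = \<zero>\<^bsub>M\<^esub> \<longrightarrow> x = \<zero>\<^bsub>X\<^esub>)"
    by simp_all
qed

end

lemma (in left_module) compatible_carrier:
  assumes C: "X_chain R \<X> M \<C>"
  shows "compatible R M \<C> (carrier M)"
proof (rule compatibleI[OF submodule_carrier])
  fix S T assume cov: "chain_covers \<C> S T"
  note S = X_chainD(1)[OF C chain_coversD(1)[OF cov]] and T = X_chainD(1)[OF C chain_coversD(2)[OF cov]]
  have "T \<subseteq> carrier M" by (rule submoduleD(1)[OF T])
  also have "\<dots> \<subseteq> S <+>\<^bsub>M\<^esub> carrier M" by (rule set_add_upper(2)[OF S submodule_carrier])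
  finally show "T \<subseteq> S <+>\<^bsub>M\<^esub> carrier M" .
qed

context semibrick_modules
begin

lemma quotient_X_chain:
  assumes N: "left_module R N" and D: "X_chain R \<X> N \<D>" and H: "compatible R N \<D> H"
  shows "X_chain R \<X> (quot_module N H) ((`) (\<lambda>x. H +>\<^bsub>N\<^esub> x) ` \<D>)"
    and "compatible R (quot_module N H) ((`) (\<lambda>x. H +>\<^bsub>N\<^esub> x) ` \<D>) K \<Longrightarrow>
      compatible R N \<D> {x \<in> carrier N. H +>\<^bsub>N\<^esub> x \<in> K}"
proof -
  interpret N: left_module R N by (rule N)
  note sH = compatibleD(1)[OF H]
  have ker: "{x \<in> carrier N. H +>\<^bsub>N\<^esub> x = \<zero>\<^bsub>quot_module N H\<^esub>} = H"
    using N.coset_eq_zero_iff[OF sH] N.submoduleD(5)[OF sH] by auto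
  have ker': "compatible R N \<D> {x \<in> carrier N. H +>\<^bsub>N\<^esub> x = \<zero>\<^bsub>quot_module N H\<^esub>}"
    unfolding ker by (rule H)
  note * = N N.quot_module_is_left_module[OF sH] N.proj_hom[OF sH] brick_left_module
    N.carrier_quot_module[symmetric] D ker'
  show "X_chain R \<X> (quot_module N H) ((`) (\<lambda>x. H +>\<^bsub>N\<^esub> x) ` \<D>)"
    by (rule X_chain_quotient[OF *])
  show "compatible R (quot_module N H) ((`) (\<lambda>x. H +>\<^bsub>N\<^esub> x) ` \<D>) K \<Longrightarrow>
      compatible R N \<D> {x \<in> carrier N. H +>\<^bsub>N\<^esub> x \<in> K}"
    by (rule compatible_vimage[OF *])
qed

lemma compatible_step:
  assumes N: "left_module R N" and D: "X_chain R \<X> N \<D>" and H: "compatible R N \<D> H"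
    and B: "left_module R B" and X: "X \<in> \<X>"
    and q: "q \<in> mod_hom R B X" "q ` carrier B = carrier X"
    and f: "f \<in> mod_hom R B N" and ker: "\<And>b. b \<in> carrier B \<Longrightarrow> q b = \<zero>\<^bsub>X\<^esub> \<Longrightarrow> f b \<in> H"
  shows "compatible R N \<D> (H <+>\<^bsub>N\<^esub> f ` carrier B)"
    and "f ` carrier B \<subseteq> H \<or> (\<forall>b\<in>carrier B. f b \<in> H \<longrightarrow> q b = \<zero>\<^bsub>X\<^esub>)"
proof -
  interpret N: left_module R N by (rule N)
  interpret B: left_module R B by (rule B)
  note sH = compatibleD(1)[OF H]
  let ?Q = "quot_module N H" and ?p = "\<lambda>x. H +>\<^bsub>N\<^esub> x"
  note p = N.proj_hom[OF sH] and Q = N.quot_module_is_left_module[OF sH]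
  interpret Q: left_module R ?Q by (rule Q)
  have fN: "f b \<in> carrier N" if "b \<in> carrier B" for b using mod_homD(1)[OF f that] .
  have "(?p \<circ> f) b = \<zero>\<^bsub>?Q\<^esub>" if "b \<in> carrier B" "q b = \<zero>\<^bsub>X\<^esub>" for b
    using N.coset_eq_zero_iff[OF sH fN] ker that by simp
  then obtain k where k: "k \<in> mod_hom R X ?Q" "\<And>b. b \<in> carrier B \<Longrightarrow> k (q b) = ?p (f b)"
    using mod_hom_factor[OF B Q mod_hom_comp[OF f p] brick_left_module[OF X] q] by auto
  note img = compatible_brick_image[OF Q quotient_X_chain(1)[OF N D H] X k(1)]
  let ?S = "H <+>\<^bsub>N\<^esub> f ` carrier B"
  have sf: "submodule (f ` carrier B) R N" by (rule submodule_image[OF B N f B.submodule_carrier])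
  have sS: "submodule ?S R N" by (rule N.submodule_set_add[OF sH sf])
  have "?S = {x \<in> carrier N. ?p x \<in> k ` carrier X}"
  proof (intro equalityI subsetI)
    fix x assume "x \<in> ?S"
    then obtain h y where hy: "h \<in> H" "y \<in> f ` carrier B" "x = h \<oplus>\<^bsub>N\<^esub> y" by (rule N.set_addE)
    then obtain b where b: "b \<in> carrier B" "y = f b" by auto
    have c: "h \<in> carrier N" "y \<in> carrier N" using N.submoduleD(5)[OF sH hy(1)] fN b by simp_all
    have "?p x = ?p h \<oplus>\<^bsub>?Q\<^esub> ?p y" unfolding hy(3) by (rule mod_homD(2)[OF p c])
    also have "?p h = \<zero>\<^bsub>?Q\<^esub>" using N.coset_eq_zero_iff[OF sH c(1)] hy(1) by simp
    also have "\<zero>\<^bsub>?Q\<^esub> \<oplus>\<^bsub>?Q\<^esub> ?p y = ?p y" by (rule Q.M.l_zero[OF mod_homD(1)[OF p c(2)]])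
    also have "\<dots> = k (q b)" using k(2) b by simp
    finally have "?p x \<in> k ` carrier X" using mod_homD(1)[OF q(1) b(1)] by simp
    moreover have "x \<in> carrier N" using c hy(3) by simp
    ultimately show "x \<in> {x \<in> carrier N. ?p x \<in> k ` carrier X}" by simp
  next
    fix x assume "x \<in> {x \<in> carrier N. ?p x \<in> k ` carrier X}"
    then have x: "x \<in> carrier N" "?p x \<in> k ` q ` carrier B" using q(2) by simp_all
    then obtain b where b: "b \<in> carrier B" "?p x = ?p (f b)" using k(2) by auto
    then have "x \<ominus>\<^bsub>N\<^esub> f b \<in> H" using N.coset_eq_iff[OF sH x(1) fN[OF b(1)]] by simp
    then have "x \<ominus>\<^bsub>N\<^esub> f b \<in> ?S" "f b \<in> ?S" using N.set_add_upper[OF sH sf] b(1) by auto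
    then have "f b \<oplus>\<^bsub>N\<^esub> (x \<ominus>\<^bsub>N\<^esub> f b) \<in> ?S" by (intro N.submoduleD(3)[OF sS])
    then show "x \<in> ?S" using N.add_diff_cancel[OF x(1) fN[OF b(1)]] by simp
  qed
  then show "compatible R N \<D> ?S" using quotient_X_chain(2)[OF N D H img(1)] by simp
  show "f ` carrier B \<subseteq> H \<or> (\<forall>b\<in>carrier B. f b \<in> H \<longrightarrow> q b = \<zero>\<^bsub>X\<^esub>)"
    using img(2)
  proof
    assume *: "\<forall>x\<in>carrier X. k x = \<zero>\<^bsub>?Q\<^esub>"
    have "f b \<in> H" if b: "b \<in> carrier B" for b
      using * k(2)[OF b] mod_homD(1)[OF q(1) b] N.coset_eq_zero_iff[OF sH fN[OF b]] by simp
    then show ?thesis by auto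
  next
    assume *: "\<forall>x\<in>carrier X. k x = \<zero>\<^bsub>?Q\<^esub> \<longrightarrow> x = \<zero>\<^bsub>X\<^esub>"
    have "q b = \<zero>\<^bsub>X\<^esub>" if b: "b \<in> carrier B" "f b \<in> H" for b
      using * k(2)[OF b(1)] mod_homD(1)[OF q(1) b(1)] N.coset_eq_zero_iff[OF sH fN[OF b(1)]] b(2) by simp
    then show ?thesis by simp
  qed
qed

lemma compatible_step_brick:
  assumes N: "left_module R N" "X_chain R \<X> N \<D>" and H: "compatible R N \<D> H"
    and X: "X \<in> \<X>" and h: "h \<in> mod_hom R X N"
  shows "compatible R N \<D> (H <+>\<^bsub>N\<^esub> h ` carrier X)"
    and "h ` carrier X \<subseteq> H \<or> (\<forall>x\<in>carrier X. h x \<in> H \<longrightarrow> x = \<zero>\<^bsub>X\<^esub>)"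
proof -
  interpret N: left_module R N by (rule N(1))
  note lX = brick_left_module[OF X]
  have "(\<lambda>x. x) \<in> mod_hom R X X" by (simp add: mod_hom_iff)
  moreover have "h x \<in> H" if "x = \<zero>\<^bsub>X\<^esub>" for x
    using mod_hom_zero[OF lX N(1) h] N.submoduleD(2)[OF compatibleD(1)[OF H]] that by simp
  ultimately show "compatible R N \<D> (H <+>\<^bsub>N\<^esub> h ` carrier X)"
    and "h ` carrier X \<subseteq> H \<or> (\<forall>x\<in>carrier X. h x \<in> H \<longrightarrow> x = \<zero>\<^bsub>X\<^esub>)"
    using compatible_step[OF N H lX X, of "\<lambda>x. x" h] h by simp_all
qed

context
  fixes M :: "('a, 'm) module" and N :: "('a, 'n) module" and f :: "'m \<Rightarrow> 'n" and \<C> \<D> H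
  assumes M: "left_module R M" and C: "X_chain R \<X> M \<C>"
    and N: "left_module R N" and D: "X_chain R \<X> N \<D>"
    and f: "f \<in> mod_hom R M N" and H: "compatible R N \<D> H"
begin

interpretation M: left_module R M by (rule M)
interpretation N: left_module R N by (rule N)

lemma submodule_add_image:
  assumes "T \<in> \<C>"
  shows "submodule (f ` T) R N" "submodule (H <+>\<^bsub>N\<^esub> f ` T) R N"
proof -
  show *: "submodule (f ` T) R N"
    by (rule submodule_image[OF M N f X_chainD(1)[OF C assms]])
  show "submodule (H <+>\<^bsub>N\<^esub> f ` T) R N"
    by (rule N.submodule_set_add[OF compatibleD(1)[OF H] *])
qed

lemma cover_step:
  assumes cov: "chain_covers \<C> S T" and S: "compatible R N \<D> (H <+>\<^bsub>N\<^esub> f ` S)"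
  shows "compatible R N \<D> (H <+>\<^bsub>N\<^esub> f ` S <+>\<^bsub>N\<^esub> f ` T)"
    and "f ` T \<subseteq> H <+>\<^bsub>N\<^esub> f ` S \<or> (\<forall>x\<in>T. f x \<in> H <+>\<^bsub>N\<^esub> f ` S \<longrightarrow> x \<in> S)"
proof -
  note ST = chain_coversD[OF cov] and sH = compatibleD(1)[OF H]
  note sT = X_chainD(1)[OF C ST(2)]
  obtain X q where q: "X \<in> \<X>" "q \<in> mod_hom R (M\<lparr>carrier := T\<rparr>) X" "q ` T = carrier X"
    "S = {x \<in> T. q x = \<zero>\<^bsub>X\<^esub>}"
    using X_chainD(4)[OF C cov] by (auto simp: X_step_def)
  have "f b \<in> H <+>\<^bsub>N\<^esub> f ` S" if "b \<in> T" "q b = \<zero>\<^bsub>X\<^esub>" for b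
    using that q(4) N.set_add_upper(2)[OF sH submodule_add_image(1)[OF ST(1)]] by auto
  note step = compatible_step[OF N D S M.left_module_submodule[OF sT] q(1,2) _
    mod_hom_restrict[OF f M.submoduleD(1)[OF sT]], simplified, OF q(3) this]
  show "compatible R N \<D> (H <+>\<^bsub>N\<^esub> f ` S <+>\<^bsub>N\<^esub> f ` T)" by (rule step(1))
  show "f ` T \<subseteq> H <+>\<^bsub>N\<^esub> f ` S \<or> (\<forall>x\<in>T. f x \<in> H <+>\<^bsub>N\<^esub> f ` S \<longrightarrow> x \<in> S)"
    using step(2) q(4) by auto
qed

lemma compatible_add_image_term:
  assumes "T \<in> \<C>"
  shows "compatible R N \<D> (H <+>\<^bsub>N\<^esub> f ` T)"
  using C assms
proof (induction rule: X_chain_induct)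
  note sH = compatibleD(1)[OF H]
  case zero
  have "H <+>\<^bsub>N\<^esub> f ` {\<zero>\<^bsub>M\<^esub>} \<subseteq> H"
    using N.submoduleD(2)[OF sH] mod_hom_zero[OF M N f]
    by (intro N.set_add_least[OF sH]) auto
  moreover have "H \<subseteq> H <+>\<^bsub>N\<^esub> f ` {\<zero>\<^bsub>M\<^esub>}"
    by (rule N.set_add_upper[OF sH submodule_add_image(1)[OF X_chainD(2)[OF C]]])
  ultimately show ?case using H by (simp add: subset_antisym)
next
  case (limit T)
  let ?D = "(\<lambda>S. H <+>\<^bsub>N\<^esub> f ` S) ` {S \<in> \<C>. S \<subset> T}"
  have "{\<zero>\<^bsub>M\<^esub>} \<subset> T" by (rule M.zero_psubset[OF X_chainD(1)[OF C limit(1)] limit(2)])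
  then have ne: "?D \<noteq> {}" using X_chainD(2)[OF C] by auto
  have "compatible R N \<D> (\<Union>?D)"
  proof (rule N.compatible_Union[OF D ne])
    show "compatible R N \<D> K" if "K \<in> ?D" for K using that limit(4) by auto
    fix A B assume AB: "A \<in> ?D" "B \<in> ?D"
    obtain S where S: "S \<in> \<C>" "A = H <+>\<^bsub>N\<^esub> f ` S" using AB(1) by auto
    obtain U where U: "U \<in> \<C>" "B = H <+>\<^bsub>N\<^esub> f ` U" using AB(2) by auto
    from X_chain_total[OF C S(1) U(1)] show "A \<subseteq> B \<or> B \<subseteq> A"
      unfolding S(2) U(2) by (meson N.set_add_mono image_mono subset_refl)
  qed
  moreover have "\<Union>?D = H <+>\<^bsub>N\<^esub> f ` T"
  proof (intro equalityI subsetI)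
    fix x assume "x \<in> \<Union>?D"
    then obtain S where "S \<subset> T" "x \<in> H <+>\<^bsub>N\<^esub> f ` S" by auto
    then show "x \<in> H <+>\<^bsub>N\<^esub> f ` T"
      using N.set_add_mono[OF subset_refl image_mono, of S T H f] by auto
  next
    fix x assume "x \<in> H <+>\<^bsub>N\<^esub> f ` T"
    then obtain h y where hy: "h \<in> H" "y \<in> f ` T" "x = h \<oplus>\<^bsub>N\<^esub> y" by (rule N.set_addE)
    then obtain t where t: "t \<in> T" "y = f t" by auto
    have "t \<in> \<Union>{S \<in> \<C>. S \<subset> T}" by (rule subsetD[OF equalityD1[OF limit(3)] t(1)])
    then obtain S where "S \<in> \<C>" "S \<subset> T" "t \<in> S" by auto
    then show "x \<in> \<Union>?D" using N.set_addI[OF hy(1), of y "f ` S"] hy(3) t(2) by auto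
  qed
  ultimately show ?case by simp
next
  case (cover S T)
  note ST = chain_coversD[OF cover(1)] and sH = compatibleD(1)[OF H]
  note sS = submodule_add_image[OF ST(1)] and sT = submodule_add_image[OF ST(2)]
  have "H <+>\<^bsub>N\<^esub> f ` S <+>\<^bsub>N\<^esub> f ` T = H <+>\<^bsub>N\<^esub> f ` T"
  proof
    show "H <+>\<^bsub>N\<^esub> f ` S <+>\<^bsub>N\<^esub> f ` T \<subseteq> H <+>\<^bsub>N\<^esub> f ` T"
      by (rule N.set_add_least[OF sT(2) N.set_add_mono N.set_add_upper(2)[OF sH sT(1)]])
        (use ST(3) in auto)
    show "H <+>\<^bsub>N\<^esub> f ` T \<subseteq> H <+>\<^bsub>N\<^esub> f ` S <+>\<^bsub>N\<^esub> f ` T"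
      by (rule N.set_add_mono[OF N.set_add_upper(1)[OF sH sS(1)] subset_refl])
  qed
  then show ?case using cover_step(1)[OF cover] by simp
qed

lemma compatible_add_image: "compatible R N \<D> (H <+>\<^bsub>N\<^esub> f ` carrier M)"
  by (rule compatible_add_image_term[OF X_chainD(3)[OF C]])

lemma compatible_preimage: "compatible R M \<C> {x \<in> carrier M. f x \<in> H}"
proof (rule compatibleI)
  let ?K = "{x \<in> carrier M. f x \<in> H}"
  note sH = compatibleD(1)[OF H]
  show sK: "submodule ?K R M" by (rule submodule_vimage[OF M N f sH])
  fix S T assume cov: "chain_covers \<C> S T" and no: "\<not> T \<inter> ?K \<subseteq> S"
  note ST = chain_coversD[OF cov]
  note sS = X_chainD(1)[OF C ST(1)] and sT = X_chainD(1)[OF C ST(2)]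
  have "H \<subseteq> H <+>\<^bsub>N\<^esub> f ` S"
    by (rule N.set_add_upper(1)[OF sH submodule_add_image(1)[OF ST(1)]])
  then have "\<not> (\<forall>x\<in>T. f x \<in> H <+>\<^bsub>N\<^esub> f ` S \<longrightarrow> x \<in> S)" using no by auto
  then have sub: "f ` T \<subseteq> H <+>\<^bsub>N\<^esub> f ` S"
    using cover_step(2)[OF cov compatible_add_image_term[OF ST(1)]] by auto
  show "T \<subseteq> S <+>\<^bsub>M\<^esub> ?K"
  proof
    fix t assume t: "t \<in> T"
    then have "f t \<in> H <+>\<^bsub>N\<^esub> f ` S" using sub by auto
    then obtain h y where hy: "h \<in> H" "y \<in> f ` S" "f t = h \<oplus>\<^bsub>N\<^esub> y" by (rule N.set_addE)
    then obtain s where s: "s \<in> S" "y = f s" by auto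
    have c: "t \<in> carrier M" "s \<in> carrier M" using M.submoduleD(5)[OF sT t] M.submoduleD(5)[OF sS s(1)] .
    have "f (t \<ominus>\<^bsub>M\<^esub> s) = h"
      unfolding mod_hom_diff[OF M N f c] hy(3) s(2)
      by (rule N.diff_add_cancel[OF N.submoduleD(5)[OF sH hy(1)] mod_homD(1)[OF f c(2)]])
    then show "t \<in> S <+>\<^bsub>M\<^esub> ?K" using M.mem_set_add_diff[OF s(1) c] c hy(1) by simp
  qed
qed

end

lemma compatible_image:
  assumes M: "left_module R M" "X_chain R \<X> M \<C>" and N: "left_module R N" "X_chain R \<X> N \<D>"
    and f: "f \<in> mod_hom R M N"
  shows "compatible R N \<D> (f ` carrier M)"
proof -
  interpret M: left_module R M by (rule M(1))
  interpret N: left_module R N by (rule N(1))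
  have "{\<zero>\<^bsub>N\<^esub>} <+>\<^bsub>N\<^esub> f ` carrier M = f ` carrier M"
    using mod_homD(1)[OF f] by (auto simp: set_add_def')
  then show ?thesis
    using compatible_add_image[OF M N f N.compatible_zero[OF N(2)]] by simp
qed

lemma FiltE:
  assumes "M \<in> Filt R \<X>"
  obtains \<C> where "left_module R M" "X_chain R \<X> M \<C>"
  using Filt_imp_X_chain[OF brick_left_module assms] assms by (auto simp: Filt_def)

lemma compatible_Filt:
  assumes M: "left_module R M" "X_chain R \<X> M \<C>" and H: "compatible R M \<C> H"
  shows "M\<lparr>carrier := H\<rparr> \<in> Filt R \<X>" and "quot_module M H \<in> Filt R \<X>"
proof -
  interpret M: left_module R M by (rule M(1))
  note sH = compatibleD(1)[OF H]
  show "M\<lparr>carrier := H\<rparr> \<in> Filt R \<X>"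
    by (rule X_chain_imp_Filt[OF M.left_module_submodule[OF sH] brick_left_module
      M.compatible_imp_X_chain[OF M(2) H]])
  show "quot_module M H \<in> Filt R \<X>"
    by (rule X_chain_imp_Filt[OF M.quot_module_is_left_module[OF sH] brick_left_module
      quotient_X_chain(1)[OF M H]])
qed

lemma Filt_cokernel:
  assumes "M \<in> Filt R \<X>" "N \<in> Filt R \<X>" and f: "f \<in> mod_hom R M N"
  shows "quot_module N (f ` carrier M) \<in> Filt R \<X>"
proof -
  obtain \<C> where M: "left_module R M" "X_chain R \<X> M \<C>" using assms(1) by (rule FiltE)
  obtain \<D> where N: "left_module R N" "X_chain R \<X> N \<D>" using assms(2) by (rule FiltE)
  show ?thesis by (rule compatible_Filt(2)[OF N compatible_image[OF M N f]])
qed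

lemma Filt_sum_Int:
  assumes NF: "N \<in> Filt R \<X>" and A: "submodule A R N" "N\<lparr>carrier := A\<rparr> \<in> Filt R \<X>"
    and B: "submodule B R N" "N\<lparr>carrier := B\<rparr> \<in> Filt R \<X>"
  shows "N\<lparr>carrier := A <+>\<^bsub>N\<^esub> B\<rparr> \<in> Filt R \<X>" and "N\<lparr>carrier := A \<inter> B\<rparr> \<in> Filt R \<X>"
proof -
  obtain \<D> where N: "left_module R N" "X_chain R \<X> N \<D>" using NF by (rule FiltE)
  interpret N: left_module R N by (rule N(1))
  obtain \<A> where AA: "left_module R (N\<lparr>carrier := A\<rparr>)" "X_chain R \<X> (N\<lparr>carrier := A\<rparr>) \<A>"
    using A(2) by (rule FiltE)
  obtain \<B> where BB: "left_module R (N\<lparr>carrier := B\<rparr>)" "X_chain R \<X> (N\<lparr>carrier := B\<rparr>) \<B>"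
    using B(2) by (rule FiltE)
  note iA = mod_hom_inclusion[OF N.submoduleD(1)[OF A(1)], of R]
    and iB = mod_hom_inclusion[OF N.submoduleD(1)[OF B(1)], of R]
  have cA: "compatible R N \<D> A" using compatible_image[OF AA N iA] by simp
  show "N\<lparr>carrier := A <+>\<^bsub>N\<^esub> B\<rparr> \<in> Filt R \<X>"
    using compatible_Filt(1)[OF N compatible_add_image[OF BB N iB cA]] by simp
  have "{x \<in> B. x \<in> A} = A \<inter> B" by auto
  then show "N\<lparr>carrier := A \<inter> B\<rparr> \<in> Filt R \<X>"
    using compatible_Filt(1)[OF BB compatible_preimage[OF BB N iB cA]] by simp
qed

end

section \<open>Socles\<close>

lemma X_socle_incl:
  "X \<in> \<X> \<Longrightarrow> h \<in> mod_hom R X N \<Longrightarrow> x \<in> carrier X \<Longrightarrow> h x \<in> X_socle R \<X> N"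
  unfolding X_socle_def by (rule generate.incl) auto

lemma X_socle_least:
  assumes N: "left_module R N" and K: "submodule K R N"
    and incl: "\<And>X h. X \<in> \<X> \<Longrightarrow> h \<in> mod_hom R X N \<Longrightarrow> h ` carrier X \<subseteq> K"
  shows "X_socle R \<X> N \<subseteq> K"
proof -
  interpret N: left_module R N by (rule N)
  show ?thesis
    unfolding X_socle_def
    by (rule N.M.add.generate_subgroup_incl[OF _ submodule.axioms(1)[OF K]]) (intro UN_least incl)
qed

lemma X_socle_submodule:
  assumes M: "left_module R M" and X: "\<And>X. X \<in> \<X> \<Longrightarrow> left_module R X"
  shows "submodule (X_socle R \<X> M) R M"
proof -
  interpret left_module R M by (rule M)
  define G where "G = (\<Union>X\<in>\<X>. \<Union>h\<in>mod_hom R X M. h ` carrier X)"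
  have soc: "X_socle R \<X> M = generate (add_monoid M) G" by (simp add: X_socle_def G_def)
  have GM: "y \<in> carrier M" if "y \<in> G" for y using that by (auto simp: mod_hom_iff G_def)
  have smG: "a \<odot>\<^bsub>M\<^esub> y \<in> G" if a: "a \<in> carrier R" and y: "y \<in> G" for a y
  proof -
    obtain X h x where h: "X \<in> \<X>" "h \<in> mod_hom R X M" "x \<in> carrier X" "y = h x"
      using y by (auto simp: G_def)
    interpret X: left_module R X by (rule X[OF h(1)])
    have "a \<odot>\<^bsub>M\<^esub> y = h (a \<odot>\<^bsub>X\<^esub> x)" using mod_homD(3)[OF h(2) a h(3)] h(4) by simp
    then show ?thesis using h X.smult_closed[OF a h(3)] unfolding G_def by auto
  qed
  have gM: "y \<in> carrier M" if "y \<in> generate (add_monoid M) G" for y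
    using M.add.generate_in_carrier[of G y] GM that by auto
  have "a \<odot>\<^bsub>M\<^esub> x \<in> generate (add_monoid M) G"
    if a: "a \<in> carrier R" and "x \<in> generate (add_monoid M) G" for a x
    using that(2)
  proof (induction rule: generate.induct)
    case one
    then show ?case using a smult_zero_right generate.one[of "add_monoid M" G] by simp
  next
    case (incl y)
    then show ?case using smG[OF a] by (simp add: generate.incl)
  next
    case (inv y)
    have "inv\<^bsub>add_monoid M\<^esub> y = (\<ominus>\<^bsub>R\<^esub> \<one>\<^bsub>R\<^esub>) \<odot>\<^bsub>M\<^esub> y"
      using smult_minus_one[OF GM[OF inv]] by (simp add: a_inv_def)
    also have "\<dots> \<in> G" by (rule smG[OF R.a_inv_closed[OF R.one_closed] inv])
    finally show ?case using smG[OF a] by (simp add: generate.incl)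
  next
    case (eng x y)
    then show ?case
      using a gM[of x] gM[of y] generate.eng[of "a \<odot>\<^bsub>M\<^esub> x" "add_monoid M" G "a \<odot>\<^bsub>M\<^esub> y"]
      by (simp add: smult_r_distr)
  qed
  then show ?thesis
    unfolding soc using gM generate.one[of "add_monoid M" G] generate.eng[of _ "add_monoid M" G]
    by (intro submoduleI) auto
qed

lemma mod_hom_X_socle:
  assumes M: "left_module R M" and N: "left_module R N" and X: "\<And>X. X \<in> \<X> \<Longrightarrow> left_module R X"
    and f: "f \<in> mod_hom R M N" and x: "x \<in> X_socle R \<X> M"
  shows "f x \<in> X_socle R \<X> N"
proof -
  let ?K = "{x \<in> carrier M. f x \<in> X_socle R \<X> N}"
  have "X_socle R \<X> M \<subseteq> ?K"
  proof (rule X_socle_least[OF M submodule_vimage[OF M N f X_socle_submodule[OF N X]]])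
    fix X h assume h: "X \<in> \<X>" "h \<in> mod_hom R X M"
    then have "f (h x) \<in> X_socle R \<X> N" if "x \<in> carrier X" for x
      using X_socle_incl[OF h(1) mod_hom_comp[OF h(2) f] that] by simp
    then show "h ` carrier X \<subseteq> ?K" using mod_homD(1)[OF h(2)] by auto
  qed auto
  then show ?thesis using x by auto
qed

lemma mod_hom_of_relation:
  fixes P :: "('a, 'p) module"
  assumes P: "left_module R P" and A: "left_module R A"
    and tot: "\<And>x. x \<in> carrier A \<Longrightarrow> \<exists>y\<in>carrier P. \<rho> x y"
    and uniq: "\<And>x y z. y \<in> carrier P \<Longrightarrow> z \<in> carrier P \<Longrightarrow> \<rho> x y \<Longrightarrow> \<rho> x z \<Longrightarrow> y = z"
    and add: "\<And>x y x' y'. x \<in> carrier A \<Longrightarrow> x' \<in> carrier A \<Longrightarrow> y \<in> carrier P \<Longrightarrow> y' \<in> carrier P \<Longrightarrow>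
      \<rho> x y \<Longrightarrow> \<rho> x' y' \<Longrightarrow> \<rho> (x \<oplus>\<^bsub>A\<^esub> x') (y \<oplus>\<^bsub>P\<^esub> y')"
    and smult: "\<And>a x y. a \<in> carrier R \<Longrightarrow> x \<in> carrier A \<Longrightarrow> y \<in> carrier P \<Longrightarrow>
      \<rho> x y \<Longrightarrow> \<rho> (a \<odot>\<^bsub>A\<^esub> x) (a \<odot>\<^bsub>P\<^esub> y)"
  obtains g where "g \<in> mod_hom R A P" "\<And>x. x \<in> carrier A \<Longrightarrow> \<rho> x (g x)"
proof -
  interpret P: left_module R P by (rule P)
  interpret A: left_module R A by (rule A)
  define g where "g x = (SOME y. y \<in> carrier P \<and> \<rho> x y)" for x
  have g: "g x \<in> carrier P" "\<rho> x (g x)" if "x \<in> carrier A" for x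
    using someI_ex[of "\<lambda>y. y \<in> carrier P \<and> \<rho> x y"] tot[OF that] unfolding g_def by auto
  have "g \<in> mod_hom R A P"
  proof (rule mod_homI)
    fix x x' assume x: "x \<in> carrier A" "x' \<in> carrier A"
    then have "x \<oplus>\<^bsub>A\<^esub> x' \<in> carrier A" by simp
    from uniq[OF _ _ g(2)[OF this] add[OF x g(1)[OF x(1)] g(1)[OF x(2)] g(2)[OF x(1)] g(2)[OF x(2)]]]
    show "g (x \<oplus>\<^bsub>A\<^esub> x') = g x \<oplus>\<^bsub>P\<^esub> g x'" using g(1) x by simp
  next
    fix a x assume a: "a \<in> carrier R" and x: "x \<in> carrier A"
    then have "a \<odot>\<^bsub>A\<^esub> x \<in> carrier A" by simp
    from uniq[OF _ _ g(2)[OF this] smult[OF a x g(1)[OF x] g(2)[OF x]]]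
    show "g (a \<odot>\<^bsub>A\<^esub> x) = a \<odot>\<^bsub>P\<^esub> g x" using g(1) a x by simp
  qed (rule g(1))
  then show thesis using that g(2) by metis
qed

context semibrick_modules
begin

lemma compatible_X_socle:
  assumes N: "left_module R N" "X_chain R \<X> N \<D>"
  shows "compatible R N \<D> (X_socle R \<X> N)"
proof -
  interpret N: left_module R N by (rule N(1))
  let ?S = "X_socle R \<X> N"
  have sS: "submodule ?S R N" by (rule X_socle_submodule[OF N(1) brick_left_module])
  let ?A = "{K. compatible R N \<D> K \<and> K \<subseteq> ?S}"
  have "\<exists>K\<in>?A. \<forall>L\<in>?A. K \<subseteq> L \<longrightarrow> L = K"
  proof (rule subset_Zorn_nonempty)
    have "{\<zero>\<^bsub>N\<^esub>} \<in> ?A" using N.compatible_zero[OF N(2)] N.submoduleD(2)[OF sS] by simp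
    then show "?A \<noteq> {}" by auto
    fix \<K> assume K: "\<K> \<noteq> {}" "subset.chain ?A \<K>"
    then have "compatible R N \<D> (\<Union>\<K>)"
      by (intro N.compatible_Union[OF N(2)]) (auto simp: subset_chain_def)
    then show "\<Union>\<K> \<in> ?A" using K(2) by (auto simp: subset_chain_def)
  qed
  then obtain K where K: "compatible R N \<D> K" "K \<subseteq> ?S"
    and max: "\<And>L. compatible R N \<D> L \<Longrightarrow> L \<subseteq> ?S \<Longrightarrow> K \<subseteq> L \<Longrightarrow> L = K" by auto
  note sK = compatibleD(1)[OF K(1)]
  have "?S \<subseteq> K"
  proof (rule X_socle_least[OF N(1) sK])
    fix X h assume h: "X \<in> \<X>" "h \<in> mod_hom R X N"
    interpret X: left_module R X by (rule brick_left_module[OF h(1)])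
    have sh: "submodule (h ` carrier X) R N"
      by (rule submodule_image[OF brick_left_module[OF h(1)] N(1) h(2) X.submodule_carrier])
    have "h ` carrier X \<subseteq> ?S" using X_socle_incl[OF h] by auto
    then have "K <+>\<^bsub>N\<^esub> h ` carrier X = K"
      by (intro max[OF compatible_step_brick(1)[OF N K(1) h]] N.set_add_least[OF sS K(2)]
          N.set_add_upper(1)[OF sK sh])
    then show "h ` carrier X \<subseteq> K" using N.set_add_upper(2)[OF sK sh] by simp
  qed
  then show ?thesis using K by (simp add: subset_antisym)
qed

text \<open>A maximal compatible complement of the image of \<open>j\<close> exists and is a complement in a submodule containing the
  whole socle; projecting along it retracts the socle of \<open>N\<close> onto that of \<open>P\<close>.\<close>

lemma inj_X_socle_iff:
  assumes P: "left_module R P" "X_chain R \<X> P \<C>" and N: "left_module R N" "X_chain R \<X> N \<D>"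
    and j: "j \<in> mod_hom R P N" and inj: "\<And>y. y \<in> carrier P \<Longrightarrow> j y = \<zero>\<^bsub>N\<^esub> \<Longrightarrow> y = \<zero>\<^bsub>P\<^esub>"
    and y: "y \<in> carrier P"
  shows "j y \<in> X_socle R \<X> N \<longleftrightarrow> y \<in> X_socle R \<X> P"
proof
  interpret P: left_module R P by (rule P(1))
  interpret N: left_module R N by (rule N(1))
  show "j y \<in> X_socle R \<X> N" if "y \<in> X_socle R \<X> P"
    by (rule mod_hom_X_socle[OF P(1) N(1) brick_left_module j that])
  assume jy: "j y \<in> X_socle R \<X> N"
  let ?J = "j ` carrier P"
  have sJ: "submodule ?J R N" by (rule submodule_image[OF P(1) N(1) j P.submodule_carrier])
  let ?A = "{C. submodule C R N \<and> C \<inter> ?J \<subseteq> {\<zero>\<^bsub>N\<^esub>} \<and> compatible R N \<D> (C <+>\<^bsub>N\<^esub> ?J)}"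
  have "\<exists>C\<in>?A. \<forall>L\<in>?A. C \<subseteq> L \<longrightarrow> L = C"
  proof (rule subset_Zorn_nonempty)
    have "compatible R N \<D> ({\<zero>\<^bsub>N\<^esub>} <+>\<^bsub>N\<^esub> ?J)"
      by (rule compatible_add_image[OF P N j N.compatible_zero[OF N(2)]])
    then have "{\<zero>\<^bsub>N\<^esub>} \<in> ?A" using N.submodule_zero by simp
    then show "?A \<noteq> {}" by auto
    fix \<K> assume K: "\<K> \<noteq> {}" "subset.chain ?A \<K>"
    have KA: "K \<in> ?A" if "K \<in> \<K>" for K using K(2) that unfolding subset_chain_def by auto
    have ch: "A \<subseteq> B \<or> B \<subseteq> A" if "A \<in> \<K>" "B \<in> \<K>" for A B
      using K(2) that unfolding subset_chain_def by simp
    have "submodule (\<Union>\<K>) R N" by (rule N.submodule_Union_chain[OF K(1) _ ch]) (use KA in auto)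
    moreover have "\<Union>\<K> \<inter> ?J \<subseteq> {\<zero>\<^bsub>N\<^esub>}" using KA by auto
    moreover have "compatible R N \<D> (\<Union>\<K> <+>\<^bsub>N\<^esub> ?J)"
    proof -
      let ?D = "(\<lambda>K. K <+>\<^bsub>N\<^esub> ?J) ` \<K>"
      have "compatible R N \<D> (\<Union>?D)"
      proof (rule N.compatible_Union[OF N(2)])
        show "?D \<noteq> {}" using K(1) by simp
        show "compatible R N \<D> L" if "L \<in> ?D" for L using that KA by auto
        fix A B assume AB: "A \<in> ?D" "B \<in> ?D"
        obtain K where K: "K \<in> \<K>" "A = K <+>\<^bsub>N\<^esub> ?J" using AB(1) by auto
        obtain L where L: "L \<in> \<K>" "B = L <+>\<^bsub>N\<^esub> ?J" using AB(2) by auto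
        from ch[OF K(1) L(1)] show "A \<subseteq> B \<or> B \<subseteq> A"
          unfolding K(2) L(2) by (meson N.set_add_mono subset_refl)
      qed
      also have "\<Union>?D = \<Union>\<K> <+>\<^bsub>N\<^esub> ?J" by (simp add: set_add_def')
      finally show ?thesis .
    qed
    ultimately show "\<Union>\<K> \<in> ?A" by simp
  qed
  then obtain C where C: "submodule C R N" "C \<inter> ?J \<subseteq> {\<zero>\<^bsub>N\<^esub>}" "compatible R N \<D> (C <+>\<^bsub>N\<^esub> ?J)"
    and max: "\<And>L. submodule L R N \<Longrightarrow> L \<inter> ?J \<subseteq> {\<zero>\<^bsub>N\<^esub>} \<Longrightarrow> compatible R N \<D> (L <+>\<^bsub>N\<^esub> ?J) \<Longrightarrow> C \<subseteq> L \<Longrightarrow> L = C"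
    by auto
  let ?H = "C <+>\<^bsub>N\<^esub> ?J"
  note CN = N.submoduleD(5)[OF C(1)] and jN = mod_homD(1)[OF j] and sH = compatibleD(1)[OF C(3)]
  note upper = N.set_add_upper[OF C(1) sJ]
  have covers: "h ` carrier X \<subseteq> ?H" if h: "X \<in> \<X>" "h \<in> mod_hom R X N" for X h
    using compatible_step_brick(2)[OF N C(3) h]
  proof
    interpret X: left_module R X by (rule brick_left_module[OF h(1)])
    assume hinj: "\<forall>x\<in>carrier X. h x \<in> ?H \<longrightarrow> x = \<zero>\<^bsub>X\<^esub>"
    let ?I = "h ` carrier X"
    have sI: "submodule ?I R N"
      by (rule submodule_image[OF brick_left_module[OF h(1)] N(1) h(2) X.submodule_carrier])
    have sCI: "submodule (C <+>\<^bsub>N\<^esub> ?I) R N" by (rule N.submodule_set_add[OF C(1) sI])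
    note upI = N.set_add_upper[OF C(1) sI]
    have "C <+>\<^bsub>N\<^esub> ?I = C"
    proof (rule max[OF sCI _ _ upI(1)])
      show "(C <+>\<^bsub>N\<^esub> ?I) \<inter> ?J \<subseteq> {\<zero>\<^bsub>N\<^esub>}"
      proof
        fix z assume z: "z \<in> (C <+>\<^bsub>N\<^esub> ?I) \<inter> ?J"
        then have "z \<in> C <+>\<^bsub>N\<^esub> ?I" by simp
        then obtain c i where ci: "c \<in> C" "i \<in> ?I" "z = c \<oplus>\<^bsub>N\<^esub> i" by (rule N.set_addE)
        then obtain x where x: "x \<in> carrier X" "i = h x" by auto
        have iN: "i \<in> carrier N" by (rule N.submoduleD(5)[OF sI ci(2)])
        have "z \<in> ?H" "c \<in> ?H" using z upper ci(1) by auto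
        then have "i \<in> ?H" using N.submodule_summand[OF sH, of c i] ci(3) CN[OF ci(1)] iN by simp
        then have "i = \<zero>\<^bsub>N\<^esub>"
          using hinj x mod_hom_zero[OF brick_left_module[OF h(1)] N(1) h(2)] by simp
        then have "z \<in> C" using ci(1,3) CN by simp
        then show "z \<in> {\<zero>\<^bsub>N\<^esub>}" using z C(2) by auto
      qed
      have "C <+>\<^bsub>N\<^esub> ?I <+>\<^bsub>N\<^esub> ?J = ?H <+>\<^bsub>N\<^esub> ?I"
      proof
        note s1 = N.submodule_set_add[OF sH sI] and s2 = N.submodule_set_add[OF sCI sJ]
        note u1 = N.set_add_upper[OF sH sI] and u2 = N.set_add_upper[OF sCI sJ]
        show "C <+>\<^bsub>N\<^esub> ?I <+>\<^bsub>N\<^esub> ?J \<subseteq> ?H <+>\<^bsub>N\<^esub> ?I"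
          by (intro N.set_add_least[OF s1] subset_trans[OF upper(1) u1(1)] u1(2)
              subset_trans[OF upper(2) u1(1)])
        show "?H <+>\<^bsub>N\<^esub> ?I \<subseteq> C <+>\<^bsub>N\<^esub> ?I <+>\<^bsub>N\<^esub> ?J"
          by (intro N.set_add_least[OF s2] subset_trans[OF upI(1) u2(1)] u2(2)
              subset_trans[OF upI(2) u2(1)])
      qed
      then show "compatible R N \<D> (C <+>\<^bsub>N\<^esub> ?I <+>\<^bsub>N\<^esub> ?J)"
        using compatible_step_brick(1)[OF N C(3) h] by simp
    qed
    then have "?I \<subseteq> C" using upI(2) by simp
    then show "?I \<subseteq> ?H" using upper(1) by (rule subset_trans)
  qed
  have uniq: "u = v"
    if uv: "u \<in> carrier P" "v \<in> carrier P" "\<exists>c\<in>C. z = c \<oplus>\<^bsub>N\<^esub> j u" "\<exists>c\<in>C. z = c \<oplus>\<^bsub>N\<^esub> j v" for z u v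
  proof -
    obtain c d where cd: "c \<in> C" "z = c \<oplus>\<^bsub>N\<^esub> j u" "d \<in> C" "z = d \<oplus>\<^bsub>N\<^esub> j v" using uv(3,4) by auto
    note cN = CN[OF cd(1)] CN[OF cd(3)] jN[OF uv(1)] jN[OF uv(2)]
    have "d \<oplus>\<^bsub>N\<^esub> j (v \<ominus>\<^bsub>P\<^esub> u) = d \<oplus>\<^bsub>N\<^esub> j v \<ominus>\<^bsub>N\<^esub> j u"
      unfolding mod_hom_diff[OF P(1) N(1) j uv(2,1)]
      using cN by (simp add: a_minus_def N.M.a_assoc)
    also have "\<dots> = c" unfolding cd(4)[symmetric] cd(2) by (rule N.diff_add_cancel[OF cN(1,3)])
    finally have eq: "d \<oplus>\<^bsub>N\<^esub> j (v \<ominus>\<^bsub>P\<^esub> u) \<in> C" using cd(1) by simp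
    have vu: "v \<ominus>\<^bsub>P\<^esub> u \<in> carrier P" using uv by simp
    have "j (v \<ominus>\<^bsub>P\<^esub> u) \<in> C"
      using N.submodule_summand[OF C(1) eq cN(2) jN[OF vu]] cd(3) by simp
    then have "j (v \<ominus>\<^bsub>P\<^esub> u) = \<zero>\<^bsub>N\<^esub>" using C(2) vu by auto
    then have "v \<ominus>\<^bsub>P\<^esub> u = \<zero>\<^bsub>P\<^esub>" by (rule inj[OF vu])
    then show "u = v" using P.diff_eq_zero_iff uv by simp
  qed
  let ?S = "j ` X_socle R \<X> P"
  have sP: "submodule (X_socle R \<X> P) R P" by (rule X_socle_submodule[OF P(1) brick_left_module])
  have sS: "submodule ?S R N" by (rule submodule_image[OF P(1) N(1) j sP])
  have "X_socle R \<X> N \<subseteq> C <+>\<^bsub>N\<^esub> ?S"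
  proof (rule X_socle_least[OF N(1) N.submodule_set_add[OF C(1) sS]])
    fix X h assume h: "X \<in> \<X>" "h \<in> mod_hom R X N"
    note lX = brick_left_module[OF h(1)]
    obtain g where g: "g \<in> mod_hom R X P" "\<And>x. x \<in> carrier X \<Longrightarrow> \<exists>c\<in>C. h x = c \<oplus>\<^bsub>N\<^esub> j (g x)"
    proof (rule mod_hom_of_relation[OF P(1) lX, of "\<lambda>x y. \<exists>c\<in>C. h x = c \<oplus>\<^bsub>N\<^esub> j y"])
      fix x assume "x \<in> carrier X"
      then have "h x \<in> ?H" using covers[OF h] by auto
      then obtain c i where "c \<in> C" "i \<in> ?J" "h x = c \<oplus>\<^bsub>N\<^esub> i" by (rule N.set_addE)
      then show "\<exists>y\<in>carrier P. \<exists>c\<in>C. h x = c \<oplus>\<^bsub>N\<^esub> j y" by auto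
    next
      fix x y x' y' assume x: "x \<in> carrier X" "x' \<in> carrier X" "y \<in> carrier P" "y' \<in> carrier P"
        and "\<exists>c\<in>C. h x = c \<oplus>\<^bsub>N\<^esub> j y" "\<exists>c\<in>C. h x' = c \<oplus>\<^bsub>N\<^esub> j y'"
      then obtain c c' where c: "c \<in> C" "h x = c \<oplus>\<^bsub>N\<^esub> j y" "c' \<in> C" "h x' = c' \<oplus>\<^bsub>N\<^esub> j y'" by auto
      have "h (x \<oplus>\<^bsub>X\<^esub> x') = (c \<oplus>\<^bsub>N\<^esub> c') \<oplus>\<^bsub>N\<^esub> j (y \<oplus>\<^bsub>P\<^esub> y')"
        using mod_homD(2)[OF h(2) x(1,2)] mod_homD(2)[OF j x(3,4)] c CN[OF c(1)] CN[OF c(3)]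
          jN[OF x(3)] jN[OF x(4)] by (simp add: N.M.a_ac)
      then show "\<exists>c\<in>C. h (x \<oplus>\<^bsub>X\<^esub> x') = c \<oplus>\<^bsub>N\<^esub> j (y \<oplus>\<^bsub>P\<^esub> y')"
        using N.submoduleD(3)[OF C(1) c(1,3)] by (rule bexI)
    next
      fix a x y assume a: "a \<in> carrier R" and x: "x \<in> carrier X" "y \<in> carrier P"
        and "\<exists>c\<in>C. h x = c \<oplus>\<^bsub>N\<^esub> j y"
      then obtain c where c: "c \<in> C" "h x = c \<oplus>\<^bsub>N\<^esub> j y" by auto
      have "h (a \<odot>\<^bsub>X\<^esub> x) = a \<odot>\<^bsub>N\<^esub> c \<oplus>\<^bsub>N\<^esub> j (a \<odot>\<^bsub>P\<^esub> y)"
        using mod_homD(3)[OF h(2) a x(1)] mod_homD(3)[OF j a x(2)] c CN[OF c(1)] jN[OF x(2)] a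
        by (simp add: N.smult_r_distr)
      then show "\<exists>c\<in>C. h (a \<odot>\<^bsub>X\<^esub> x) = c \<oplus>\<^bsub>N\<^esub> j (a \<odot>\<^bsub>P\<^esub> y)"
        using N.submoduleD(4)[OF C(1) a c(1)] by (rule bexI)
    next
      fix g assume "g \<in> mod_hom R X P" "\<And>x. x \<in> carrier X \<Longrightarrow> \<exists>c\<in>C. h x = c \<oplus>\<^bsub>N\<^esub> j (g x)"
      then show thesis by (rule that)
    qed (rule uniq)
    show "h ` carrier X \<subseteq> C <+>\<^bsub>N\<^esub> ?S"
    proof
      fix z assume "z \<in> h ` carrier X"
      then obtain x where zx: "x \<in> carrier X" "z = h x" by auto
      with g(2)[OF zx(1)] obtain c where x: "x \<in> carrier X" "c \<in> C" "z = c \<oplus>\<^bsub>N\<^esub> j (g x)" by auto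
      have "j (g x) \<in> ?S" using X_socle_incl[OF h(1) g(1) x(1)] by simp
      then show "z \<in> C <+>\<^bsub>N\<^esub> ?S" unfolding x(3) by (rule N.set_addI[OF x(2)])
    qed
  qed
  then have "j y \<in> C <+>\<^bsub>N\<^esub> ?S" using jy by auto
  then obtain c i where ci: "c \<in> C" "i \<in> ?S" "j y = c \<oplus>\<^bsub>N\<^esub> i" by (rule N.set_addE)
  then obtain u where u: "u \<in> X_socle R \<X> P" "i = j u" by auto
  have "j y = \<zero>\<^bsub>N\<^esub> \<oplus>\<^bsub>N\<^esub> j y" using jN[OF y] by simp
  then have "\<exists>c\<in>C. j y = c \<oplus>\<^bsub>N\<^esub> j y" using N.submoduleD(2)[OF C(1)] by (rule bexI)
  moreover have "\<exists>c\<in>C. j y = c \<oplus>\<^bsub>N\<^esub> j u" using ci u(2) by auto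
  ultimately have "y = u" by (rule uniq[OF y P.submoduleD(5)[OF sP u(1)]])
  then show "y \<in> X_socle R \<X> P" using u(1) by simp
qed

end

section \<open>Socle filtrations\<close>

lemma well_order_induct_under [consumes 3, case_names zero succ limit]:
  assumes wo: "Well_order r" and "\<mu> \<in> Field r" "\<alpha> \<in> under r \<mu>"
    and zero: "\<And>\<alpha>. \<alpha> \<in> under r \<mu> \<Longrightarrow> ord_zero r \<alpha> \<Longrightarrow> P \<alpha>"
    and succ: "\<And>\<alpha> \<beta>. \<alpha> \<in> under r \<mu> \<Longrightarrow> \<beta> \<in> under r \<mu> \<Longrightarrow> ord_succ r \<alpha> \<beta> \<Longrightarrow> P \<alpha> \<Longrightarrow> P \<beta>"
    and limit: "\<And>\<beta>. \<beta> \<in> under r \<mu> \<Longrightarrow> ord_limit r \<beta> \<Longrightarrow>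
      (\<And>\<alpha>. \<alpha> \<in> underS r \<beta> \<Longrightarrow> \<alpha> \<in> under r \<mu> \<and> P \<alpha>) \<Longrightarrow> P \<beta>"
  shows "P \<alpha>"
proof -
  interpret w: wo_rel r using wo by (simp add: wo_rel_def)
  have "\<alpha> \<in> under r \<mu> \<longrightarrow> P \<alpha>"
  proof (induction \<alpha> rule: w.well_order_induct)
    case (1 \<beta>)
    show ?case
    proof
      assume \<beta>: "\<beta> \<in> under r \<mu>"
      have IH: "\<alpha> \<in> under r \<mu> \<and> P \<alpha>" if "\<alpha> \<in> underS r \<beta>" for \<alpha>
      proof -
        have "(\<alpha>, \<beta>) \<in> r" "\<alpha> \<noteq> \<beta>" using that by (auto simp: underS_def)
        moreover then have "\<alpha> \<in> under r \<mu>" using \<beta> w.TRANS by (auto simp: under_def dest: transD)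
        ultimately show ?thesis using 1 by auto
      qed
      have "\<beta> \<in> Field r" using \<beta> by (auto simp: under_def Field_def)
      then consider "ord_zero r \<beta>" | "ord_limit r \<beta>" | \<alpha> where "ord_succ r \<alpha> \<beta>"
        by (auto simp: ord_limit_def)
      then show "P \<beta>"
      proof cases
        case (3 \<alpha>)
        then have "\<alpha> \<in> underS r \<beta>" using w.REFL by (auto simp: ord_succ_def under_def refl_on_def)
        then show ?thesis using succ[OF _ \<beta> 3] IH by auto
      qed (use zero limit \<beta> IH in auto)
    qed
  qed
  then show ?thesis using assms(3) by simp
qed

context semibrick_modules
begin

lemma socle_filtration_compatible:
  assumes N: "left_module R N" "X_chain R \<X> N \<D>" and V: "socle_filtration R \<X> N r \<nu> V"
    and \<alpha>: "\<alpha> \<in> under r \<nu>"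
  shows "compatible R N \<D> (V \<alpha>) \<and> (\<forall>\<beta>\<in>under r \<alpha>. V \<beta> \<subseteq> V \<alpha>)"
proof -
  interpret N: left_module R N by (rule N(1))
  have r: "Well_order r" and \<nu>: "\<nu> \<in> Field r"
    and V0: "\<And>\<alpha>. \<alpha> \<in> under r \<nu> \<Longrightarrow> ord_zero r \<alpha> \<Longrightarrow> V \<alpha> = {\<zero>\<^bsub>N\<^esub>}"
    and V_Suc: "\<And>\<alpha> \<beta>. \<beta> \<in> under r \<nu> \<Longrightarrow> ord_succ r \<alpha> \<beta> \<Longrightarrow>
      V \<beta> = {x \<in> carrier N. V \<alpha> +>\<^bsub>N\<^esub> x \<in> X_socle R \<X> (quot_module N (V \<alpha>))}"
    and V_lim: "\<And>\<beta>. \<beta> \<in> under r \<nu> \<Longrightarrow> ord_limit r \<beta> \<Longrightarrow> V \<beta> = (\<Union>\<alpha>\<in>underS r \<beta>. V \<alpha>)"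
    using V by (simp_all add: socle_filtration_def)
  interpret w: wo_rel r using r by (simp add: wo_rel_def)
  have under: "under r \<beta> = insert \<beta> (underS r \<beta>)" if "\<beta> \<in> Field r" for \<beta>
    using that w.REFL by (auto simp: under_def underS_def refl_on_def)
  have F: "\<beta> \<in> Field r" if "\<beta> \<in> under r \<nu>" for \<beta> using that by (auto simp: under_def Field_def)
  show ?thesis
    using r \<nu> \<alpha>
  proof (induction rule: well_order_induct_under)
    case (zero \<alpha>)
    have "under r \<alpha> = {\<alpha>}" using under[OF F[OF zero(1)]] zero(2) by (simp add: ord_zero_def)
    then show ?case using N.compatible_zero[OF N(2)] V0[OF zero] by simp
  next
    case (succ \<alpha> \<beta>)
    then have comp: "compatible R N \<D> (V \<alpha>)" and mono: "\<And>\<gamma>. \<gamma> \<in> under r \<alpha> \<Longrightarrow> V \<gamma> \<subseteq> V \<alpha>" by simp_all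
    note sV = compatibleD(1)[OF comp]
    let ?Q = "quot_module N (V \<alpha>)"
    interpret Q: left_module R ?Q by (rule N.quot_module_is_left_module[OF sV])
    have sS: "submodule (X_socle R \<X> ?Q) R ?Q"
      by (rule X_socle_submodule[OF Q.left_module_axioms brick_left_module])
    have "V \<alpha> \<subseteq> V \<beta>"
    proof
      fix x assume x: "x \<in> V \<alpha>"
      have xN: "x \<in> carrier N" by (rule N.submoduleD(5)[OF sV x])
      have "V \<alpha> +>\<^bsub>N\<^esub> x = \<zero>\<^bsub>?Q\<^esub>" using N.coset_eq_zero_iff[OF sV xN] x by simp
      then show "x \<in> V \<beta>" unfolding V_Suc[OF succ(2,3)] using Q.submoduleD(2)[OF sS] xN by simp
    qed
    moreover have "under r \<beta> = insert \<beta> (under r \<alpha>)"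
      using under[OF F[OF succ(2)]] succ(3) by (simp add: ord_succ_def)
    moreover have "compatible R N \<D> (V \<beta>)"
      unfolding V_Suc[OF succ(2,3)]
      by (rule quotient_X_chain(2)[OF N comp compatible_X_socle[OF Q.left_module_axioms
        quotient_X_chain(1)[OF N comp]]])
    ultimately show ?case using mono by auto
  next
    case (limit \<beta>)
    have lim: "V \<beta> = (\<Union>\<alpha>\<in>underS r \<beta>. V \<alpha>)" by (rule V_lim[OF limit(1,2)])
    have "compatible R N \<D> (\<Union>(V ` underS r \<beta>))"
    proof (rule N.compatible_Union[OF N(2)])
      show "V ` underS r \<beta> \<noteq> {}" using limit(2) by (auto simp: ord_limit_def ord_zero_def)
      show "compatible R N \<D> D" if "D \<in> V ` underS r \<beta>" for D using that limit(3) by auto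
      fix A B assume AB: "A \<in> V ` underS r \<beta>" "B \<in> V ` underS r \<beta>"
      obtain a where a: "a \<in> underS r \<beta>" "A = V a" using AB(1) by auto
      obtain b where b: "b \<in> underS r \<beta>" "B = V b" using AB(2) by auto
      have "a \<in> under r b \<or> b \<in> under r a"
        using w.TOTALS F limit(3)[OF a(1)] limit(3)[OF b(1)] by (simp add: under_def)
      then show "A \<subseteq> B \<or> B \<subseteq> A" using limit(3)[OF a(1)] limit(3)[OF b(1)] a(2) b(2) by auto
    qed
    then have "compatible R N \<D> (V \<beta>)" using lim by simp
    moreover have "V \<alpha> \<subseteq> V \<beta>" if "\<alpha> \<in> underS r \<beta>" for \<alpha> using that lim by auto
    ultimately show ?case using under[OF F[OF limit(1)]] by simp
  qed
qed

lemma continue_constant_socle: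
  assumes N: "left_module R N" "X_chain R \<X> N \<D>" and V: "socle_filtration R \<X> N r \<nu> V"
  defines "W \<equiv> continue_constant N r \<nu> V"
  shows "compatible R N \<D> (W \<alpha>)"
    and "ord_zero r \<alpha> \<Longrightarrow> W \<alpha> = {\<zero>\<^bsub>N\<^esub>}"
    and "ord_succ r \<alpha> \<beta> \<Longrightarrow> W \<beta> = {x \<in> carrier N. W \<alpha> +>\<^bsub>N\<^esub> x \<in> X_socle R \<X> (quot_module N (W \<alpha>))}"
    and "ord_limit r \<beta> \<Longrightarrow> W \<beta> = (\<Union>\<alpha>\<in>underS r \<beta>. W \<alpha>)"
proof -
  interpret N: left_module R N by (rule N(1))
  have r: "Well_order r" and \<nu>: "\<nu> \<in> Field r" and V\<nu>: "V \<nu> = carrier N"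
    and V0: "\<And>\<alpha>. \<alpha> \<in> under r \<nu> \<Longrightarrow> ord_zero r \<alpha> \<Longrightarrow> V \<alpha> = {\<zero>\<^bsub>N\<^esub>}"
    and V_Suc: "\<And>\<alpha> \<beta>. \<beta> \<in> under r \<nu> \<Longrightarrow> ord_succ r \<alpha> \<beta> \<Longrightarrow>
      V \<beta> = {x \<in> carrier N. V \<alpha> +>\<^bsub>N\<^esub> x \<in> X_socle R \<X> (quot_module N (V \<alpha>))}"
    and V_lim: "\<And>\<beta>. \<beta> \<in> under r \<nu> \<Longrightarrow> ord_limit r \<beta> \<Longrightarrow> V \<beta> = (\<Union>\<alpha>\<in>underS r \<beta>. V \<alpha>)"
    using V by (simp_all add: socle_filtration_def)
  interpret w: wo_rel r using r by (simp add: wo_rel_def)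
  have W: "W \<alpha> = (if \<alpha> \<in> under r \<nu> then V \<alpha> else carrier N)" for \<alpha>
    by (simp add: W_def continue_constant_def)
  have comp: "compatible R N \<D> (W \<alpha>)" for \<alpha>
    using socle_filtration_compatible[OF N V] N.compatible_carrier[OF N(2)] by (simp add: W)
  then show "compatible R N \<D> (W \<alpha>)" .
  have above: "\<nu> \<in> underS r \<beta>" if "\<beta> \<in> Field r" "\<beta> \<notin> under r \<nu>" for \<beta>
  proof -
    have "(\<nu>, \<beta>) \<in> r" using w.TOTALS \<nu> that by (auto simp: under_def)
    moreover have "\<nu> \<noteq> \<beta>" using w.REFL \<nu> that(2) by (auto simp: under_def refl_on_def)
    ultimately show ?thesis by (simp add: underS_def)
  qed
  have \<nu>\<nu>: "\<nu> \<in> under r \<nu>" using w.REFL \<nu> by (auto simp: under_def refl_on_def)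
  show "W \<alpha> = {\<zero>\<^bsub>N\<^esub>}" if z: "ord_zero r \<alpha>"
  proof -
    have "\<alpha> \<in> under r \<nu>" using above[of \<alpha>] z by (auto simp: ord_zero_def)
    then show ?thesis using V0 z by (simp add: W)
  qed
  show "W \<beta> = {x \<in> carrier N. W \<alpha> +>\<^bsub>N\<^esub> x \<in> X_socle R \<X> (quot_module N (W \<alpha>))}" if s: "ord_succ r \<alpha> \<beta>"
  proof -
    have *: "\<alpha> \<in> Field r" "\<beta> \<in> Field r" "underS r \<beta> = under r \<alpha>" using s by (simp_all add: ord_succ_def)
    show ?thesis
    proof (cases "\<beta> \<in> under r \<nu>")
      case True
      have "\<alpha> \<in> underS r \<beta>" using *(1,3) w.REFL by (auto simp: under_def refl_on_def)
      then have "(\<alpha>, \<beta>) \<in> r" by (simp add: underS_def)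
      moreover have "(\<beta>, \<nu>) \<in> r" using True by (simp add: under_def)
      ultimately have "\<alpha> \<in> under r \<nu>" using w.TRANS unfolding under_def trans_def by auto
      then show ?thesis using V_Suc[OF True s] True by (simp add: W)
    next
      case False
      have "\<nu> \<in> under r \<alpha>" using above[OF *(2) False] *(3) by simp
      then have "\<alpha> = \<nu>" if "\<alpha> \<in> under r \<nu>"
        using that w.ANTISYM by (auto simp: under_def antisym_def)
      then have W\<alpha>: "W \<alpha> = carrier N" using V\<nu> by (auto simp: W)
      interpret Q: left_module R "quot_module N (carrier N)"
        by (rule N.quot_module_is_left_module[OF N.submodule_carrier])
      have "carrier N +>\<^bsub>N\<^esub> x \<in> X_socle R \<X> (quot_module N (carrier N))" if "x \<in> carrier N" for x
        using N.coset_eq_zero_iff[OF N.submodule_carrier that] that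
          Q.submoduleD(2)[OF X_socle_submodule[OF Q.left_module_axioms brick_left_module]] by simp
      then show ?thesis unfolding W\<alpha> using False by (auto simp: W)
    qed
  qed
  show "W \<beta> = (\<Union>\<alpha>\<in>underS r \<beta>. W \<alpha>)" if l: "ord_limit r \<beta>"
  proof (cases "\<beta> \<in> under r \<nu>")
    case True
    have "\<alpha> \<in> under r \<nu>" if "\<alpha> \<in> underS r \<beta>" for \<alpha>
      using True that w.TRANS by (auto simp: under_def underS_def dest: transD)
    then show ?thesis using V_lim[OF True l] True by (simp add: W)
  next
    case False
    have "\<nu> \<in> underS r \<beta>" using above False l by (simp add: ord_limit_def)
    moreover have "W \<nu> = carrier N" using V\<nu> by (simp add: W)
    moreover have "W \<alpha> \<subseteq> carrier N" for \<alpha> by (rule N.submoduleD(1)[OF compatibleD(1)[OF comp]])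
    ultimately show ?thesis using False by (auto simp: W[of \<beta>])
  qed
qed

lemma mod_hom_socle_filtration:
  assumes M: "left_module R M" "X_chain R \<X> M \<C>" and N: "left_module R N" "X_chain R \<X> N \<D>"
    and f: "f \<in> mod_hom R M N"
    and V: "socle_filtration R \<X> M r \<mu> V" and U: "socle_filtration R \<X> N r \<nu> U"
    and \<alpha>: "\<alpha> \<in> under r \<mu>"
  shows "f ` V \<alpha> \<subseteq> continue_constant N r \<nu> U \<alpha>"
proof -
  interpret M: left_module R M by (rule M(1))
  interpret N: left_module R N by (rule N(1))
  let ?W = "continue_constant N r \<nu> U"
  note W = continue_constant_socle[OF N U]
  have r: "Well_order r" and \<mu>: "\<mu> \<in> Field r"
    and V0: "\<And>\<alpha>. \<alpha> \<in> under r \<mu> \<Longrightarrow> ord_zero r \<alpha> \<Longrightarrow> V \<alpha> = {\<zero>\<^bsub>M\<^esub>}"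
    and V_Suc: "\<And>\<alpha> \<beta>. \<beta> \<in> under r \<mu> \<Longrightarrow> ord_succ r \<alpha> \<beta> \<Longrightarrow>
      V \<beta> = {x \<in> carrier M. V \<alpha> +>\<^bsub>M\<^esub> x \<in> X_socle R \<X> (quot_module M (V \<alpha>))}"
    and V_lim: "\<And>\<beta>. \<beta> \<in> under r \<mu> \<Longrightarrow> ord_limit r \<beta> \<Longrightarrow> V \<beta> = (\<Union>\<alpha>\<in>underS r \<beta>. V \<alpha>)"
    using V by (simp_all add: socle_filtration_def)
  show ?thesis
    using r \<mu> \<alpha>
  proof (induction rule: well_order_induct_under)
    case (zero \<alpha>)
    then show ?case using V0 W(2)[OF zero(2)] mod_hom_zero[OF M(1) N(1) f] by simp
  next
    case (succ \<alpha> \<beta>)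
    have sV: "submodule (V \<alpha>) R M"
      using socle_filtration_compatible[OF M V succ(1)] compatibleD(1) by metis
    have sW: "submodule (?W \<alpha>) R N" by (rule compatibleD(1)[OF W(1)])
    note QM = M.quot_module_is_left_module[OF sV] and QN = N.quot_module_is_left_module[OF sW]
    note pM = M.proj_hom[OF sV] and pN = N.proj_hom[OF sW]
    have "((\<lambda>y. ?W \<alpha> +>\<^bsub>N\<^esub> y) \<circ> f) x = \<zero>\<^bsub>quot_module N (?W \<alpha>)\<^esub>"
      if "x \<in> carrier M" "V \<alpha> +>\<^bsub>M\<^esub> x = \<zero>\<^bsub>quot_module M (V \<alpha>)\<^esub>" for x
      using that M.coset_eq_zero_iff[OF sV that(1)] succ(4) N.coset_eq_zero_iff[OF sW mod_homD(1)[OF f that(1)]]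
      by auto
    then obtain k where k: "k \<in> mod_hom R (quot_module M (V \<alpha>)) (quot_module N (?W \<alpha>))"
      "\<And>x. x \<in> carrier M \<Longrightarrow> k (V \<alpha> +>\<^bsub>M\<^esub> x) = ?W \<alpha> +>\<^bsub>N\<^esub> f x"
      using mod_hom_factor[OF M(1) QN mod_hom_comp[OF f pN] QM pM M.carrier_quot_module[symmetric]]
      by auto
    show ?case
    proof
      fix y assume "y \<in> f ` V \<beta>"
      then obtain x where x: "x \<in> carrier M" "V \<alpha> +>\<^bsub>M\<^esub> x \<in> X_socle R \<X> (quot_module M (V \<alpha>))" "y = f x"
        unfolding V_Suc[OF succ(2,3)] by auto
      have "?W \<alpha> +>\<^bsub>N\<^esub> f x \<in> X_socle R \<X> (quot_module N (?W \<alpha>))"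
        using mod_hom_X_socle[OF QM QN brick_left_module k(1) x(2)] k(2)[OF x(1)] by simp
      then show "y \<in> ?W \<beta>" unfolding W(3)[OF succ(3)] using x mod_homD(1)[OF f] by simp
    qed
  next
    case (limit \<beta>)
    then show ?case unfolding V_lim[OF limit(1,2)] W(4)[OF limit(2)] by auto
  qed
qed

lemma image_socle_filtration:
  assumes MF: "M \<in> Filt R \<X>" and NF: "N \<in> Filt R \<X>" and f: "f \<in> mod_hom R M N"
    and V: "socle_filtration R \<X> M r \<mu> V" and U: "socle_filtration R \<X> N r \<nu> U"
  shows "socle_filtration R \<X> (N\<lparr>carrier := f ` carrier M\<rparr>) r \<mu>
    (\<lambda>\<alpha>. f ` carrier M \<inter> continue_constant N r \<nu> U \<alpha>)"
proof -
  obtain \<C> where M: "left_module R M" "X_chain R \<X> M \<C>" using MF by (rule FiltE)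
  obtain \<D> where N: "left_module R N" "X_chain R \<X> N \<D>" using NF by (rule FiltE)
  interpret M: left_module R M by (rule M(1))
  interpret N: left_module R N by (rule N(1))
  let ?W = "continue_constant N r \<nu> U" and ?J = "f ` carrier M"
  let ?I = "N\<lparr>carrier := ?J\<rparr>"
  note W = continue_constant_socle[OF N U]
  have IF: "?I \<in> Filt R \<X>" by (rule compatible_Filt(1)[OF N compatible_image[OF M N f]])
  then obtain \<E> where I: "left_module R ?I" "X_chain R \<X> ?I \<E>" by (rule FiltE)
  interpret I: left_module R ?I by (rule I(1))
  have sJ: "submodule ?J R N" by (rule submodule_image[OF M(1) N(1) f M.submodule_carrier])
  note JN = N.submoduleD(1)[OF sJ]
  note i = mod_hom_inclusion[OF JN, of R]
  have succ: "?J \<inter> ?W \<beta> = {x \<in> carrier ?I. (?J \<inter> ?W \<alpha>) +>\<^bsub>?I\<^esub> x \<in> X_socle R \<X> (quot_module ?I (?J \<inter> ?W \<alpha>))}"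
    if s: "ord_succ r \<alpha> \<beta>" for \<alpha> \<beta>
  proof -
    let ?K = "?J \<inter> ?W \<alpha>"
    let ?P = "quot_module ?I ?K" and ?Q = "quot_module N (?W \<alpha>)"
    have cW: "compatible R N \<D> (?W \<alpha>)" by (rule W(1))
    have "{x \<in> ?J. x \<in> ?W \<alpha>} = ?K" by auto
    then have cK: "compatible R ?I \<E> ?K" using compatible_preimage[OF I N i cW] by simp
    note sW = compatibleD(1)[OF cW] and sK = compatibleD(1)[OF cK]
    have P: "left_module R ?P" "X_chain R \<X> ?P ((`) (\<lambda>x. ?K +>\<^bsub>?I\<^esub> x) ` \<E>)"
      by (rule I.quot_module_is_left_module[OF sK], rule quotient_X_chain(1)[OF I cK])
    have Q: "left_module R ?Q" "X_chain R \<X> ?Q ((`) (\<lambda>x. ?W \<alpha> +>\<^bsub>N\<^esub> x) ` \<D>)"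
      by (rule N.quot_module_is_left_module[OF sW], rule quotient_X_chain(1)[OF N cW])
    have zero_iff: "?W \<alpha> +>\<^bsub>N\<^esub> x = \<zero>\<^bsub>?Q\<^esub> \<longleftrightarrow> ?K +>\<^bsub>?I\<^esub> x = \<zero>\<^bsub>?P\<^esub>" if "x \<in> ?J" for x
      using N.coset_eq_zero_iff[OF sW, of x] I.coset_eq_zero_iff[OF sK, of x] that JN by auto
    have g: "(\<lambda>x. ?W \<alpha> +>\<^bsub>N\<^esub> x) \<in> mod_hom R ?I ?Q"
      by (rule mod_hom_restrict[OF N.proj_hom[OF sW] JN])
    obtain j where j: "j \<in> mod_hom R ?P ?Q" "\<And>x. x \<in> carrier ?I \<Longrightarrow> j (?K +>\<^bsub>?I\<^esub> x) = ?W \<alpha> +>\<^bsub>N\<^esub> x"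
      using mod_hom_factor[OF I(1) Q(1) g P(1) I.proj_hom[OF sK] I.carrier_quot_module[symmetric]]
        zero_iff by auto
    have inj: "y = \<zero>\<^bsub>?P\<^esub>" if yP: "y \<in> carrier ?P" and y: "j y = \<zero>\<^bsub>?Q\<^esub>" for y
    proof -
      obtain x where x: "x \<in> carrier ?I" "y = ?K +>\<^bsub>?I\<^esub> x"
        using yP unfolding I.carrier_quot_module by auto
      then have "?W \<alpha> +>\<^bsub>N\<^esub> x = \<zero>\<^bsub>?Q\<^esub>" using y j(2) by simp
      then show ?thesis using zero_iff x by simp
    qed
    have "?W \<alpha> +>\<^bsub>N\<^esub> x \<in> X_socle R \<X> ?Q \<longleftrightarrow> ?K +>\<^bsub>?I\<^esub> x \<in> X_socle R \<X> ?P" if x: "x \<in> ?J" for x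
    proof -
      have "?K +>\<^bsub>?I\<^esub> x \<in> carrier ?P" unfolding I.carrier_quot_module using x by simp
      from inj_X_socle_iff[OF P Q j(1) inj this] show ?thesis using j(2) x by simp
    qed
    then show ?thesis unfolding W(3)[OF s] using JN by auto
  qed
  have r: "Well_order r" and \<mu>: "\<mu> \<in> Field r" and V\<mu>: "V \<mu> = carrier M"
    using V by (simp_all add: socle_filtration_def)
  have "\<mu> \<in> under r \<mu>" using wo_rel.REFL[of r] r \<mu> by (auto simp: wo_rel_def under_def refl_on_def)
  from mod_hom_socle_filtration[OF M N f V U this]
  have top: "?J \<subseteq> ?W \<mu>" unfolding V\<mu> .
  show ?thesis
    unfolding socle_filtration_def
  proof (intro conjI allI ballI impI)
    fix \<alpha> assume "ord_zero r \<alpha>"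
    then show "?J \<inter> ?W \<alpha> = {\<zero>\<^bsub>?I\<^esub>}" using W(2) N.submoduleD(2)[OF sJ] by auto
  next
    fix \<beta> assume "ord_limit r \<beta>"
    then show "?J \<inter> ?W \<beta> = (\<Union>\<alpha>\<in>underS r \<beta>. ?J \<inter> ?W \<alpha>)" using W(4) by auto
  next
    show "?J \<inter> ?W \<mu> = carrier ?I" using top by auto
  qed (use IF r \<mu> succ in auto)
qed

end

theorem proposition3p10:
  fixes R :: "'a ring" and \<X> :: "('a, 'b) module set"
    and M :: "('a, 'm) module" and N :: "('a, 'n) module" and f :: "'m \<Rightarrow> 'n"
  assumes "ring R" and "semibrick R \<X>"
    and "M \<in> Filt R \<X>" and "N \<in> Filt R \<X>"
    and "f \<in> mod_hom R M N"
  shows "(\<forall>A B. submodule A R N \<and> submodule B R N \<and>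
            N\<lparr>carrier := A\<rparr> \<in> Filt R \<X> \<and> N\<lparr>carrier := B\<rparr> \<in> Filt R \<X> \<longrightarrow>
            N\<lparr>carrier := A <+>\<^bsub>N\<^esub> B\<rparr> \<in> Filt R \<X> \<and> N\<lparr>carrier := A \<inter> B\<rparr> \<in> Filt R \<X>)
       \<and> (\<forall>(r :: 'i rel) \<mu> \<nu> Ms Ns.
            socle_filtration R \<X> M r \<mu> Ms \<and> socle_filtration R \<X> N r \<nu> Ns \<longrightarrow>
            socle_filtration R \<X> (N\<lparr>carrier := f ` carrier M\<rparr>) r \<mu>
              (\<lambda>\<alpha>. f ` carrier M \<inter> continue_constant N r \<nu> Ns \<alpha>))
       \<and> quot_module N (f ` carrier M) \<in> Filt R \<X>"
proof -
  interpret semibrick_modules R \<X> by unfold_locales (rule assms(2))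
  show ?thesis
    by (intro conjI allI impI; (elim conjE)?)
      (rule Filt_sum_Int[OF assms(4)] image_socle_filtration[OF assms(3-5)]
        Filt_cokernel[OF assms(3-5)]; assumption)+
qed

end
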